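(* Let $D\subset\mathbb{R}^d$ ($d\ge1$) be a bounded domain with $C^\infty$ boundary (an open bounded interval if $d=1$). Let $\gamma>\frac d4$ and let $\dot\xi$ be any symmetric Lévy white noise on $D$ with characteristic triplet $(b,\sigma,\nu)$. Then the problem $$(-\Delta)^\gamma u=\dot\xi\ \text{ in }D,\qquad u=0\ \text{ on }\partial D,$$ where $(-\Delta)^\gamma$ is the spectral power of the Dirichlet Laplacian, admits a unique mild solution $u=\{u(x);x\in D\}$. Moreover, $u$ is also a generalized solution, i.e. for every $\varphi\in\mathcal{D}(D)$, $$\int_Du(x)\varphi(x)\,dx=\Bigl\langle\dot\xi,\ \int_DG_\gamma(\cdot,y)\varphi(y)\,dy\Bigr\rangle\quad\text{a.s.},$$ where $G_\gamma$ is the Green function of $(-\Delta)^\gamma$.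
   Context: $(\Omega,\mathcal{F},\mathbb{P})$ is a complete probability space. $\mathcal{D}(D)=C_c^\infty(D)$. $\mathcal{B}(D)$ is the Borel $\sigma$-field and $|A|$ is the Lebesgue measure of $A$. $\{e_k\}_{k\ge1}$ is an orthonormal basis of $L^2(D)$ of eigenfunctions of the Dirichlet Laplacian, $-\Delta e_k=\lambda_ke_k$ in $D$, $e_k=0$ on $\partial D$, with eigenvalues $\lambda_k>0$, $\lambda_k\to\infty$. The spectral power is $(-\Delta)^\gamma h=\sum_{k\ge1}\lambda_k^\gamma\langle h,e_k\rangle_{L^2(D)}e_k$, and its Green function is $G_\gamma(x,y)=\sum_{k=1}^\infty\lambda_k^{-\gamma}e_k(x)e_k(y)$ (for $\gamma>d/4$ and fixed $x\in D$ understood as a function of $y$ in $L^2(D)$). Symmetric Lévy white noise with characteristic triplet $(b,\sigma,\nu)$: an independently scattered random measure $\dot\xi=\{\xi(A)\}_{A\in\mathcal{B}(D)}$ (i.e. for pairwise disjoint $A_1,A_2,\dots$ the variables $\xi(A_n)$ are independent and $\xi(\bigcup_nA_n)=\sum_n\xi(A_n)$ a.s.) with $$\mathbb{E}[e^{iu\xi(A)}]=\exp(|A|\Psi(u)),\qquad \Psi(u)=ibu-\frac{\sigma^2u^2}{2}+\int_{\mathbb{R}_0}\bigl(e^{iuz}-1-iuz\mathbf{1}_{\{|z|\le1\}}\bigr)\nu(dz),$$ where $b\in\mathbb{R}$, $\sigma\ge0$, $\mathbb{R}_0=\mathbb{R}\setminus\{0\}$, and $\nu$ is a measure on $\mathbb{R}_0$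 with $\int(|z|^2\wedge1)\nu(dz)<\infty$ and $\nu(A)=\nu(-A)$ for all Borel $A\subset\mathbb{R}_0$. Stochastic integral: for a simple function $f=\sum_{i=1}^n\alpha_i1_{A_i}$ (disjoint $A_i\in\mathcal{B}(D)$, $\alpha_i\in\mathbb{R}$) and $A\in\mathcal{B}(D)$, $\langle\dot\xi,f1_A\rangle=\sum_i\alpha_i\xi(A\cap A_i)$. A Borel function $f:D\to\mathbb{R}$ is $\dot\xi$-integrable if there are simple functions $f_n\to f$ a.e. such that for every $A\in\mathcal{B}(D)$ the sequence $\langle\dot\xi,f_n1_A\rangle$ converges in probability; then $\langle\dot\xi,f\rangle=\int_Df(x)\,\xi(dx)$ is the limit in probability of $\langle\dot\xi,f_n\rangle$. Mild solution: a process $u=\{u(x);x\in D\}$, measurable with respect to the $\sigma$-field on $\Omega\times D$ generated by $\mathcal{F}\times\mathcal{B}(D)$, such that for every $x\in D$ the function $G_\gamma(x,\cdot)$ is $\dot\xi$-integrable and $u(x)=\int_DG_\gamma(x,y)\,\xi(dy)$ a.s.; uniqueness is up to modification. *)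

theory Defs
  imports "HOL-Probability.Probability"
begin

section \<open>Domains and smooth functions\<close>

text \<open>Intended for open \<open>S\<close>; all iterated partial derivatives up to order \<open>k\<close> exist and are
  continuous.\<close>

primrec Ck_on :: "nat \<Rightarrow> ('a::euclidean_space \<Rightarrow> real) \<Rightarrow> 'a set \<Rightarrow> bool" where
  "Ck_on 0 f S \<longleftrightarrow> continuous_on S f"
| "Ck_on (Suc k) f S \<longleftrightarrow>
     (\<forall>x\<in>S. f differentiable at x) \<and>
     (\<forall>i\<in>Basis. Ck_on k (\<lambda>x. frechet_derivative f (at x) i) S)"

definition smooth_on :: "('a::euclidean_space \<Rightarrow> real) \<Rightarrow> 'a set \<Rightarrow> bool" where
  "smooth_on f S \<longleftrightarrow> (\<forall>k. Ck_on k f S)"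

definition test_function :: "'a::euclidean_space set \<Rightarrow> ('a \<Rightarrow> real) \<Rightarrow> bool" where
  "test_function D \<phi> \<longleftrightarrow>
     smooth_on \<phi> UNIV \<and> compact (closure {x. \<phi> x \<noteq> 0}) \<and> closure {x. \<phi> x \<noteq> 0} \<subseteq> D"

definition laplacian :: "('a::euclidean_space \<Rightarrow> real) \<Rightarrow> 'a \<Rightarrow> real" where
  "laplacian f x =
     (\<Sum>i\<in>Basis. frechet_derivative (\<lambda>y. frechet_derivative f (at y) i) (at x) i)"

text \<open>Near each boundary point, \<open>D\<close> is, after a rotation of the coordinate axes, the region
  strictly above the graph of a smooth function \<open>h\<close> of the coordinates orthogonal to the
  vertical unit vector \<open>n\<close>. The argument \<open>x - (x \<bullet> n) *\<^sub>R n\<close> is the orthogonal projection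
  of \<open>x\<close> onto the hyperplane orthogonal to \<open>n\<close>. In dimension one that projection is \<open>0\<close>, so
  the condition says that \<open>D\<close> is locally a half-line, and together with openness,
  connectedness and boundedness it describes exactly the nonempty bounded open intervals.\<close>

definition smooth_boundary :: "'a::euclidean_space set \<Rightarrow> bool" where
  "smooth_boundary D \<longleftrightarrow>
     (\<forall>x0\<in>frontier D. \<exists>r>0. \<exists>n h. norm n = 1 \<and> smooth_on h UNIV \<and>
        D \<inter> ball x0 r = {x \<in> ball x0 r. h (x - (x \<bullet> n) *\<^sub>R n) < x \<bullet> n})"

definition smooth_bounded_domain :: "'a::euclidean_space set \<Rightarrow> bool" where
  "smooth_bounded_domain D \<longleftrightarrow>
     open D \<and> connected D \<and> D \<noteq> {} \<and> bounded D \<and> smooth_boundary D"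


section \<open>Dirichlet eigenbasis and Green function\<close>

text \<open>Lebesgue measure on the Borel sets of \<open>D\<close>. Measurable functions for it are exactly the
  Borel functions on \<open>D\<close>.\<close>

abbreviation leb_on :: "'a::euclidean_space set \<Rightarrow> 'a measure" where
  "leb_on D \<equiv> restrict_space lborel D"

definition L2_fun :: "'a::euclidean_space set \<Rightarrow> ('a \<Rightarrow> real) \<Rightarrow> bool" where
  "L2_fun D f \<longleftrightarrow> f \<in> borel_measurable (leb_on D) \<and> integrable (leb_on D) (\<lambda>x. (f x)\<^sup>2)"

definition L2_inner :: "'a::euclidean_space set \<Rightarrow> ('a \<Rightarrow> real) \<Rightarrow> ('a \<Rightarrow> real) \<Rightarrow> real" where
  "L2_inner D f g = (LINT x|leb_on D. f x * g x)"

definition L2_tendsto ::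
    "'a::euclidean_space set \<Rightarrow> (nat \<Rightarrow> 'a \<Rightarrow> real) \<Rightarrow> ('a \<Rightarrow> real) \<Rightarrow> bool" where
  "L2_tendsto D f g \<longleftrightarrow> (\<lambda>n. LINT x|leb_on D. (f n x - g x)\<^sup>2) \<longlonglongrightarrow> 0"

definition L2_orthonormal_basis :: "'a::euclidean_space set \<Rightarrow> (nat \<Rightarrow> 'a \<Rightarrow> real) \<Rightarrow> bool" where
  "L2_orthonormal_basis D e \<longleftrightarrow>
     (\<forall>k. L2_fun D (e k)) \<and>
     (\<forall>j k. L2_inner D (e j) (e k) = (if j = k then 1 else 0)) \<and>
     (\<forall>h. L2_fun D h \<longrightarrow> L2_tendsto D (\<lambda>n y. \<Sum>k<n. L2_inner D h (e k) * e k y) h)"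

text \<open>The index \<open>k\<close> starts at \<open>0\<close>. Eigenfunctions are classical, so that their point values
  make sense: twice continuously differentiable in \<open>D\<close>, with continuous extension by \<open>0\<close> to the
  boundary. On a smooth domain elliptic regularity makes this no restriction.\<close>

definition dirichlet_eigenbasis ::
    "'a::euclidean_space set \<Rightarrow> (nat \<Rightarrow> 'a \<Rightarrow> real) \<Rightarrow> (nat \<Rightarrow> real) \<Rightarrow> bool" where
  "dirichlet_eigenbasis D e lam \<longleftrightarrow>
     L2_orthonormal_basis D e \<and>
     (\<forall>k. Ck_on 2 (e k) D \<and> continuous_on (closure D) (e k) \<and>
          (\<forall>x\<in>D. - laplacian (e k) x = lam k * e k x) \<and>
          (\<forall>x\<in>frontier D. e k x = 0)) \<and>
     (\<forall>k. 0 < lam k) \<and> filterlim lam at_top sequentially"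

text \<open>A Borel representative of the sum in \<open>L\<^sup>2(D)\<close>, as a function of \<open>y\<close>, of
  \<open>\<Sum>k. (lam k) powr (-\<gamma>) * e k x * e k y\<close>. It is unspecified if the series diverges in
  \<open>L\<^sup>2(D)\<close>.\<close>

definition green ::
    "'a::euclidean_space set \<Rightarrow> (nat \<Rightarrow> 'a \<Rightarrow> real) \<Rightarrow> (nat \<Rightarrow> real) \<Rightarrow> real \<Rightarrow> 'a \<Rightarrow> 'a \<Rightarrow> real" where
  "green D e lam \<gamma> x =
     (SOME g. L2_fun D g \<and>
        L2_tendsto D (\<lambda>n y. \<Sum>k<n. lam k powr (- \<gamma>) * e k x * e k y) g)"


section \<open>Symmetric Levy white noise\<close>

definition symmetric_levy_measure :: "real measure \<Rightarrow> bool" where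
  "symmetric_levy_measure \<nu> \<longleftrightarrow>
     sets \<nu> = sets (restrict_space borel (- {0})) \<and>
     (\<integral>\<^sup>+ z. ennreal (min (z\<^sup>2) 1) \<partial>\<nu>) < \<infinity> \<and>
     (\<forall>A\<in>sets \<nu>. emeasure \<nu> (uminus ` A) = emeasure \<nu> A)"

definition levy_exponent :: "real \<Rightarrow> real \<Rightarrow> real measure \<Rightarrow> real \<Rightarrow> complex" where
  "levy_exponent b \<sigma> \<nu> u =
     \<i> * of_real (b * u) - of_real (\<sigma>\<^sup>2 * u\<^sup>2 / 2) +
     (CLINT z|\<nu>. iexp (u * z) - 1 - \<i> * of_real (u * z * indicator {z. \<bar>z\<bar> \<le> 1} z))"

definition symmetric_levy_noise ::
    "'w measure \<Rightarrow> 'a::euclidean_space set \<Rightarrow> real \<Rightarrow> real \<Rightarrow> real measure \<Rightarrow>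
     ('a set \<Rightarrow> 'w \<Rightarrow> real) \<Rightarrow> bool" where
  "symmetric_levy_noise M D b \<sigma> \<nu> \<xi> \<longleftrightarrow>
     0 \<le> \<sigma> \<and> symmetric_levy_measure \<nu> \<and>
     (\<forall>A\<in>sets (leb_on D). \<xi> A \<in> borel_measurable M) \<and>
     (\<forall>A. range A \<subseteq> sets (leb_on D) \<and> disjoint_family A \<longrightarrow>
        prob_space.indep_vars M (\<lambda>_. borel) (\<lambda>n::nat. \<xi> (A n)) UNIV \<and>
        (AE \<omega> in M. (\<lambda>n. \<xi> (A n) \<omega>) sums \<xi> (\<Union>n. A n) \<omega>)) \<and>
     (\<forall>A\<in>sets (leb_on D). \<forall>u.
        (CLINT \<omega>|M. iexp (u * \<xi> A \<omega>)) =
        exp (of_real (measure lborel A) * levy_exponent b \<sigma> \<nu> u))"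


section \<open>Stochastic integral\<close>

definition conv_in_prob :: "'w measure \<Rightarrow> (nat \<Rightarrow> 'w \<Rightarrow> real) \<Rightarrow> ('w \<Rightarrow> real) \<Rightarrow> bool" where
  "conv_in_prob M X Y \<longleftrightarrow>
     (\<forall>n. X n \<in> borel_measurable M) \<and> Y \<in> borel_measurable M \<and>
     (\<forall>\<epsilon>>0. (\<lambda>n. measure M {\<omega>\<in>space M. \<epsilon> < \<bar>X n \<omega> - Y \<omega>\<bar>}) \<longlonglongrightarrow> 0)"

text \<open>The integral of the simple function \<open>f\<close> times the indicator of \<open>A\<close>, computed from the
  representation of \<open>f\<close> by its distinct values on \<open>D\<close>. By additivity of \<open>\<xi>\<close>, any other
  representation with disjoint Borel sets gives the same random variable almost surely.\<close>

definition simple_noise_integral ::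
    "'a set \<Rightarrow> ('a set \<Rightarrow> 'w \<Rightarrow> real) \<Rightarrow> ('a \<Rightarrow> real) \<Rightarrow> 'a set \<Rightarrow> 'w \<Rightarrow> real" where
  "simple_noise_integral D \<xi> f A \<omega> = (\<Sum>\<alpha>\<in>f ` D. \<alpha> * \<xi> (A \<inter> {x\<in>D. f x = \<alpha>}) \<omega>)"

definition noise_approx ::
    "'w measure \<Rightarrow> 'a::euclidean_space set \<Rightarrow> ('a set \<Rightarrow> 'w \<Rightarrow> real) \<Rightarrow> ('a \<Rightarrow> real) \<Rightarrow>
     (nat \<Rightarrow> 'a \<Rightarrow> real) \<Rightarrow> bool" where
  "noise_approx M D \<xi> f F \<longleftrightarrow>
     (\<forall>n. simple_function (leb_on D) (F n)) \<and>
     (AE x in leb_on D. (\<lambda>n. F n x) \<longlonglongrightarrow> f x) \<and>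
     (\<forall>A\<in>sets (leb_on D). \<exists>Y. conv_in_prob M (\<lambda>n. simple_noise_integral D \<xi> (F n) A) Y)"

definition noise_integrable ::
    "'w measure \<Rightarrow> 'a::euclidean_space set \<Rightarrow> ('a set \<Rightarrow> 'w \<Rightarrow> real) \<Rightarrow> ('a \<Rightarrow> real) \<Rightarrow> bool" where
  "noise_integrable M D \<xi> f \<longleftrightarrow>
     f \<in> borel_measurable (leb_on D) \<and> (\<exists>F. noise_approx M D \<xi> f F)"

text \<open>A version of the stochastic integral: it is determined only up to almost sure equality,
  and is unspecified if \<open>f\<close> is not integrable with respect to \<open>\<xi>\<close>.\<close>

definition noise_integral ::
    "'w measure \<Rightarrow> 'a::euclidean_space set \<Rightarrow> ('a set \<Rightarrow> 'w \<Rightarrow> real) \<Rightarrow> ('a \<Rightarrow> real) \<Rightarrow> 'w \<Rightarrow> real" where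
  "noise_integral M D \<xi> f =
     (SOME Y. \<exists>F. noise_approx M D \<xi> f F \<and>
        conv_in_prob M (\<lambda>n. simple_noise_integral D \<xi> (F n) D) Y)"


section \<open>Solutions\<close>

text \<open>For the solution notions below, \<open>G\<close> is the Green function of the operator.\<close>

definition mild_solution ::
    "'w measure \<Rightarrow> 'a::euclidean_space set \<Rightarrow> ('a \<Rightarrow> 'a \<Rightarrow> real) \<Rightarrow> ('a set \<Rightarrow> 'w \<Rightarrow> real) \<Rightarrow>
     ('a \<Rightarrow> 'w \<Rightarrow> real) \<Rightarrow> bool" where
  "mild_solution M D G \<xi> u \<longleftrightarrow>
     (\<lambda>(\<omega>, x). u x \<omega>) \<in> borel_measurable (M \<Otimes>\<^sub>M restrict_space borel D) \<and>
     (\<forall>x\<in>D. noise_integrable M D \<xi> (G x) \<and> (AE \<omega> in M. u x \<omega> = noise_integral M D \<xi> (G x) \<omega>))"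

definition modification_of ::
    "'w measure \<Rightarrow> 'a set \<Rightarrow> ('a \<Rightarrow> 'w \<Rightarrow> real) \<Rightarrow> ('a \<Rightarrow> 'w \<Rightarrow> real) \<Rightarrow> bool" where
  "modification_of M D u v \<longleftrightarrow> (\<forall>x\<in>D. AE \<omega> in M. u x \<omega> = v x \<omega>)"

text \<open>The integrability clauses make both sides of the identity meaningful, since integrals are
  total functions here.\<close>

definition generalized_solution ::
    "'w measure \<Rightarrow> 'a::euclidean_space set \<Rightarrow> ('a \<Rightarrow> 'a \<Rightarrow> real) \<Rightarrow> ('a set \<Rightarrow> 'w \<Rightarrow> real) \<Rightarrow>
     ('a \<Rightarrow> 'w \<Rightarrow> real) \<Rightarrow> bool" where
  "generalized_solution M D G \<xi> u \<longleftrightarrow>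
     (\<forall>\<phi>. test_function D \<phi> \<longrightarrow>
        noise_integrable M D \<xi> (\<lambda>x. LINT y|leb_on D. G x y * \<phi> y) \<and>
        (AE \<omega> in M. integrable (leb_on D) (\<lambda>x. u x \<omega> * \<phi> x) \<and>
           (LINT x|leb_on D. u x \<omega> * \<phi> x) =
             noise_integral M D \<xi> (\<lambda>x. LINT y|leb_on D. G x y * \<phi> y) \<omega>))"

end

theory Submission
  imports Defs "HOL-Real_Asymp.Real_Asymp"
begin

text \<open>
  Independence enters only through the characteristic function of the integral of a simple
  function \<open>f\<close>, which is \<open>exp (\<integral> \<Psi> (u * f))\<close>. For every \<open>\<eta> > 0\<close> there is \<open>C\<close> with
  \<open>\<bar>\<Psi> v\<bar> \<le> \<eta> + C * v\<^sup>2\<close>, so the integral extends to \<open>L\<^sup>2(D)\<close> and is continuous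
  from \<open>L\<^sup>2(D)\<close> into convergence in probability, although it may have no moments.

  \<open>G x\<close> lies in \<open>L\<^sup>2(D)\<close> for every \<open>x\<close> because of the bound \<open>C * r powr (-d)\<close> on the sum of
  \<open>(e k x)\<^sup>2\<close> over \<open>lam k \<le> r powr (-2)\<close>, locally uniformly in \<open>x\<close>. It follows from the mean value
  property of the harmonic functions \<open>e k y * cosh (sqrt (lam k) * s)\<close> in one more variable and
  from Bessel's inequality. Summing over dyadic ranges of \<open>lam k\<close> uses exactly \<open>\<gamma> > d / 4\<close>.

  For the generalized solution the partial sums of \<open>u\<close> have to converge in \<open>L\<^sup>2(K)\<close> for compact
  \<open>K\<close>, not only pointwise in \<open>x\<close>. Their norms are controlled through \<open>E exp (- \<parallel>U\<parallel>\<^sup>2 / 2)\<close>: expand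
  \<open>\<parallel>U\<parallel>\<^sup>2\<close> by Parseval and write each factor \<open>exp (- Z\<^sup>2 / 2)\<close> as the average of \<open>iexp (g * Z)\<close> over
  a Gaussian \<open>g\<close>. This leaves characteristic functions of integrals of \<open>L\<^sup>2\<close> functions.
\<close>

section \<open>Convergence in probability\<close>

text \<open>Two features of the definitions shape the proof. \<open>noise_integral\<close> is a
  choice over all approximating sequences that converge almost everywhere, not only over those that
  converge in L2. The L2 estimates therefore say nothing about the chosen sequence until
  \<open>SI_limit_zero\<close> has shown that any two admissible sequences have almost surely the
  same limit. And since the noise may have no moments, the integral in x and the noise are not
  interchanged by a Fubini argument; both sides of the generalized identity are recognised as limits
  in probability of the same finite sums \<open>pairing\<close>.

  The constant \<eta> in the bound for the exponent is harmless because it enters only multiplied by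
  the finite volume of \<open>D\<close> and does not accumulate over the terms of an expansion.

  The extra variable turns the eigenvalue equation into Laplace's equation, so one mean value
  identity serves all k; the restriction on \<open>lam k\<close> keeps the hyperbolic cosine bounded
  on the ball. The resulting bounds depend on the distance to the boundary, which is why the
  solution is estimated on compact subsets of \<open>D\<close>.\<close>

lemma AE_summable_of_integral_bound:
  fixes f :: "nat \<Rightarrow> 'b \<Rightarrow> real"
  assumes int: "\<And>n. integrable M (f n)" and nonneg: "\<And>n x. 0 \<le> f n x"
    and bound: "\<And>n. (LINT x|M. f n x) \<le> c n" and c: "summable c"
  shows "AE x in M. summable (\<lambda>n. f n x)"
proof -
  have c0: "0 \<le> c n" for n
    using bound[of n] Bochner_Integration.integral_nonneg[of M "f n"] nonneg by (meson order_trans)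
  have [measurable]: "f n \<in> borel_measurable M" for n using int by auto
  have "(\<integral>\<^sup>+x. (\<Sum>n. ennreal (f n x)) \<partial>M) = (\<Sum>n. \<integral>\<^sup>+x. ennreal (f n x) \<partial>M)"
    by (rule nn_integral_suminf) auto
  also have "\<dots> = (\<Sum>n. ennreal (LINT x|M. f n x))"
    using int nonneg by (simp add: nn_integral_eq_integral)
  also have "\<dots> \<le> (\<Sum>n. ennreal (c n))"
    by (intro suminf_le) (auto intro!: ennreal_leI bound)
  also have "\<dots> = ennreal (\<Sum>n. c n)" by (rule suminf_ennreal2[OF c0 c])
  finally have "(\<integral>\<^sup>+x. (\<Sum>n. ennreal (f n x)) \<partial>M) \<noteq> \<infinity>" by (auto simp: top_unique)
  then have "AE x in M. (\<Sum>n. ennreal (f n x)) \<noteq> \<infinity>"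
    by (intro nn_integral_PInf_AE) auto
  then show ?thesis
    by eventually_elim (use nonneg in \<open>auto intro!: summable_suminf_not_top\<close>)
qed

text \<open>Summable terms tend to 0, so the truncation at 1 is eventually inactive. This removes
  the cut-off that a possible lack of moments makes necessary.\<close>

lemma summable_of_summable_min:
  fixes a :: "nat \<Rightarrow> real"
  assumes "summable (\<lambda>n. min 1 \<bar>a n\<bar>)"
  shows "summable (\<lambda>n. \<bar>a n\<bar>)"
proof -
  have "(\<lambda>n. min 1 \<bar>a n\<bar>) \<longlonglongrightarrow> 0" by (rule summable_LIMSEQ_zero[OF assms])
  then have "eventually (\<lambda>n. min 1 \<bar>a n\<bar> < 1) sequentially"
    by (rule order_tendstoD) simp
  then have "eventually (\<lambda>n. min 1 \<bar>a n\<bar> = \<bar>a n\<bar>) sequentially"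
    by eventually_elim linarith
  from summable_cong[OF this] assms show ?thesis by simp
qed

lemma norm_integral_le:
  fixes f :: "'b \<Rightarrow> 'c::{banach, second_countable_topology}"
  assumes "integrable M f" "integrable M g" "\<And>x. x \<in> space M \<Longrightarrow> norm (f x) \<le> g x"
  shows "norm (LINT x|M. f x) \<le> (LINT x|M. g x)"
  using assms by (intro order_trans[OF integral_norm_bound] integral_mono) auto

text \<open>Combines the Lipschitz bound, used for differences up to 1, with the trivial bound 2
  beyond; hence the factor \<open>2 + \<bar>u\<bar>\<close>. It makes characteristic functions
  Lipschitz in the truncated metric \<open>prob_dist\<close>.\<close>

lemma norm_iexp_diff_le: "cmod (iexp (u * x) - iexp (u * y)) \<le> (2 + \<bar>u\<bar>) * min 1 \<bar>x - y\<bar>"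
proof -
  have "iexp (u * x) - iexp (u * y) = iexp (u * y) * (iexp (u * (x - y)) - 1)"
    by (simp add: right_diff_distrib mult_exp_exp del: exp_of_real)
  then have eq: "cmod (iexp (u * x) - iexp (u * y)) = cmod (iexp (u * (x - y)) - 1)"
    by (simp add: norm_mult)
  have 1: "cmod (iexp (u * (x - y)) - 1) \<le> \<bar>u\<bar> * \<bar>x - y\<bar>"
    using iexp_approx1[of "u * (x - y)" 0] by (simp add: abs_mult)
  have 2: "cmod (iexp (u * (x - y)) - 1) \<le> 2"
    using iexp_approx2[of "u * (x - y)" 0] by simp
  show ?thesis
  proof (cases "\<bar>x - y\<bar> \<le> 1")
    case True
    have "\<bar>u\<bar> * \<bar>x - y\<bar> \<le> (2 + \<bar>u\<bar>) * \<bar>x - y\<bar>" by (intro mult_right_mono) auto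
    then show ?thesis using True 1 eq by (simp add: min_def)
  next
    case False
    then show ?thesis using 2 eq by (simp add: min_def)
  qed
qed

text \<open>From exp(-t) \<le> 1/(1+t) at t = x^2/2 one gets 1 - exp(-t) \<ge> x^2/(2+x^2). That
  quotient is at least a third of the left side, with equality at x^2 = 1.\<close>

lemma min_sq_le_gauss: "(min 1 \<bar>x\<bar>)\<^sup>2 \<le> 3 * (1 - exp (- x\<^sup>2 / 2))" for x :: real
proof -
  have e: "exp (- x\<^sup>2 / 2) \<le> 1 / (1 + x\<^sup>2 / 2)"
  proof -
    have "1 + x\<^sup>2 / 2 \<le> exp (x\<^sup>2 / 2)" by (rule exp_ge_add_one_self)
    moreover have "0 < 1 + x\<^sup>2 / 2" by (simp add: add_pos_nonneg)
    ultimately have "inverse (exp (x\<^sup>2 / 2)) \<le> inverse (1 + x\<^sup>2 / 2)" by (intro le_imp_inverse_le)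
    moreover have "exp (- x\<^sup>2 / 2) = inverse (exp (x\<^sup>2 / 2))" by (simp flip: exp_minus)
    ultimately show ?thesis by (simp only: inverse_eq_divide)
  qed
  have pos: "0 < 2 + x\<^sup>2" by (simp add: add_pos_nonneg)
  have "1 / (1 + x\<^sup>2 / 2) = 2 / (2 + x\<^sup>2)" using pos by (simp add: field_simps)
  then have *: "3 * (x\<^sup>2 / (2 + x\<^sup>2)) \<le> 3 * (1 - exp (- x\<^sup>2 / 2))"
    using e pos by (simp add: field_simps)
  have "(min 1 \<bar>x\<bar>)\<^sup>2 \<le> 3 * (x\<^sup>2 / (2 + x\<^sup>2))"
  proof (cases "\<bar>x\<bar> \<le> 1")
    case True
    then have "x\<^sup>2 \<le> 1" by (simp add: abs_square_le_1)
    then have "x\<^sup>2 * (2 + x\<^sup>2) \<le> x\<^sup>2 * 3" by (intro mult_left_mono) auto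
    then show ?thesis using True pos by (simp add: min_def field_simps)
  next
    case False
    then have "1 \<le> x\<^sup>2" by (metis abs_le_square_iff abs_one linear one_power2)
    then show ?thesis using False pos by (simp add: min_def field_simps)
  qed
  with * show ?thesis by linarith
qed

lemma min_one_le_exp:
  fixes s :: real
  assumes "0 \<le> s" shows "min 1 s \<le> 3 * (1 - exp (- s / 2))"
proof -
  have "(min 1 \<bar>sqrt s\<bar>)\<^sup>2 \<le> 3 * (1 - exp (- (sqrt s)\<^sup>2 / 2))" by (rule min_sq_le_gauss)
  moreover have "(min 1 \<bar>sqrt s\<bar>)\<^sup>2 = min 1 s"
    using assms by (cases "s \<le> 1") (auto simp: min_def)
  ultimately show ?thesis using assms by simp
qed

text \<open>A metric for convergence in probability, up to almost sure equality. Truncation keeps it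
  finite without moments; it obeys an exact triangle inequality, and summable distances give almost
  sure convergence.\<close>

definition prob_dist :: "'w measure \<Rightarrow> ('w \<Rightarrow> real) \<Rightarrow> ('w \<Rightarrow> real) \<Rightarrow> real" where
  "prob_dist M X Y = (LINT \<omega>|M. min 1 \<bar>X \<omega> - Y \<omega>\<bar>)"

context prob_space
begin

lemma integrable_min_one [simp]:
  fixes X :: "'a \<Rightarrow> real"
  assumes "X \<in> borel_measurable M"
  shows "integrable M (\<lambda>\<omega>. min 1 \<bar>X \<omega>\<bar>)"
  using assms by (intro integrable_const_bound[where B=1]) auto

lemma prob_dist_nonneg: "0 \<le> prob_dist M X Y"
  unfolding prob_dist_def by (intro Bochner_Integration.integral_nonneg) auto

lemma prob_dist_commute: "prob_dist M X Y = prob_dist M Y X"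
  unfolding prob_dist_def by (simp add: abs_minus_commute)

lemma prob_dist_cong_AE:
  assumes [measurable]: "X \<in> borel_measurable M" "X' \<in> borel_measurable M"
    "Y \<in> borel_measurable M" "Y' \<in> borel_measurable M"
    and "AE \<omega> in M. X \<omega> = X' \<omega>" "AE \<omega> in M. Y \<omega> = Y' \<omega>"
  shows "prob_dist M X Y = prob_dist M X' Y'"
  unfolding prob_dist_def
proof (rule integral_cong_AE)
  show "AE \<omega> in M. min 1 \<bar>X \<omega> - Y \<omega>\<bar> = min 1 \<bar>X' \<omega> - Y' \<omega>\<bar>"
    using assms(5,6) by eventually_elim auto
qed auto

lemma prob_dist_triangle:
  assumes [measurable]: "X \<in> borel_measurable M" "Y \<in> borel_measurable M" "Z \<in> borel_measurable M"
  shows "prob_dist M X Z \<le> prob_dist M X Y + prob_dist M Y Z"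
proof -
  have "prob_dist M X Z \<le> (LINT \<omega>|M. min 1 \<bar>X \<omega> - Y \<omega>\<bar> + min 1 \<bar>Y \<omega> - Z \<omega>\<bar>)"
    unfolding prob_dist_def by (intro integral_mono) auto
  also have "\<dots> = prob_dist M X Y + prob_dist M Y Z"
    unfolding prob_dist_def by (intro Bochner_Integration.integral_add) auto
  finally show ?thesis .
qed

lemma prob_dist_eq_0_imp_AE:
  assumes [measurable]: "X \<in> borel_measurable M" "Y \<in> borel_measurable M"
    and "prob_dist M X Y = 0"
  shows "AE \<omega> in M. X \<omega> = Y \<omega>"
proof -
  have "AE \<omega> in M. min 1 \<bar>X \<omega> - Y \<omega>\<bar> = 0"
    using assms(3) unfolding prob_dist_def
    by (subst (asm) integral_nonneg_eq_0_iff_AE) auto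
  then show ?thesis by eventually_elim (auto simp: min_def split: if_splits)
qed

text \<open>Forward, the difference is split at level \<open>a/2\<close>. Backward, Markov's
  inequality is applied to the truncated difference, whence the divisor
  \<open>min 1 \<epsilon>\<close>.\<close>

lemma conv_in_prob_iff:
  "conv_in_prob M X Y \<longleftrightarrow>
     (\<forall>n. X n \<in> borel_measurable M) \<and> Y \<in> borel_measurable M \<and>
     (\<lambda>n. prob_dist M (X n) Y) \<longlonglongrightarrow> 0" (is "?L \<longleftrightarrow> ?R")
proof
  assume L: ?L
  then have [measurable]: "X n \<in> borel_measurable M" "Y \<in> borel_measurable M" for n
    by (auto simp: conv_in_prob_def)
  have "(\<lambda>n. prob_dist M (X n) Y) \<longlonglongrightarrow> 0"
  proof (rule order_tendstoI)
    fix a :: real assume "a < 0"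
    then show "\<forall>\<^sub>F n in sequentially. a < prob_dist M (X n) Y"
      using prob_dist_nonneg by (intro always_eventually allI) (meson less_le_trans)
  next
    fix a :: real assume a: "0 < a"
    have bound: "prob_dist M (X n) Y \<le> a/2 + prob {\<omega>\<in>space M. a/2 < \<bar>X n \<omega> - Y \<omega>\<bar>}" for n
    proof -
      define S where "S = {\<omega>\<in>space M. a/2 < \<bar>X n \<omega> - Y \<omega>\<bar>}"
      have [measurable]: "S \<in> sets M" unfolding S_def by measurable
      have int: "integrable M (indicator S :: 'a \<Rightarrow> real)"
        by (rule integrable_real_indicator) (simp_all add: emeasure_eq_measure)
      have "prob_dist M (X n) Y \<le> (LINT \<omega>|M. a/2 + indicator S \<omega>)"
        unfolding prob_dist_def
      proof (intro integral_mono)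
        fix \<omega> assume "\<omega> \<in> space M"
        show "min 1 \<bar>X n \<omega> - Y \<omega>\<bar> \<le> a/2 + indicator S \<omega>"
        proof (cases "\<omega> \<in> S")
          case True
          then show ?thesis using a by (intro min.coboundedI1) simp
        next
          case False
          then have "\<bar>X n \<omega> - Y \<omega>\<bar> \<le> a/2" using \<open>\<omega> \<in> space M\<close> by (simp add: S_def not_less)
          then show ?thesis using False by (intro min.coboundedI2) simp
        qed
      qed (use int in auto)
      also have "\<dots> = a/2 + prob S"
        using int by (simp add: prob_space)
      finally show ?thesis by (simp add: S_def)
    qed
    have "(\<lambda>n. prob {\<omega>\<in>space M. a/2 < \<bar>X n \<omega> - Y \<omega>\<bar>}) \<longlonglongrightarrow> 0"
      using L half_gt_zero[OF a] unfolding conv_in_prob_def by blast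
    then have "\<forall>\<^sub>F n in sequentially. prob {\<omega>\<in>space M. a/2 < \<bar>X n \<omega> - Y \<omega>\<bar>} < a/2"
      by (rule order_tendstoD) (use a in simp)
    then show "\<forall>\<^sub>F n in sequentially. prob_dist M (X n) Y < a"
    proof eventually_elim
      case (elim n)
      then show ?case using bound[of n] by linarith
    qed
  qed
  with L show ?R unfolding conv_in_prob_def by blast
next
  assume R: ?R
  then have [measurable]: "X n \<in> borel_measurable M" "Y \<in> borel_measurable M" for n by auto
  have "(\<lambda>n. prob {\<omega>\<in>space M. \<epsilon> < \<bar>X n \<omega> - Y \<omega>\<bar>}) \<longlonglongrightarrow> 0" if \<epsilon>: "\<epsilon> > 0" for \<epsilon>
  proof (rule tendsto_sandwich[OF _ _ tendsto_const])
    show "(\<lambda>n. prob_dist M (X n) Y / min 1 \<epsilon>) \<longlonglongrightarrow> 0"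
      using R by (intro tendsto_divide_zero) blast
    show "\<forall>\<^sub>F n in sequentially. 0 \<le> prob {\<omega>\<in>space M. \<epsilon> < \<bar>X n \<omega> - Y \<omega>\<bar>}" by simp
    show "\<forall>\<^sub>F n in sequentially. prob {\<omega>\<in>space M. \<epsilon> < \<bar>X n \<omega> - Y \<omega>\<bar>} \<le> prob_dist M (X n) Y / min 1 \<epsilon>"
    proof (intro always_eventually allI)
      fix n
      define S where "S = {\<omega>\<in>space M. \<epsilon> < \<bar>X n \<omega> - Y \<omega>\<bar>}"
      have [measurable]: "S \<in> sets M" unfolding S_def by measurable
      have int: "integrable M (indicator S :: 'a \<Rightarrow> real)"
        by (rule integrable_real_indicator) (simp_all add: emeasure_eq_measure)
      have "min 1 \<epsilon> * prob S = (LINT \<omega>|M. min 1 \<epsilon> * indicator S \<omega>)" by simp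
      also have "\<dots> \<le> prob_dist M (X n) Y"
        unfolding prob_dist_def
      proof (intro integral_mono)
        fix \<omega>
        show "min 1 \<epsilon> * indicator S \<omega> \<le> min 1 \<bar>X n \<omega> - Y \<omega>\<bar>"
          using \<epsilon> by (cases "\<omega> \<in> S") (auto simp: S_def intro: min.coboundedI2)
      qed (use int in auto)
      finally show "prob {\<omega>\<in>space M. \<epsilon> < \<bar>X n \<omega> - Y \<omega>\<bar>} \<le> prob_dist M (X n) Y / min 1 \<epsilon>"
        using \<epsilon> by (simp add: field_simps S_def)
    qed
  qed
  with R show ?L unfolding conv_in_prob_def by blast
qed

lemma conv_in_prob_unique:
  assumes "conv_in_prob M X Y" "conv_in_prob M X Z"
  shows "AE \<omega> in M. Y \<omega> = Z \<omega>"
proof (rule prob_dist_eq_0_imp_AE)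
  have [measurable]: "X n \<in> borel_measurable M" "Y \<in> borel_measurable M" "Z \<in> borel_measurable M" for n
    using assms by (auto simp: conv_in_prob_iff)
  have "(\<lambda>n. prob_dist M (X n) Y + prob_dist M (X n) Z) \<longlonglongrightarrow> 0 + 0"
    using assms by (intro tendsto_add) (auto simp: conv_in_prob_iff)
  moreover have "prob_dist M Y Z \<le> prob_dist M (X n) Y + prob_dist M (X n) Z" for n
    using prob_dist_triangle[of Y "X n" Z] by (simp add: prob_dist_commute)
  ultimately have "prob_dist M Y Z \<le> 0"
    by (intro LIMSEQ_le_const[where X="\<lambda>n. prob_dist M (X n) Y + prob_dist M (X n) Z"]) auto
  then show "prob_dist M Y Z = 0" using prob_dist_nonneg[of Y Z] by simp
qed (use assms in \<open>auto simp: conv_in_prob_iff\<close>)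

lemma conv_in_prob_cong_AE:
  assumes "conv_in_prob M X Y" and [measurable]: "\<And>n. X' n \<in> borel_measurable M" "Y' \<in> borel_measurable M"
    and "\<And>n. AE \<omega> in M. X n \<omega> = X' n \<omega>" "AE \<omega> in M. Y \<omega> = Y' \<omega>"
  shows "conv_in_prob M X' Y'"
proof -
  have [measurable]: "X n \<in> borel_measurable M" "Y \<in> borel_measurable M" for n
    using assms(1) by (auto simp: conv_in_prob_iff)
  have "prob_dist M (X n) Y = prob_dist M (X' n) Y'" for n
    by (rule prob_dist_cong_AE) (use assms(4,5) in auto)
  with assms show ?thesis by (simp add: conv_in_prob_iff)
qed

lemma conv_in_prob_linear:
  assumes "conv_in_prob M X Y" "conv_in_prob M X' Y'"
  shows "conv_in_prob M (\<lambda>n \<omega>. X n \<omega> + c * X' n \<omega>) (\<lambda>\<omega>. Y \<omega> + c * Y' \<omega>)"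
proof -
  have [measurable]: "X n \<in> borel_measurable M" "Y \<in> borel_measurable M"
    "X' n \<in> borel_measurable M" "Y' \<in> borel_measurable M" for n
    using assms by (auto simp: conv_in_prob_iff)
  \<comment> \<open>The factor is \<open>1 + \<bar>c\<bar>\<close> and not
    \<open>\<bar>c\<bar>\<close>: when only \<open>y\<close> exceeds 1, the right side must still
    reach the truncation level 1 even if \<open>c\<close> is small.\<close>
  have min_scale: "min 1 \<bar>x + c * y\<bar> \<le> min 1 \<bar>x\<bar> + (1 + \<bar>c\<bar>) * min 1 \<bar>y\<bar>" for x y :: real
  proof (cases "\<bar>x\<bar> < 1 \<and> \<bar>y\<bar> < 1")
    case True
    have "\<bar>x + c * y\<bar> \<le> \<bar>x\<bar> + \<bar>c\<bar> * \<bar>y\<bar>" by (metis abs_mult abs_triangle_ineq)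
    also have "\<dots> \<le> \<bar>x\<bar> + (1 + \<bar>c\<bar>) * \<bar>y\<bar>" by (simp add: algebra_simps)
    finally show ?thesis using True by (simp add: min_def)
  next
    case False
    have "1 \<le> min 1 \<bar>x\<bar> + (1 + \<bar>c\<bar>) * min 1 \<bar>y\<bar>"
    proof (cases "\<bar>x\<bar> < 1")
      case True
      then have "min 1 \<bar>y\<bar> = 1" using False by simp
      then show ?thesis by simp
    next
      case False
      then have "min 1 \<bar>x\<bar> = 1" by simp
      then show ?thesis by simp
    qed
    then show ?thesis by (rule min.coboundedI1)
  qed
  have "prob_dist M (\<lambda>\<omega>. X n \<omega> + c * X' n \<omega>) (\<lambda>\<omega>. Y \<omega> + c * Y' \<omega>)
      \<le> prob_dist M (X n) Y + (1 + \<bar>c\<bar>) * prob_dist M (X' n) Y'" for n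
  proof -
    have "prob_dist M (\<lambda>\<omega>. X n \<omega> + c * X' n \<omega>) (\<lambda>\<omega>. Y \<omega> + c * Y' \<omega>)
      \<le> (LINT \<omega>|M. min 1 \<bar>X n \<omega> - Y \<omega>\<bar> + (1 + \<bar>c\<bar>) * min 1 \<bar>X' n \<omega> - Y' \<omega>\<bar>)"
      unfolding prob_dist_def
    proof (intro integral_mono)
      fix \<omega>
      have eq: "X n \<omega> + c * X' n \<omega> - (Y \<omega> + c * Y' \<omega>) = (X n \<omega> - Y \<omega>) + c * (X' n \<omega> - Y' \<omega>)"
        by (simp add: algebra_simps)
      show "min 1 \<bar>X n \<omega> + c * X' n \<omega> - (Y \<omega> + c * Y' \<omega>)\<bar> \<le>
        min 1 \<bar>X n \<omega> - Y \<omega>\<bar> + (1 + \<bar>c\<bar>) * min 1 \<bar>X' n \<omega> - Y' \<omega>\<bar>"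
        unfolding eq by (rule min_scale)
    qed auto
    also have "\<dots> = prob_dist M (X n) Y + (1 + \<bar>c\<bar>) * prob_dist M (X' n) Y'"
      unfolding prob_dist_def by simp
    finally show ?thesis .
  qed
  moreover have "(\<lambda>n. prob_dist M (X n) Y + (1 + \<bar>c\<bar>) * prob_dist M (X' n) Y') \<longlonglongrightarrow> 0"
    using assms unfolding conv_in_prob_iff by (intro tendsto_add_zero tendsto_mult_right_zero) blast+
  ultimately have "(\<lambda>n. prob_dist M (\<lambda>\<omega>. X n \<omega> + c * X' n \<omega>) (\<lambda>\<omega>. Y \<omega> + c * Y' \<omega>)) \<longlonglongrightarrow> 0"
    by - (rule Lim_null_comparison[OF always_eventually, rotated], assumption, auto simp: prob_dist_nonneg)
  then show ?thesis by (simp add: conv_in_prob_iff)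
qed

lemma conv_in_prob_of_AE:
  assumes [measurable]: "\<And>n. X n \<in> borel_measurable M" "Y \<in> borel_measurable M"
    and lim: "AE \<omega> in M. (\<lambda>n. X n \<omega>) \<longlonglongrightarrow> Y \<omega>"
  shows "conv_in_prob M X Y"
proof -
  have "(\<lambda>n. LINT \<omega>|M. min 1 \<bar>X n \<omega> - Y \<omega>\<bar>) \<longlonglongrightarrow> (LINT \<omega>|M. (0::real))"
  proof (rule integral_dominated_convergence[where w="\<lambda>_. 1"])
    show "AE \<omega> in M. (\<lambda>n. min 1 \<bar>X n \<omega> - Y \<omega>\<bar>) \<longlonglongrightarrow> 0"
      using lim
    proof eventually_elim
      case (elim \<omega>)
      then have "(\<lambda>n. min 1 \<bar>X n \<omega> - Y \<omega>\<bar>) \<longlonglongrightarrow> min 1 \<bar>Y \<omega> - Y \<omega>\<bar>"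
        by (intro tendsto_intros)
      then show ?case by simp
    qed
  qed auto
  then show ?thesis by (simp add: conv_in_prob_iff prob_dist_def)
qed

text \<open>A Borel-Cantelli argument in integrated form: the truncated increments have summable
  means, so the increments are almost surely summable, and their sums telescope to
  \<open>X n\<close>.\<close>

lemma AE_convergent_of_summable_prob_dist:
  assumes [measurable]: "\<And>n. X n \<in> borel_measurable M"
    and "\<And>n. prob_dist M (X (Suc n)) (X n) \<le> c n" "summable c"
  shows "AE \<omega> in M. convergent (\<lambda>n. X n \<omega>)"
proof -
  have "AE \<omega> in M. summable (\<lambda>n. min 1 \<bar>X (Suc n) \<omega> - X n \<omega>\<bar>)"
    by (rule AE_summable_of_integral_bound[OF _ _ _ assms(3)])
       (use assms(2) in \<open>auto simp: prob_dist_def\<close>)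
  then show ?thesis
  proof eventually_elim
    case (elim \<omega>)
    then have "summable (\<lambda>n. \<bar>X (Suc n) \<omega> - X n \<omega>\<bar>)" by (rule summable_of_summable_min)
    then have "summable (\<lambda>n. X (Suc n) \<omega> - X n \<omega>)" by (rule summable_rabs_cancel)
    then have "convergent (\<lambda>n. \<Sum>k<n. X (Suc k) \<omega> - X k \<omega>)" by (simp add: summable_iff_convergent)
    then have "convergent (\<lambda>n. X 0 \<omega> + (\<Sum>k<n. X (Suc k) \<omega> - X k \<omega>))"
      by (simp add: convergent_add_const_iff)
    then show ?case by (subst (asm) sum_lessThan_telescope[of "\<lambda>k. X k \<omega>"]) simp
  qed
qed

lemma AE_tendsto_of_summable_prob_dist:
  assumes [measurable]: "\<And>n. X n \<in> borel_measurable M" "Y \<in> borel_measurable M"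
    and "\<And>n. prob_dist M (X n) Y \<le> c n" "summable c"
  shows "AE \<omega> in M. (\<lambda>n. X n \<omega>) \<longlonglongrightarrow> Y \<omega>"
proof -
  have "AE \<omega> in M. summable (\<lambda>n. min 1 \<bar>X n \<omega> - Y \<omega>\<bar>)"
    by (rule AE_summable_of_integral_bound[OF _ _ _ assms(4)])
       (use assms(3) in \<open>auto simp: prob_dist_def\<close>)
  then show ?thesis
  proof eventually_elim
    case (elim \<omega>)
    then have "summable (\<lambda>n. \<bar>X n \<omega> - Y \<omega>\<bar>)" by (rule summable_of_summable_min)
    then have "(\<lambda>n. \<bar>X n \<omega> - Y \<omega>\<bar>) \<longlonglongrightarrow> 0" by (rule summable_LIMSEQ_zero)
    then show ?case by (simp add: LIM_zero_iff tendsto_rabs_zero_iff)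
  qed
qed

lemma conv_in_prob_char:
  assumes "conv_in_prob M X Y"
  shows "(\<lambda>n. CLINT \<omega>|M. iexp (u * X n \<omega>)) \<longlonglongrightarrow> (CLINT \<omega>|M. iexp (u * Y \<omega>))"
proof -
  have [measurable]: "X n \<in> borel_measurable M" "Y \<in> borel_measurable M" for n
    using assms by (auto simp: conv_in_prob_iff)
  have int: "integrable M (\<lambda>\<omega>. iexp (u * Z \<omega>))" if "Z \<in> borel_measurable M" for Z
    using that by (intro integrable_iexp) auto
  have "cmod ((CLINT \<omega>|M. iexp (u * X n \<omega>)) - (CLINT \<omega>|M. iexp (u * Y \<omega>)))
      \<le> (2 + \<bar>u\<bar>) * prob_dist M (X n) Y" for n
  proof -
    have "(CLINT \<omega>|M. iexp (u * X n \<omega>)) - (CLINT \<omega>|M. iexp (u * Y \<omega>))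
        = (CLINT \<omega>|M. iexp (u * X n \<omega>) - iexp (u * Y \<omega>))"
      by (rule Bochner_Integration.integral_diff[symmetric]) (rule int, simp)+
    also have "cmod \<dots> \<le> (LINT \<omega>|M. (2 + \<bar>u\<bar>) * min 1 \<bar>X n \<omega> - Y \<omega>\<bar>)"
      by (intro norm_integral_le norm_iexp_diff_le Bochner_Integration.integrable_diff int) auto
    finally show ?thesis by (simp add: prob_dist_def)
  qed
  moreover have "(\<lambda>n. (2 + \<bar>u\<bar>) * prob_dist M (X n) Y) \<longlonglongrightarrow> 0"
    using assms unfolding conv_in_prob_iff by (intro tendsto_mult_right_zero) blast
  ultimately have "(\<lambda>n. (CLINT \<omega>|M. iexp (u * X n \<omega>)) - (CLINT \<omega>|M. iexp (u * Y \<omega>))) \<longlonglongrightarrow> 0"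
    by - (rule Lim_null_comparison[OF always_eventually, rotated], assumption, auto)
  then show ?thesis by (simp add: LIM_zero_iff)
qed

text \<open>Averaging over an independent standard Gaussian multiplier \<open>g\<close> turns \<open>iexp (g * X)\<close> into
  \<open>exp (- X\<^sup>2 / 2)\<close>, so tail bounds follow from bounds on characteristic functions.\<close>

lemma gaussian_average_bound:
  fixes V :: "'a \<Rightarrow> complex"
  assumes [measurable]: "X \<in> borel_measurable M" "V \<in> borel_measurable M"
    and V: "\<And>\<omega>. cmod (V \<omega>) \<le> 1"
    and bound: "\<And>g. cmod (1 - (CLINT \<omega>|M. V \<omega> * iexp (g * X \<omega>))) \<le> \<alpha> + \<beta> * g + \<kappa> * g\<^sup>2"
  shows "cmod (1 - (CLINT \<omega>|M. V \<omega> * of_real (exp (- (X \<omega>)\<^sup>2 / 2)))) \<le> \<alpha> + \<kappa>"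
proof -
  let ?N = "std_normal_distribution"
  interpret N: real_distribution ?N by (rule real_dist_normal_dist)
  interpret NM: pair_prob_space ?N M ..
  have [measurable_cong]: "sets ?N = sets borel" by simp
  have int2: "integrable (?N \<Otimes>\<^sub>M M) (\<lambda>(g, \<omega>). V \<omega> * iexp (g * X \<omega>))"
    by (rule NM.P.integrable_const_bound[where B=1]) (auto simp: norm_mult V)
  \<comment> \<open>The Gaussian moments 0 and 1 decide the conclusion: the term in
    \<open>\<beta>\<close> averages out and \<open>\<kappa>\<close> survives with factor 1.\<close>
  have m2: "(LINT g|?N. g\<^sup>2) = 1"
    using std_normal_distribution_even_moments(1)[of 1] by (simp add: has_bochner_integral_iff)
  have m1: "(LINT g|?N. g) = 0"
    using integral_std_normal_distribution_moment_odd[of 1] by simp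
  have im: "integrable ?N (\<lambda>g. g)" "integrable ?N (\<lambda>g. g\<^sup>2)"
    using integrable_std_normal_distribution_moment[of 1] integrable_std_normal_distribution_moment[of 2]
    by auto
  have "(CLINT \<omega>|M. V \<omega> * of_real (exp (- (X \<omega>)\<^sup>2 / 2)))
      = (CLINT \<omega>|M. CLINT g|?N. V \<omega> * iexp (g * X \<omega>))"
  proof (intro Bochner_Integration.integral_cong refl)
    fix \<omega>
    have "(CLINT g|?N. iexp (X \<omega> * g)) = of_real (exp (- (X \<omega>)\<^sup>2 / 2))"
      using fun_cong[OF char_std_normal_distribution, of "X \<omega>"] by (simp add: char_def)
    then show "V \<omega> * of_real (exp (- (X \<omega>)\<^sup>2 / 2)) = (CLINT g|?N. V \<omega> * iexp (g * X \<omega>))"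
      by (simp add: mult.commute)
  qed
  also have "\<dots> = (CLINT g|?N. CLINT \<omega>|M. V \<omega> * iexp (g * X \<omega>))"
    using NM.Fubini_integral[OF int2] by simp
  finally have "1 - (CLINT \<omega>|M. V \<omega> * of_real (exp (- (X \<omega>)\<^sup>2 / 2)))
      = (CLINT g|?N. 1 - (CLINT \<omega>|M. V \<omega> * iexp (g * X \<omega>)))"
    using NM.integrable_fst'[OF int2] by (subst Bochner_Integration.integral_diff) (auto simp: N.prob_space[simplified])
  also have "cmod \<dots> \<le> (LINT g|?N. \<alpha> + \<beta> * g + \<kappa> * g\<^sup>2)"
    using NM.integrable_fst'[OF int2] im
    by (intro norm_integral_le bound) auto
  also have "\<dots> = \<alpha> + \<kappa>"
    using im by (simp add: m1 m2 N.prob_space[simplified])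
  finally show ?thesis .
qed

lemma square_expectation_le:
  fixes Z :: "'a \<Rightarrow> real"
  assumes "integrable M Z" "integrable M (\<lambda>\<omega>. (Z \<omega>)\<^sup>2)"
  shows "(expectation Z)\<^sup>2 \<le> expectation (\<lambda>\<omega>. (Z \<omega>)\<^sup>2)"
  using variance_eq[OF assms] variance_positive[of Z] by simp

text \<open>Jensen's inequality moves the square inside, the Gaussian inequality replaces the
  truncated square by \<open>1 - exp (- X\<^sup>2 / 2)\<close>, and the Gaussian average turns this
  into characteristic functions. So a bound at all frequencies controls \<open>X\<close> without any
  moments.\<close>

lemma prob_dist_le_of_char:
  assumes [measurable]: "X \<in> borel_measurable M"
    and bound: "\<And>g. cmod (1 - (CLINT \<omega>|M. iexp (g * X \<omega>))) \<le> \<alpha> + \<kappa> * g\<^sup>2"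
  shows "(prob_dist M X (\<lambda>_. 0))\<^sup>2 \<le> 3 * (\<alpha> + \<kappa>)"
proof -
  have int: "integrable M (\<lambda>\<omega>. exp (- (X \<omega>)\<^sup>2 / 2))"
    by (intro integrable_const_bound[where B=1]) auto
  have int': "integrable M (\<lambda>\<omega>. (min 1 \<bar>X \<omega>\<bar>)\<^sup>2)"
    by (intro integrable_const_bound[where B=1]) (auto simp: abs_square_le_1)
  have "(prob_dist M X (\<lambda>_. 0))\<^sup>2 \<le> (LINT \<omega>|M. (min 1 \<bar>X \<omega>\<bar>)\<^sup>2)"
    unfolding prob_dist_def diff_0_right
    by (rule square_expectation_le) (auto intro: int')
  also have "\<dots> \<le> (LINT \<omega>|M. 3 * (1 - exp (- (X \<omega>)\<^sup>2 / 2)))"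
    by (intro integral_mono int' min_sq_le_gauss Bochner_Integration.integrable_diff integrable_mult_right int)
      auto
  also have "\<dots> = 3 * (1 - (LINT \<omega>|M. exp (- (X \<omega>)\<^sup>2 / 2)))"
    using int by (simp add: prob_space)
  also have "\<dots> \<le> 3 * cmod (1 - (CLINT \<omega>|M. 1 * of_real (exp (- (X \<omega>)\<^sup>2 / 2))))"
  proof -
    have "(CLINT \<omega>|M. 1 * of_real (exp (- (X \<omega>)\<^sup>2 / 2))) = of_real (LINT \<omega>|M. exp (- (X \<omega>)\<^sup>2 / 2))"
      by (simp only: mult_1 integral_complex_of_real)
    then have "1 - (CLINT \<omega>|M. 1 * of_real (exp (- (X \<omega>)\<^sup>2 / 2)))
        = of_real (1 - (LINT \<omega>|M. exp (- (X \<omega>)\<^sup>2 / 2)))"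
      by (simp only: of_real_diff of_real_1)
    then have "3 * (1 - (LINT \<omega>|M. exp (- (X \<omega>)\<^sup>2 / 2)))
        \<le> 3 * cmod (1 - (CLINT \<omega>|M. 1 * of_real (exp (- (X \<omega>)\<^sup>2 / 2))))"
      by (simp only: norm_of_real) (intro mult_left_mono abs_ge_self, simp)
    then show ?thesis .
  qed
  also have "\<dots> \<le> 3 * (\<alpha> + \<kappa>)"
    using gaussian_average_bound[of X "\<lambda>_. 1" \<alpha> 0 \<kappa>] bound by simp
  finally show ?thesis .
qed

end

section \<open>The Levy exponent\<close>

text \<open>The half-plane Re z \<le> 0 is convex, and the derivative of exp has modulus at most 1
  on it. Characteristic functions can thus be compared through their exponents.\<close>

lemma norm_exp_diff_le:
  fixes a b :: complex
  assumes "Re a \<le> 0" "Re b \<le> 0"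
  shows "cmod (exp a - exp b) \<le> cmod (a - b)"
proof -
  have "cmod (exp a - exp b) \<le> 1 * cmod (a - b)"
  proof (rule field_differentiable_bound[where S="{z. Re z \<le> 0}" and f'=exp])
    show "convex {z. Re z \<le> 0}" by (rule convex_halfspace_Re_le)
    show "(exp has_field_derivative exp z) (at z within {z. Re z \<le> 0})" for z :: complex
      by (rule has_field_derivative_at_within[OF DERIV_exp])
    show "cmod (exp z) \<le> 1" if "z \<in> {z. Re z \<le> 0}" for z
      using that unfolding norm_exp_eq_Re by simp
    show "a \<in> {z. Re z \<le> 0}" "b \<in> {z. Re z \<le> 0}" using assms by blast+
  qed
  then show ?thesis by (simp only: mult_1)
qed

context
  fixes \<nu> :: "real measure"
  assumes levy: "symmetric_levy_measure \<nu>"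
begin

lemma borel_measurable_levy_measure:
  "f \<in> borel_measurable borel \<Longrightarrow> f \<in> borel_measurable \<nu>"
proof -
  assume "f \<in> borel_measurable borel"
  then have "f \<in> borel_measurable (restrict_space borel (- {0}))"
    by (rule measurable_restrict_space1)
  moreover have "sets \<nu> = sets (restrict_space borel (- {0}))"
    using levy unfolding symmetric_levy_measure_def by blast
  ultimately show ?thesis
    using measurable_cong_sets[of \<nu> "restrict_space borel (- {0})" borel borel] by blast
qed

lemma integrable_levy_min: "integrable \<nu> (\<lambda>z. min (z\<^sup>2) 1)"
proof (rule integrableI_nonneg)
  show "(\<lambda>z. min (z\<^sup>2) 1) \<in> borel_measurable \<nu>"
    by (rule borel_measurable_levy_measure) simp
  show "(\<integral>\<^sup>+ z. ennreal (min (z\<^sup>2) 1) \<partial>\<nu>) < \<infinity>"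
    using levy by (simp add: symmetric_levy_measure_def)
qed simp

text \<open>Second-order Taylor expansion where the compensator is present, the trivial bound 2 on
  large jumps. The result is integrable against the Levy measure, with a constant that is locally
  bounded in \<open>u\<close>.\<close>

lemma norm_levy_integrand_le:
  "cmod (iexp (u * z) - 1 - \<i> * of_real (u * z * indicator {z. \<bar>z\<bar> \<le> 1} z))
    \<le> (u\<^sup>2 / 2 + 2) * min (z\<^sup>2) 1"
proof (cases "\<bar>z\<bar> \<le> 1")
  case True
  then have z: "z\<^sup>2 \<le> 1" by (simp add: abs_square_le_1)
  have "cmod (iexp (u * z) - 1 - \<i> * of_real (u * z)) \<le> (u * z)\<^sup>2 / 2"
    using iexp_approx1[of "u * z" 1] by (simp add: algebra_simps power2_eq_square)
  also have "\<dots> \<le> (u\<^sup>2 / 2 + 2) * z\<^sup>2" by (simp add: algebra_simps power_mult_distrib)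
  finally show ?thesis using True z by (simp add: min_def)
next
  case False
  then have z: "1 \<le> z\<^sup>2" using abs_le_square_iff[of 1 z] by simp
  have "cmod (iexp (u * z) - 1) \<le> 2" using iexp_approx2[of "u * z" 0] by simp
  also have "\<dots> \<le> u\<^sup>2 / 2 + 2" by simp
  finally show ?thesis using False z by (simp add: min_def)
qed

lemma integrable_levy_integrand:
  "complex_integrable \<nu> (\<lambda>z. iexp (u * z) - 1 - \<i> * of_real (u * z * indicator {z. \<bar>z\<bar> \<le> 1} z))"
proof (rule Bochner_Integration.integrable_bound)
  show "integrable \<nu> (\<lambda>z. (u\<^sup>2 / 2 + 2) * min (z\<^sup>2) 1)"
    using integrable_levy_min by simp
  show "AE z in \<nu>. cmod (iexp (u * z) - 1 - \<i> * of_real (u * z * indicator {z. \<bar>z\<bar> \<le> 1} z))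
      \<le> norm ((u\<^sup>2 / 2 + 2) * min (z\<^sup>2) 1)"
    by (intro AE_I2 order_trans[OF norm_levy_integrand_le]) simp
qed (rule borel_measurable_levy_measure, measurable)

lemma Re_levy_exponent_nonpos: "Re (levy_exponent b \<sigma> \<nu> u) \<le> 0"
proof -
  have "Re (CLINT z|\<nu>. iexp (u * z) - 1 - \<i> * of_real (u * z * indicator {z. \<bar>z\<bar> \<le> 1} z))
      = (LINT z|\<nu>. cos (u * z) - 1)"
    by (subst integral_Re[OF integrable_levy_integrand, symmetric]) (simp add: Re_exp)
  also have "\<dots> = - (LINT z|\<nu>. 1 - cos (u * z))"
    by (subst Bochner_Integration.integral_minus[symmetric]) simp
  also have "\<dots> \<le> 0" by simp
  finally have "Re (levy_exponent b \<sigma> \<nu> u) \<le> - (\<sigma>\<^sup>2 * u\<^sup>2 / 2)"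
    unfolding levy_exponent_def by simp
  also have "\<dots> \<le> 0" by simp
  finally show ?thesis .
qed

lemma levy_exponent_tendsto_0:
  assumes "v \<longlonglongrightarrow> 0"
  shows "(\<lambda>n. levy_exponent b \<sigma> \<nu> (v n)) \<longlonglongrightarrow> 0"
proof -
  obtain K where K: "\<And>n. \<bar>v n\<bar> \<le> K" 
    using convergent_imp_Bseq[of v] assms by (auto simp: convergent_def Bseq_def)
  let ?k = "\<lambda>u z. iexp (u * z) - 1 - \<i> * of_real (u * z * indicator {z. \<bar>z\<bar> \<le> 1} z)"
  have "(\<lambda>n. CLINT z|\<nu>. ?k (v n) z) \<longlonglongrightarrow> (CLINT z|\<nu>. 0)"
  proof (rule integral_dominated_convergence[where w="\<lambda>z. (K\<^sup>2 / 2 + 2) * min (z\<^sup>2) 1"])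
    show "integrable \<nu> (\<lambda>z. (K\<^sup>2 / 2 + 2) * min (z\<^sup>2) 1)"
      using integrable_levy_min by simp
    show "AE z in \<nu>. (\<lambda>n. ?k (v n) z) \<longlonglongrightarrow> 0"
    proof (intro AE_I2)
      fix z
      have "(\<lambda>n. ?k (v n) z) \<longlonglongrightarrow> ?k 0 z" by (intro tendsto_intros assms)
      then show "(\<lambda>n. ?k (v n) z) \<longlonglongrightarrow> 0" by simp
    qed
    fix n
    show "AE z in \<nu>. cmod (?k (v n) z) \<le> (K\<^sup>2 / 2 + 2) * min (z\<^sup>2) 1"
    proof (intro AE_I2 order_trans[OF norm_levy_integrand_le] mult_right_mono)
      have "(v n)\<^sup>2 \<le> K\<^sup>2" using K[of n] abs_le_square_iff[of "v n" K] by simp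
      then show "(v n)\<^sup>2 / 2 + 2 \<le> K\<^sup>2 / 2 + 2" by simp
    qed simp
    show "?k (v n) \<in> borel_measurable \<nu>" by (rule borel_measurable_levy_measure) measurable
  qed simp
  then have 1: "(\<lambda>n. CLINT z|\<nu>. ?k (v n) z) \<longlonglongrightarrow> 0" by simp
  have 2: "(\<lambda>n. \<i> * of_real (b * v n) - of_real (\<sigma>\<^sup>2 * (v n)\<^sup>2 / 2)) \<longlonglongrightarrow>
      \<i> * of_real (b * 0) - of_real (\<sigma>\<^sup>2 * 0\<^sup>2 / 2)"
    by (intro tendsto_intros assms) auto
  show ?thesis
    unfolding levy_exponent_def using tendsto_add[OF 2 1] by simp
qed

text \<open>Continuity at 0 makes the exponent smaller than \<eta> near 0, and away from 0 its
  growth is at most quadratic. The constant \<eta> cannot be replaced by 0: for nonzero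
  \<open>b\<close> the exponent is of first order at 0.\<close>

lemma levy_exponent_bound:
  assumes "0 < \<eta>"
  obtains C where "0 \<le> C" "\<And>v. cmod (levy_exponent b \<sigma> \<nu> v) \<le> \<eta> + C * v\<^sup>2"
proof -
  let ?\<Psi> = "levy_exponent b \<sigma> \<nu>"
  have zero: "?\<Psi> 0 = 0" by (simp add: levy_exponent_def)
  have "isCont ?\<Psi> 0"
    by (simp add: continuous_at_sequentially o_def zero levy_exponent_tendsto_0)
  then obtain \<delta> where \<delta>: "\<delta> > 0" "\<And>v. \<bar>v\<bar> < \<delta> \<Longrightarrow> cmod (?\<Psi> v) < \<eta>"
    using assms unfolding continuous_at_eps_delta by (auto simp: zero)
  define L where "L = (LINT z|\<nu>. min (z\<^sup>2) 1)"
  have L: "0 \<le> L" unfolding L_def by (intro Bochner_Integration.integral_nonneg) auto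
  define A where "A = \<bar>b\<bar> + \<sigma>\<^sup>2 / 2 + L / 2"
  define B where "B = \<bar>b\<bar> + 2 * L"
  have AB: "0 \<le> A" "0 \<le> B" unfolding A_def B_def using L by auto
  have gen: "cmod (?\<Psi> v) \<le> A * v\<^sup>2 + B" for v
  proof -
    let ?I = "CLINT z|\<nu>. iexp (v * z) - 1 - \<i> * of_real (v * z * indicator {z. \<bar>z\<bar> \<le> 1} z)"
    have "cmod ?I \<le> (LINT z|\<nu>. (v\<^sup>2 / 2 + 2) * min (z\<^sup>2) 1)"
      by (intro norm_integral_le integrable_levy_integrand norm_levy_integrand_le)
         (use integrable_levy_min in simp)
    then have 1: "cmod ?I \<le> (v\<^sup>2 / 2 + 2) * L" by (simp add: L_def)
    have 2: "cmod (\<i> * of_real (b * v)) \<le> \<bar>b\<bar> * (v\<^sup>2 + 1)"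
    proof -
      have "0 \<le> (\<bar>v\<bar> - 1)\<^sup>2" by simp
      then have "2 * \<bar>v\<bar> \<le> v\<^sup>2 + 1" by (simp add: power2_eq_square algebra_simps abs_mult[symmetric])
      then have "\<bar>v\<bar> \<le> v\<^sup>2 + 1" by simp
      then show ?thesis by (simp add: norm_mult abs_mult mult_left_mono)
    qed
    have "cmod (?\<Psi> v) \<le> cmod (\<i> * of_real (b * v)) + cmod (of_real (\<sigma>\<^sup>2 * v\<^sup>2 / 2) :: complex) + cmod ?I"
      unfolding levy_exponent_def
      by (intro order_trans[OF norm_triangle_ineq] add_right_mono norm_triangle_ineq4)
    moreover have "cmod (of_real (\<sigma>\<^sup>2 * v\<^sup>2 / 2) :: complex) = \<sigma>\<^sup>2 * v\<^sup>2 / 2"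
      by (simp only: norm_of_real) simp
    ultimately show ?thesis using 1 2 unfolding A_def B_def by (simp add: algebra_simps)
  qed
  show ?thesis
  proof
    \<comment> \<open>\<open>B\<close> is the constant part of the general bound; for
      \<open>\<bar>v\<bar> \<ge> \<delta>\<close> it is at most
      \<open>B * v\<^sup>2 / \<delta>\<^sup>2\<close>.\<close>
    show "0 \<le> A + B / \<delta>\<^sup>2" using AB by simp
    fix v
    show "cmod (?\<Psi> v) \<le> \<eta> + (A + B / \<delta>\<^sup>2) * v\<^sup>2"
    proof (cases "\<bar>v\<bar> < \<delta>")
      case True
      have "0 \<le> (A + B / \<delta>\<^sup>2) * v\<^sup>2" using AB by simp
      then show ?thesis using \<delta>(2)[OF True] by linarith
    next
      case False
      then have "\<delta>\<^sup>2 \<le> v\<^sup>2" using \<delta>(1) by (intro abs_le_square_iff[THEN iffD1]) simp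
      then have "1 \<le> v\<^sup>2 / \<delta>\<^sup>2" using \<delta>(1) by simp
      then have "B * 1 \<le> B * (v\<^sup>2 / \<delta>\<^sup>2)" using AB by (intro mult_left_mono)
      then show ?thesis using gen[of v] assms by (simp add: algebra_simps)
    qed
  qed
qed

end

section \<open>Square integrable functions on a bounded region\<close>

text \<open>Kept to bounded Borel sets because it is instantiated twice: at the domain, and at the
  interval \<open>{-1..1}\<close> of the extra variable in the mean value argument.\<close>

locale bounded_region =
  fixes D :: "'a::euclidean_space set"
  assumes D_borel: "D \<in> sets borel" and D_bounded: "bounded D"
begin

lemma sets_leb_on: "A \<in> sets (leb_on D) \<longleftrightarrow> A \<in> sets borel \<and> A \<subseteq> D"
  using D_borel by (subst sets_restrict_space_iff) auto

lemma space_leb_on: "space (leb_on D) = D"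
  by (simp add: space_restrict_space)

lemma measure_leb_on: "A \<in> sets (leb_on D) \<Longrightarrow> measure (leb_on D) A = measure lborel A"
  using D_borel sets_leb_on by (intro measure_restrict_space) auto

sublocale leb: finite_measure "leb_on D"
proof
  have "emeasure (leb_on D) (space (leb_on D)) = emeasure lborel D"
    unfolding space_leb_on using D_borel by (intro emeasure_restrict_space) auto
  also have "\<dots> < \<infinity>" using D_bounded by (rule emeasure_bounded_finite)
  finally show "emeasure (leb_on D) (space (leb_on D)) \<noteq> \<infinity>" by simp
qed

lemma simple_function_level_set:
  fixes h :: "'a \<Rightarrow> real"
  assumes "simple_function (leb_on D) h" "A \<in> sets (leb_on D)"
  shows "A \<inter> {x\<in>D. h x = \<alpha>} \<in> sets (leb_on D)"
proof -
  have [measurable]: "h \<in> borel_measurable (leb_on D)"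
    using assms(1) by (rule borel_measurable_simple_function)
  have "{x\<in>space (leb_on D). h x = \<alpha>} \<in> sets (leb_on D)" by measurable
  then show ?thesis using assms(2) by (auto simp: space_leb_on)
qed

lemma finite_simple_range: "simple_function (leb_on D) h \<Longrightarrow> finite (h ` D)"
  using simple_functionD(1)[of "leb_on D" h] by (simp add: space_leb_on)

abbreviation vol :: real where "vol \<equiv> measure (leb_on D) D"
abbreviation sqn :: "('a \<Rightarrow> real) \<Rightarrow> real" where "sqn f \<equiv> LINT x|leb_on D. (f x)\<^sup>2"

lemma sqn_nonneg: "0 \<le> sqn f"
  by (intro Bochner_Integration.integral_nonneg) simp

lemma integral_const_leb: "(LINT x|leb_on D. c) = c * vol" for c :: real
  by (simp add: space_leb_on)

lemma L2_fun_borel [measurable_dest]: "L2_fun D f \<Longrightarrow> f \<in> borel_measurable (leb_on D)"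
  by (simp add: L2_fun_def)

lemma L2_fun_square: "L2_fun D f \<Longrightarrow> integrable (leb_on D) (\<lambda>x. (f x)\<^sup>2)"
  by (simp add: L2_fun_def)

lemma L2_fun_mult: 
  assumes "L2_fun D f" "L2_fun D g"
  shows "integrable (leb_on D) (\<lambda>x. f x * g x)"
proof (rule Bochner_Integration.integrable_bound)
  show "integrable (leb_on D) (\<lambda>x. (f x)\<^sup>2 + (g x)\<^sup>2)"
    using assms by (intro Bochner_Integration.integrable_add L2_fun_square)
  show "(\<lambda>x. f x * g x) \<in> borel_measurable (leb_on D)"
    using assms by (intro borel_measurable_times L2_fun_borel)
  show "AE x in leb_on D. norm (f x * g x) \<le> norm ((f x)\<^sup>2 + (g x)\<^sup>2)"
  proof (intro AE_I2)
    fix x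
    have "0 \<le> (\<bar>f x\<bar> - \<bar>g x\<bar>)\<^sup>2" by simp
    then have "2 * (\<bar>f x\<bar> * \<bar>g x\<bar>) \<le> (f x)\<^sup>2 + (g x)\<^sup>2" by (simp add: power2_diff)
    moreover have "0 \<le> \<bar>f x\<bar> * \<bar>g x\<bar>" by simp
    ultimately have "\<bar>f x\<bar> * \<bar>g x\<bar> \<le> (f x)\<^sup>2 + (g x)\<^sup>2" by linarith
    then show "norm (f x * g x) \<le> norm ((f x)\<^sup>2 + (g x)\<^sup>2)" by (simp add: abs_mult)
  qed
qed

lemma L2_fun_linear:
  assumes "L2_fun D f" "L2_fun D g"
  shows "L2_fun D (\<lambda>x. f x + c * g x)"
proof -
  have "integrable (leb_on D) (\<lambda>x. (f x)\<^sup>2 + 2 * c * (f x * g x) + c\<^sup>2 * (g x)\<^sup>2)"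
    using assms
    by (intro Bochner_Integration.integrable_add integrable_mult_right L2_fun_square L2_fun_mult) auto
  moreover have "(\<lambda>x. (f x)\<^sup>2 + 2 * c * (f x * g x) + c\<^sup>2 * (g x)\<^sup>2) = (\<lambda>x. (f x + c * g x)\<^sup>2)"
    by (simp add: power2_eq_square algebra_simps)
  ultimately show ?thesis
    using assms[THEN L2_fun_borel] unfolding L2_fun_def by simp
qed

lemma sqn_linear:
  assumes "L2_fun D f" "L2_fun D g"
  shows "sqn (\<lambda>x. f x + c * g x) = sqn f + 2 * c * L2_inner D f g + c\<^sup>2 * sqn g"
proof -
  have "sqn (\<lambda>x. f x + c * g x)
      = (LINT x|leb_on D. (f x)\<^sup>2 + 2 * c * (f x * g x) + c\<^sup>2 * (g x)\<^sup>2)"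
    by (simp add: power2_eq_square algebra_simps)
  also have "\<dots> = sqn f + 2 * c * L2_inner D f g + c\<^sup>2 * sqn g"
    using assms L2_fun_square L2_fun_mult by (simp add: L2_inner_def)
  finally show ?thesis .
qed

lemma L2_fun_add: "L2_fun D f \<Longrightarrow> L2_fun D g \<Longrightarrow> L2_fun D (\<lambda>x. f x + g x)"
  using L2_fun_linear[of f g 1] by simp

lemma L2_fun_diff: "L2_fun D f \<Longrightarrow> L2_fun D g \<Longrightarrow> L2_fun D (\<lambda>x. f x - g x)"
  using L2_fun_linear[of f g "-1"] by simp

lemma L2_fun_zero: "L2_fun D (\<lambda>_. 0)"
  by (simp add: L2_fun_def)

lemma L2_fun_cmult: "L2_fun D f \<Longrightarrow> L2_fun D (\<lambda>x. c * f x)"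
  using L2_fun_linear[OF L2_fun_zero, of f c] by simp

lemma L2_fun_sum:
  "(\<And>i. i \<in> I \<Longrightarrow> L2_fun D (f i)) \<Longrightarrow> L2_fun D (\<lambda>x. \<Sum>i\<in>I. c i * f i x)"
  by (induction I rule: infinite_finite_induct)
     (auto simp: L2_fun_zero intro!: L2_fun_add L2_fun_cmult)

lemma L2_fun_bounded:
  assumes "f \<in> borel_measurable (leb_on D)" "\<And>x. x \<in> D \<Longrightarrow> \<bar>f x\<bar> \<le> K"
  shows "L2_fun D f"
proof -
  have "integrable (leb_on D) (\<lambda>x. (f x)\<^sup>2)"
  proof (rule leb.integrable_const_bound[where B="K\<^sup>2"])
    show "AE x in leb_on D. norm ((f x)\<^sup>2) \<le> K\<^sup>2"
    proof (intro AE_I2)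
      fix x assume "x \<in> space (leb_on D)"
      then have "\<bar>f x\<bar> \<le> K" using assms(2) by (simp add: space_leb_on)
      then show "norm ((f x)\<^sup>2) \<le> K\<^sup>2" using power_mono[of "\<bar>f x\<bar>" K 2] by simp
    qed
  qed (use assms in simp)
  then show ?thesis using assms by (simp add: L2_fun_def)
qed

lemma L2_fun_const: "L2_fun D (\<lambda>_. c)"
  by (rule L2_fun_bounded[where K="\<bar>c\<bar>"]) auto

lemma L2_fun_simple:
  fixes h :: "'a \<Rightarrow> real"
  assumes "simple_function (leb_on D) h"
  shows "L2_fun D h"
proof (rule L2_fun_bounded)
  show "h \<in> borel_measurable (leb_on D)" by (rule borel_measurable_simple_function[OF assms])
  have "finite ((\<lambda>x. \<bar>h x\<bar>) ` D)"
    using finite_imageI[OF finite_simple_range[OF assms], of abs] by (simp add: image_image)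
  then show "\<bar>h x\<bar> \<le> Max ((\<lambda>x. \<bar>h x\<bar>) ` D)" if "x \<in> D" for x
    using that by (intro Max_ge) auto
qed

lemma L2_fun_integrable: "L2_fun D f \<Longrightarrow> integrable (leb_on D) f"
  using L2_fun_mult[of f "\<lambda>_. 1"] L2_fun_const by simp

lemma sqn_add_le:
  assumes "L2_fun D f" "L2_fun D g"
  shows "sqn (\<lambda>x. f x + g x) \<le> 2 * sqn f + 2 * sqn g"
proof -
  have "sqn (\<lambda>x. f x + g x) \<le> (LINT x|leb_on D. 2 * (f x)\<^sup>2 + 2 * (g x)\<^sup>2)"
  proof (rule integral_mono)
    show "(f x + g x)\<^sup>2 \<le> 2 * (f x)\<^sup>2 + 2 * (g x)\<^sup>2" for x
      using zero_le_power2[of "f x - g x"] by (simp add: power2_eq_square algebra_simps)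
  qed (use assms L2_fun_square[OF L2_fun_add] L2_fun_square in auto)
  also have "\<dots> = 2 * sqn f + 2 * sqn g" using assms L2_fun_square by simp
  finally show ?thesis .
qed

lemma sqn_diff_le:
  assumes "L2_fun D f" "L2_fun D g" "L2_fun D k"
  shows "sqn (\<lambda>x. f x - g x) \<le> 2 * sqn (\<lambda>x. f x - k x) + 2 * sqn (\<lambda>x. g x - k x)"
proof -
  have "sqn (\<lambda>x. (f x - k x) + (k x - g x)) \<le> 2 * sqn (\<lambda>x. f x - k x) + 2 * sqn (\<lambda>x. k x - g x)"
    using assms by (intro sqn_add_le L2_fun_diff)
  then show ?thesis by (simp add: power2_commute[of "k _"])
qed

lemma L2_Cauchy_Schwarz:
  assumes "L2_fun D f" "L2_fun D g"
  shows "(L2_inner D f g)\<^sup>2 \<le> sqn f * sqn g"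
proof (cases "sqn g = 0")
  case True
  have "L2_inner D f g = 0"
  proof (rule ccontr)
    let ?c = "L2_inner D f g"
    assume c: "?c \<noteq> 0"
    \<comment> \<open>With this \<open>t\<close> the nonnegative quantity
      \<open>sqn f + 2 * t * ?c\<close> would equal -1.\<close>
    define t where "t = - (sqn f + 1) / (2 * ?c)"
    have "0 \<le> sqn f + 2 * t * ?c"
      using sqn_linear[OF assms, of t] sqn_nonneg[of "\<lambda>x. f x + t * g x"] True by simp
    also have "2 * t * ?c = - (sqn f + 1)" using c by (simp add: t_def)
    finally show False by simp
  qed
  with True show ?thesis by simp
next
  case False
  then have pos: "0 < sqn g" using sqn_nonneg[of g] by linarith
  let ?c = "L2_inner D f g"
  have "0 \<le> sqn f + 2 * (- ?c / sqn g) * ?c + (- ?c / sqn g)\<^sup>2 * sqn g"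
    using sqn_linear[OF assms, of "- ?c / sqn g"] sqn_nonneg[of "\<lambda>x. f x + (- ?c / sqn g) * g x"]
    by simp
  also have "\<dots> = sqn f - ?c\<^sup>2 / sqn g"
    using pos by (simp add: power2_eq_square field_simps)
  finally show ?thesis using pos by (simp add: field_simps)
qed

text \<open>Fatou's lemma, giving membership in L2 together with the bound. \<open>K\<close> is
  asked for only eventually because, for differences with a fixed \<open>n\<close>, a Cauchy bound
  applies only to later members.\<close>

lemma L2_fatou:
  assumes g: "\<And>n. L2_fun D (g n)" and f [measurable]: "f \<in> borel_measurable (leb_on D)"
    and lim: "AE x in leb_on D. (\<lambda>n. g n x) \<longlonglongrightarrow> f x" and K: "\<forall>\<^sub>F n in sequentially. sqn (g n) \<le> K"
  shows "L2_fun D f" "sqn f \<le> K"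
proof -
  have [measurable]: "g n \<in> borel_measurable (leb_on D)" for n using g by (rule L2_fun_borel)
  obtain N where "sqn (g N) \<le> K" using eventually_happens[OF K] by auto
  then have K0: "0 \<le> K" using sqn_nonneg[of "g N"] by linarith
  have "(\<integral>\<^sup>+x. ennreal ((f x)\<^sup>2) \<partial>leb_on D) = (\<integral>\<^sup>+x. liminf (\<lambda>n. ennreal ((g n x)\<^sup>2)) \<partial>leb_on D)"
  proof (rule nn_integral_cong_AE)
    show "AE x in leb_on D. ennreal ((f x)\<^sup>2) = liminf (\<lambda>n. ennreal ((g n x)\<^sup>2))"
      using lim
    proof eventually_elim
      case (elim x)
      then have "(\<lambda>n. ennreal ((g n x)\<^sup>2)) \<longlonglongrightarrow> ennreal ((f x)\<^sup>2)"
        by (intro tendsto_ennrealI tendsto_power)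
      then show ?case by (rule lim_imp_Liminf[OF sequentially_bot, symmetric])
    qed
  qed
  also have "\<dots> \<le> liminf (\<lambda>n. \<integral>\<^sup>+x. ennreal ((g n x)\<^sup>2) \<partial>leb_on D)"
    by (rule nn_integral_liminf) simp
  also have "\<dots> = liminf (\<lambda>n. ennreal (sqn (g n)))"
    using g by (subst nn_integral_eq_integral) (auto simp: L2_fun_square)
  also have "\<dots> \<le> liminf (\<lambda>n::nat. ennreal K)"
    using K by (intro Liminf_mono) (auto elim!: eventually_mono intro: ennreal_leI)
  finally have le: "(\<integral>\<^sup>+x. ennreal ((f x)\<^sup>2) \<partial>leb_on D) \<le> ennreal K"
    by (simp add: Liminf_const)
  have int: "integrable (leb_on D) (\<lambda>x. (f x)\<^sup>2)"
    by (rule integrableI_nonneg) (use le in \<open>auto intro: le_less_trans\<close>)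
  then show "L2_fun D f" by (simp add: L2_fun_def)
  show "sqn f \<le> K"
    using le int K0 by (subst (asm) nn_integral_eq_integral) auto
qed

text \<open>Riesz-Fischer with a rate: the limit inherits the Cauchy modulus \<delta>, which later
  becomes an explicit error for the truncated Green function.\<close>

lemma L2_complete:
  assumes g: "\<And>n. L2_fun D (g n)" and \<delta>: "\<delta> \<longlonglongrightarrow> 0"
    and Cauchy: "\<And>m n. n \<le> m \<Longrightarrow> sqn (\<lambda>x. g m x - g n x) \<le> \<delta> n"
  obtains f where "L2_fun D f" "\<And>n. sqn (\<lambda>x. f x - g n x) \<le> \<delta> n"
proof -
  have "\<exists>N. \<forall>j. (\<delta> (N j) \<le> (1/4)^j) \<and> N j < N (Suc j)"
  proof (rule dependent_nat_choice)
    have ev: "\<forall>\<^sub>F n in sequentially. \<delta> n < (1/4)^j" for j :: nat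
      by (rule order_tendstoD(2)[OF \<delta>]) simp
    show "\<exists>n. \<delta> n \<le> (1/4)^0"
      using eventually_happens[OF ev[of 0]] by (auto intro: less_imp_le)
    fix n and j :: nat
    have "\<forall>\<^sub>F m in sequentially. \<delta> m < (1/4)^Suc j \<and> n < m"
      by (intro eventually_conj ev eventually_gt_at_top)
    from eventually_happens[OF this] show "\<exists>m. \<delta> m \<le> (1/4)^Suc j \<and> n < m"
      by (auto intro: less_imp_le)
  qed
  then obtain N where N: "\<And>j. \<delta> (N j) \<le> (1/4)^j" "strict_mono N"
    by (auto simp: strict_mono_Suc_iff)
  have [measurable]: "g n \<in> borel_measurable (leb_on D)" for n using g by (rule L2_fun_borel)
  have "AE x in leb_on D. summable (\<lambda>j. \<bar>g (N (Suc j)) x - g (N j) x\<bar>)"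
  proof (rule AE_summable_of_integral_bound[where c="\<lambda>j. (1 + vol) * (1/2)^j"])
    fix j
    let ?a = "\<lambda>x. g (N (Suc j)) x - g (N j) x"
    have L2: "L2_fun D ?a" using g by (intro L2_fun_diff)
    then show int: "integrable (leb_on D) (\<lambda>x. \<bar>?a x\<bar>)" by (intro integrable_abs L2_fun_integrable)
    \<comment> \<open>Expanding a square weighted by 2^j. It trades the squared L2 distance 4^(-j)
      for an L1 distance of order 2^(-j), which is summable, at the cost of the finite volume of
      \<open>D\<close>.\<close>
    have gen: "\<bar>a\<bar> \<le> 2^j * a\<^sup>2 + (1/2)^j" for a :: real
    proof -
      have "0 \<le> 2^j * (\<bar>a\<bar> - (1/2)^j)\<^sup>2" by simp
      also have "\<dots> = 2^j * a\<^sup>2 + (1/2)^j - 2 * \<bar>a\<bar>"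
        by (simp add: power2_diff algebra_simps power_one_over power2_eq_square)
      finally show ?thesis by linarith
    qed
    have "(LINT x|leb_on D. \<bar>?a x\<bar>) \<le> (LINT x|leb_on D. 2^j * (?a x)\<^sup>2 + (1/2)^j)"
    proof (rule integral_mono)
      show "\<bar>?a x\<bar> \<le> 2^j * (?a x)\<^sup>2 + (1/2)^j" for x by (rule gen)
    qed (use int L2_fun_square[OF L2] in auto)
    also have "\<dots> = 2^j * sqn ?a + (1/2)^j * vol"
      using L2_fun_square[OF L2] by (simp add: space_leb_on)
    also have "sqn ?a \<le> (1/4)^j"
      using Cauchy[of "N j" "N (Suc j)"] N by (auto simp: strict_mono_less_eq intro: order_trans)
    also have "2^j * (1/4)^j = (1/2::real)^j" by (simp add: power_mult_distrib[symmetric])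
    finally show "(LINT x|leb_on D. \<bar>?a x\<bar>) \<le> (1 + vol) * (1/2)^j"
      by (simp add: algebra_simps)
  qed (auto intro!: summable_mult summable_geometric)
  then have conv: "AE x in leb_on D. convergent (\<lambda>j. g (N j) x)"
  proof eventually_elim
    case (elim x)
    then have "summable (\<lambda>j. g (N (Suc j)) x - g (N j) x)" by (rule summable_rabs_cancel)
    then have "convergent (\<lambda>n. \<Sum>j<n. g (N (Suc j)) x - g (N j) x)" by (simp add: summable_iff_convergent)
    then have "convergent (\<lambda>n. g (N 0) x + (\<Sum>j<n. g (N (Suc j)) x - g (N j) x))"
      by (simp add: convergent_add_const_iff)
    then show ?case by (subst (asm) sum_lessThan_telescope[of "\<lambda>j. g (N j) x"]) simp
  qed
  define f where "f x = lim (\<lambda>j. g (N j) x)" for x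
  have [measurable]: "f \<in> borel_measurable (leb_on D)"
    unfolding f_def by (rule borel_measurable_lim_metric) simp
  have lim: "AE x in leb_on D. (\<lambda>j. g (N j) x) \<longlonglongrightarrow> f x"
    using conv by eventually_elim (simp add: f_def convergent_LIMSEQ_iff)
  have diff: "L2_fun D (\<lambda>x. f x - g n x) \<and> sqn (\<lambda>x. f x - g n x) \<le> \<delta> n" for n
  proof -
    have L2: "L2_fun D (\<lambda>x. g (N j) x - g n x)" for j using g by (intro L2_fun_diff)
    have lim': "AE x in leb_on D. (\<lambda>j. g (N j) x - g n x) \<longlonglongrightarrow> f x - g n x"
      using lim by eventually_elim (rule tendsto_diff[OF _ tendsto_const])
    have "\<forall>\<^sub>F j in sequentially. n \<le> N j"
      using filterlim_subseq[OF N(2)] by (simp add: filterlim_at_top)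
    then have ev: "\<forall>\<^sub>F j in sequentially. sqn (\<lambda>x. g (N j) x - g n x) \<le> \<delta> n"
      by (rule eventually_mono) (rule Cauchy)
    show ?thesis using L2_fatou[OF L2 _ lim' ev] by simp
  qed
  have "L2_fun D f" using L2_fun_add[OF conjunct1[OF diff[of 0]] g[of 0]] by simp
  with diff show ?thesis using that by blast
qed

lemma L2_simple_approx:
  assumes f: "L2_fun D f"
  obtains F where "\<And>n. simple_function (leb_on D) (F n)"
    "\<And>x. x \<in> D \<Longrightarrow> (\<lambda>n. F n x) \<longlonglongrightarrow> f x" "(\<lambda>n. sqn (\<lambda>x. F n x - f x)) \<longlonglongrightarrow> 0"
proof -
  have [measurable]: "f \<in> borel_measurable (leb_on D)" using f by (rule L2_fun_borel)
  obtain F where F0: "\<forall>n. simple_function (leb_on D) (F n)"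
    "\<forall>x\<in>space (leb_on D). (\<lambda>n. F n x) \<longlonglongrightarrow> f x"
    "\<forall>n. \<forall>x\<in>space (leb_on D). dist (F n x) 0 \<le> 2 * dist (f x) 0"
    using borel_measurable_implies_sequence_metric[of f "leb_on D" 0] by auto
  then have F: "\<And>n. simple_function (leb_on D) (F n)"
    "\<And>x. x \<in> D \<Longrightarrow> (\<lambda>n. F n x) \<longlonglongrightarrow> f x" "\<And>n x. x \<in> D \<Longrightarrow> norm (F n x) \<le> 2 * norm (f x)"
    by (auto simp: space_leb_on)
  have [measurable]: "F n \<in> borel_measurable (leb_on D)" for n
    using F(1) by (rule borel_measurable_simple_function)
  have "(\<lambda>n. sqn (\<lambda>x. F n x - f x)) \<longlonglongrightarrow> (LINT x|leb_on D. 0)"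
  proof (rule integral_dominated_convergence[where w="\<lambda>x. 9 * (f x)\<^sup>2"])
    show "integrable (leb_on D) (\<lambda>x. 9 * (f x)\<^sup>2)" using L2_fun_square[OF f] by simp
    show "AE x in leb_on D. (\<lambda>n. (F n x - f x)\<^sup>2) \<longlonglongrightarrow> 0"
    proof (intro AE_I2)
      fix x assume "x \<in> space (leb_on D)"
      then have "(\<lambda>n. F n x - f x) \<longlonglongrightarrow> 0" using F(2) by (simp add: space_leb_on LIM_zero)
      from tendsto_power[OF this, of 2] show "(\<lambda>n. (F n x - f x)\<^sup>2) \<longlonglongrightarrow> 0" by simp
    qed
    show "AE x in leb_on D. norm ((F n x - f x)\<^sup>2) \<le> 9 * (f x)\<^sup>2" for n
    proof (intro AE_I2)
      fix x assume "x \<in> space (leb_on D)"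
      then have "\<bar>F n x - f x\<bar> \<le> 3 * \<bar>f x\<bar>" using F(3)[of x n] by (simp add: space_leb_on)
      from power_mono[OF this, of 2] show "norm ((F n x - f x)\<^sup>2) \<le> 9 * (f x)\<^sup>2"
        by (simp add: power_mult_distrib)
    qed
  qed auto
  then have lim: "(\<lambda>n. sqn (\<lambda>x. F n x - f x)) \<longlonglongrightarrow> 0" by simp
  show ?thesis by (rule that[OF F(1) F(2) lim])
qed

lemma L2_inner_commute: "L2_inner D f g = L2_inner D g f"
  by (simp add: L2_inner_def mult.commute)

lemma L2_inner_linear:
  assumes "L2_fun D f" "L2_fun D g" "L2_fun D h"
  shows "L2_inner D (\<lambda>x. f x + c * g x) h = L2_inner D f h + c * L2_inner D g h"
proof -
  have "L2_inner D (\<lambda>x. f x + c * g x) h = (LINT x|leb_on D. f x * h x + c * (g x * h x))"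
    unfolding L2_inner_def by (simp add: algebra_simps)
  also have "\<dots> = L2_inner D f h + c * L2_inner D g h"
    using assms unfolding L2_inner_def by (simp add: L2_fun_mult)
  finally show ?thesis .
qed

lemma L2_inner_sum:
  assumes "\<And>i. i \<in> I \<Longrightarrow> L2_fun D (f i)" "L2_fun D h"
  shows "L2_inner D (\<lambda>x. \<Sum>i\<in>I. c i * f i x) h = (\<Sum>i\<in>I. c i * L2_inner D (f i) h)"
proof -
  have "L2_inner D (\<lambda>x. \<Sum>i\<in>I. c i * f i x) h = (LINT x|leb_on D. (\<Sum>i\<in>I. c i * (f i x * h x)))"
    unfolding L2_inner_def by (simp add: sum_distrib_right mult.assoc)
  also have "\<dots> = (\<Sum>i\<in>I. c i * L2_inner D (f i) h)"
    using assms unfolding L2_inner_def by (subst Bochner_Integration.integral_sum) (auto simp: L2_fun_mult)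
  finally show ?thesis .
qed

lemma L2_inner_tendsto:
  assumes g: "\<And>n. L2_fun D (g n)" and f: "L2_fun D f" and h: "L2_fun D h"
    and lim: "(\<lambda>n. sqn (\<lambda>x. g n x - f x)) \<longlonglongrightarrow> 0"
  shows "(\<lambda>n. L2_inner D (g n) h) \<longlonglongrightarrow> L2_inner D f h"
proof -
  have "\<bar>L2_inner D (g n) h - L2_inner D f h\<bar> \<le> sqrt (sqn (\<lambda>x. g n x - f x) * sqn h)" for n
  proof (rule real_le_rsqrt)
    have "L2_inner D (g n) h - L2_inner D f h = L2_inner D (\<lambda>x. g n x - f x) h"
      using L2_inner_linear[OF g f h, of n "-1"] by simp
    then show "\<bar>L2_inner D (g n) h - L2_inner D f h\<bar>\<^sup>2 \<le> sqn (\<lambda>x. g n x - f x) * sqn h"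
      using L2_Cauchy_Schwarz[OF L2_fun_diff[OF g[of n] f] h] by simp
  qed
  moreover have "(\<lambda>n. sqrt (sqn (\<lambda>x. g n x - f x) * sqn h)) \<longlonglongrightarrow> sqrt (0 * sqn h)"
    by (intro tendsto_real_sqrt tendsto_mult lim tendsto_const)
  ultimately have "(\<lambda>n. L2_inner D (g n) h - L2_inner D f h) \<longlonglongrightarrow> 0"
    by - (rule Lim_null_comparison[OF always_eventually, of _ "\<lambda>n. sqrt (sqn (\<lambda>x. g n x - f x) * sqn h)"], auto)
  then show ?thesis by (simp add: LIM_zero_iff)
qed

end

section \<open>Integrals of simple functions\<close>

locale levy_white_noise = prob_space M + bounded_region D
  for M :: "'w measure" and D :: "'a::euclidean_space set" +
  fixes b \<sigma> :: real and \<nu> :: "real measure" and \<xi> :: "'a set \<Rightarrow> 'w \<Rightarrow> real"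
  assumes noise: "symmetric_levy_noise M D b \<sigma> \<nu> \<xi>"
begin

abbreviation "\<Psi> \<equiv> levy_exponent b \<sigma> \<nu>"
abbreviation "SI \<equiv> simple_noise_integral D \<xi>"

lemma levy: "symmetric_levy_measure \<nu>"
  using noise unfolding symmetric_levy_noise_def by blast

lemma measurable_xi [measurable]: "A \<in> sets (leb_on D) \<Longrightarrow> \<xi> A \<in> borel_measurable M"
  using noise unfolding symmetric_levy_noise_def by blast

lemma measurable_SI [measurable]:
  assumes "simple_function (leb_on D) h" "A \<in> sets (leb_on D)"
  shows "SI h A \<in> borel_measurable M"
proof -
  have "(\<lambda>\<omega>. \<Sum>\<alpha>\<in>h ` D. \<alpha> * \<xi> (A \<inter> {x\<in>D. h x = \<alpha>}) \<omega>) \<in> borel_measurable M"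
    using simple_function_level_set[OF assms]
    by (intro borel_measurable_sum borel_measurable_times borel_measurable_const measurable_xi)
  then show ?thesis by (simp add: simple_noise_integral_def[abs_def])
qed

text \<open>The constant family of empty sets is disjoint, so countable additivity makes a constant
  series converge; its term must vanish.\<close>

lemma xi_empty: "AE \<omega> in M. \<xi> {} \<omega> = 0"
proof -
  have "AE \<omega> in M. (\<lambda>n. \<xi> ((\<lambda>_::nat. {}) n) \<omega>) sums \<xi> (\<Union>n. (\<lambda>_::nat. {}) n) \<omega>"
    using noise unfolding symmetric_levy_noise_def
    by (elim conjE allE[of _ "\<lambda>_::nat. {}"]) (auto simp: disjoint_family_on_def)
  then show ?thesis
  proof eventually_elim
    case (elim \<omega>)
    then have "summable (\<lambda>n::nat. \<xi> {} \<omega>)" by (simp add: sums_iff)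
    then show ?case by (simp add: summable_const_iff)
  qed
qed

lemma xi_Un:
  assumes A: "A \<in> sets (leb_on D)" and B: "B \<in> sets (leb_on D)" and disj: "A \<inter> B = {}"
  shows "AE \<omega> in M. \<xi> (A \<union> B) \<omega> = \<xi> A \<omega> + \<xi> B \<omega>"
proof -
  have "disjoint_family (binaryset A B)"
    using disj by (auto simp: disjoint_family_on_def binaryset_def)
  moreover have "range (binaryset A B) \<subseteq> sets (leb_on D)"
    using A B by (auto simp: range_binaryset_eq)
  ultimately have "AE \<omega> in M. (\<lambda>n. \<xi> (binaryset A B n) \<omega>) sums \<xi> (\<Union>n. binaryset A B n) \<omega>"
    using noise unfolding symmetric_levy_noise_def by blast
  with xi_empty show ?thesis
  proof eventually_elim
    case (elim \<omega>)
    have "(\<lambda>n. \<xi> (binaryset A B n) \<omega>) sums (\<xi> A \<omega> + \<xi> B \<omega>)"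
      using elim(1) by (rule binaryset_sums)
    with elim(2) show ?case by (simp add: UN_binaryset_eq sums_unique2)
  qed
qed

lemma xi_UN:
  assumes "finite I" "\<And>i. i \<in> I \<Longrightarrow> B i \<in> sets (leb_on D)" "disjoint_family_on B I"
  shows "AE \<omega> in M. \<xi> (\<Union>i\<in>I. B i) \<omega> = (\<Sum>i\<in>I. \<xi> (B i) \<omega>)"
  using assms
proof (induction I)
  case empty
  then show ?case using xi_empty by simp
next
  case (insert i I)
  have "AE \<omega> in M. \<xi> (B i \<union> (\<Union>i\<in>I. B i)) \<omega> = \<xi> (B i) \<omega> + \<xi> (\<Union>i\<in>I. B i) \<omega>"
  proof (rule xi_Un)
    show "(\<Union>i\<in>I. B i) \<in> sets (leb_on D)"
      using insert by (intro sets.finite_UN) auto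
    show "B i \<inter> (\<Union>i\<in>I. B i) = {}"
      using insert.hyps(2) insert.prems(2) by (fastforce simp: disjoint_family_on_def)
  qed (use insert.prems in auto)
  moreover have "AE \<omega> in M. \<xi> (\<Union>i\<in>I. B i) \<omega> = (\<Sum>i\<in>I. \<xi> (B i) \<omega>)"
    using insert.prems by (intro insert.IH) (auto simp: disjoint_family_on_def)
  ultimately show ?case
    by eventually_elim (use insert.hyps in simp)
qed

text \<open>Frees the integral from the representation by level sets: blocks with equal coefficient
  are merged by additivity of \<open>\<xi>\<close>. Nonempty blocks guarantee that every
  \<open>\<beta> i\<close> is a value of \<open>h\<close>.\<close>

lemma SI_partition:
  assumes I: "finite I" and B: "\<And>i. i \<in> I \<Longrightarrow> B i \<in> sets (leb_on D)"
    and ne: "\<And>i. i \<in> I \<Longrightarrow> B i \<noteq> {}" and disj: "disjoint_family_on B I"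
    and D: "(\<Union>i\<in>I. B i) = D" and h: "\<And>i x. i \<in> I \<Longrightarrow> x \<in> B i \<Longrightarrow> h x = \<beta> i"
    and A: "A \<in> sets (leb_on D)"
  shows "AE \<omega> in M. SI h A \<omega> = (\<Sum>i\<in>I. \<beta> i * \<xi> (A \<inter> B i) \<omega>)"
proof -
  have range: "h ` D = \<beta> ` I"
  proof
    show "h ` D \<subseteq> \<beta> ` I" using D h by blast
    show "\<beta> ` I \<subseteq> h ` D"
    proof
      fix y assume "y \<in> \<beta> ` I"
      then obtain i where i: "i \<in> I" "y = \<beta> i" by blast
      then obtain x where "x \<in> B i" using ne by blast
      then have "x \<in> D" "h x = y" using i D h by auto
      then show "y \<in> h ` D" by blast
    qed
  qed
  have "AE \<omega> in M. \<forall>\<alpha>\<in>h ` D. \<xi> (A \<inter> {x\<in>D. h x = \<alpha>}) \<omega> = (\<Sum>i\<in>{i\<in>I. \<beta> i = \<alpha>}. \<xi> (A \<inter> B i) \<omega>)"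
  proof (rule AE_finite_allI)
    show "finite (h ` D)" using range I by simp
    fix \<alpha>
    have "A \<inter> {x\<in>D. h x = \<alpha>} = (\<Union>i\<in>{i\<in>I. \<beta> i = \<alpha>}. A \<inter> B i)"
      using D h by fastforce
    moreover have "AE \<omega> in M. \<xi> (\<Union>i\<in>{i\<in>I. \<beta> i = \<alpha>}. A \<inter> B i) \<omega>
        = (\<Sum>i\<in>{i\<in>I. \<beta> i = \<alpha>}. \<xi> (A \<inter> B i) \<omega>)"
      using I A B disj by (intro xi_UN) (auto simp: disjoint_family_on_def)
    ultimately show "AE \<omega> in M. \<xi> (A \<inter> {x\<in>D. h x = \<alpha>}) \<omega> = (\<Sum>i\<in>{i\<in>I. \<beta> i = \<alpha>}. \<xi> (A \<inter> B i) \<omega>)"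
      by simp
  qed
  then show ?thesis
  proof eventually_elim
    case (elim \<omega>)
    have "SI h A \<omega> = (\<Sum>\<alpha>\<in>\<beta> ` I. \<alpha> * (\<Sum>i\<in>{i\<in>I. \<beta> i = \<alpha>}. \<xi> (A \<inter> B i) \<omega>))"
      unfolding simple_noise_integral_def using elim range by (intro sum.cong) auto
    also have "\<dots> = (\<Sum>\<alpha>\<in>\<beta> ` I. \<Sum>i\<in>{i\<in>I. \<beta> i = \<alpha>}. \<beta> i * \<xi> (A \<inter> B i) \<omega>)"
      by (simp add: sum_distrib_left)
    also have "\<dots> = (\<Sum>i\<in>I. \<beta> i * \<xi> (A \<inter> B i) \<omega>)"
      by (rule sum.image_gen[OF I, symmetric])
    finally show ?case .
  qed
qed

text \<open>The level sets of the pair \<open>(f x, g x)\<close> form a common refinement on which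
  all three integrals are sums over one index set.\<close>

lemma SI_linear:
  assumes f: "simple_function (leb_on D) f" and g: "simple_function (leb_on D) g"
    and A: "A \<in> sets (leb_on D)"
  shows "AE \<omega> in M. SI (\<lambda>x. f x + c * g x) A \<omega> = SI f A \<omega> + c * SI g A \<omega>"
proof -
  define I where "I = (\<lambda>x. (f x, g x)) ` D"
  define B where "B = (\<lambda>(p, q). {x\<in>D. f x = p} \<inter> {x\<in>D. g x = q})"
  have I: "finite I"
    by (rule finite_subset[of _ "f ` D \<times> g ` D"])
       (use finite_simple_range[OF f] finite_simple_range[OF g] in \<open>auto simp: I_def\<close>)
  have top: "D \<in> sets (leb_on D)" using D_borel by (simp add: sets_leb_on)
  have B: "B i \<in> sets (leb_on D)" for i
    using simple_function_level_set[OF f top] simple_function_level_set[OF g top]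
    by (cases i) (auto simp: B_def Int_absorb1)
  note part = SI_partition[OF I B _ _ _ _ A]
  have ne: "B i \<noteq> {}" if "i \<in> I" for i using that by (auto simp: I_def B_def)
  have disj: "disjoint_family_on B I" by (auto simp: disjoint_family_on_def B_def)
  have UN: "(\<Union>i\<in>I. B i) = D" by (auto simp: I_def B_def)
  have "AE \<omega> in M. SI (\<lambda>x. f x + c * g x) A \<omega> = (\<Sum>i\<in>I. (fst i + c * snd i) * \<xi> (A \<inter> B i) \<omega>)"
    by (rule part) (use ne disj UN in \<open>auto simp: B_def\<close>)
  moreover have "AE \<omega> in M. SI f A \<omega> = (\<Sum>i\<in>I. fst i * \<xi> (A \<inter> B i) \<omega>)"
    by (rule part) (use ne disj UN in \<open>auto simp: B_def\<close>)
  moreover have "AE \<omega> in M. SI g A \<omega> = (\<Sum>i\<in>I. snd i * \<xi> (A \<inter> B i) \<omega>)"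
    by (rule part) (use ne disj UN in \<open>auto simp: B_def\<close>)
  ultimately show ?thesis
    by eventually_elim (simp add: algebra_simps sum.distrib sum_distrib_left)
qed

lemma exponent_integral_simple:
  assumes h: "simple_function (leb_on D) h" and A: "A \<in> sets (leb_on D)"
  shows "(CLINT x|leb_on D. indicator A x * \<Psi> (u * h x))
    = (\<Sum>\<alpha>\<in>h ` D. of_real (measure lborel (A \<inter> {x\<in>D. h x = \<alpha>})) * \<Psi> (u * \<alpha>))"
proof -
  note B = simple_function_level_set[OF h A]
  have "(CLINT x|leb_on D. indicator A x * \<Psi> (u * h x))
      = (CLINT x|leb_on D. \<Sum>\<alpha>\<in>h ` D. indicator (A \<inter> {x\<in>D. h x = \<alpha>}) x *\<^sub>R \<Psi> (u * \<alpha>))"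
  proof (rule Bochner_Integration.integral_cong[OF refl])
    fix x assume "x \<in> space (leb_on D)"
    then have x: "x \<in> D" by (simp add: space_leb_on)
    have "(\<Sum>\<alpha>\<in>h ` D. indicator (A \<inter> {x\<in>D. h x = \<alpha>}) x *\<^sub>R \<Psi> (u * \<alpha>))
        = (\<Sum>\<alpha>\<in>h ` D. if \<alpha> = h x then indicator A x * \<Psi> (u * h x) else 0)"
      using x by (intro sum.cong) (auto simp: indicator_def)
    also have "\<dots> = indicator A x * \<Psi> (u * h x)"
      using finite_simple_range[OF h] x by simp
    finally show "indicator A x * \<Psi> (u * h x)
        = (\<Sum>\<alpha>\<in>h ` D. indicator (A \<inter> {x\<in>D. h x = \<alpha>}) x *\<^sub>R \<Psi> (u * \<alpha>))" by simp
  qed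
  also have "\<dots> = (\<Sum>\<alpha>\<in>h ` D. CLINT x|leb_on D. indicator (A \<inter> {x\<in>D. h x = \<alpha>}) x *\<^sub>R \<Psi> (u * \<alpha>))"
    using B by (intro Bochner_Integration.integral_sum integrable_scaleR_left integrable_real_indicator)
       (auto simp: leb.emeasure_eq_measure)
  also have "\<dots> = (\<Sum>\<alpha>\<in>h ` D. of_real (measure lborel (A \<inter> {x\<in>D. h x = \<alpha>})) * \<Psi> (u * \<alpha>))"
  proof (rule sum.cong[OF refl])
    fix \<alpha>
    have "(CLINT x|leb_on D. indicator (A \<inter> {x\<in>D. h x = \<alpha>}) x *\<^sub>R \<Psi> (u * \<alpha>))
      = (LINT x|leb_on D. indicator (A \<inter> {x\<in>D. h x = \<alpha>}) x) *\<^sub>R \<Psi> (u * \<alpha>)"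
      using B by (intro integral_scaleR_left integrable_real_indicator)
        (auto simp: leb.emeasure_eq_measure)
    also have "(LINT x|leb_on D. indicator (A \<inter> {x\<in>D. h x = \<alpha>}) x) = measure lborel (A \<inter> {x\<in>D. h x = \<alpha>})"
      using B[of \<alpha>] by (simp add: measure_leb_on sets.Int_space_eq2 del: space_restrict_space)
    finally show "(CLINT x|leb_on D. indicator (A \<inter> {x\<in>D. h x = \<alpha>}) x *\<^sub>R \<Psi> (u * \<alpha>))
      = of_real (measure lborel (A \<inter> {x\<in>D. h x = \<alpha>})) * \<Psi> (u * \<alpha>)" by (simp add: scaleR_conv_of_real)
  qed
  finally show ?thesis .
qed

lemma SI_char:
  assumes h: "simple_function (leb_on D) h" and A: "A \<in> sets (leb_on D)"
  shows "(CLINT \<omega>|M. iexp (u * SI h A \<omega>)) = exp (CLINT x|leb_on D. indicator A x * \<Psi> (u * h x))"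
proof -
  define B where "B \<alpha> = A \<inter> {x\<in>D. h x = \<alpha>}" for \<alpha>
  have B [measurable]: "B \<alpha> \<in> sets (leb_on D)" for \<alpha>
    unfolding B_def by (rule simple_function_level_set[OF h A])
  obtain f where f: "bij_betw f {0..<card (h ` D)} (h ` D)"
    using ex_bij_betw_nat_finite[OF finite_simple_range[OF h]] by blast
  define n where "n = card (h ` D)"
  \<comment> \<open>Independence is given for sequences indexed by all natural numbers, so the
    finitely many level sets are enumerated and padded with the empty set.\<close>
  define C where "C i = (if i < n then B (f i) else {})" for i :: nat
  have "disjoint_family C"
  proof (unfold disjoint_family_on_def, intro ballI impI)
    fix i j :: nat assume "i \<noteq> j"
    then have "f i \<noteq> f j" if "i < n" "j < n"
      using f that unfolding n_def[symmetric] by (auto simp: bij_betw_def inj_on_def)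
    then show "C i \<inter> C j = {}" by (auto simp: C_def B_def)
  qed
  moreover have "range C \<subseteq> sets (leb_on D)" by (auto simp: C_def)
  ultimately have "indep_vars (\<lambda>_. borel) (\<lambda>i. \<xi> (C i)) UNIV"
    using noise unfolding symmetric_levy_noise_def by blast
  then have "indep_vars (\<lambda>_. borel) (\<lambda>i. \<xi> (C i)) {0..<n}"
    by (rule indep_vars_subset) simp
  then have "indep_vars (\<lambda>_. borel) (\<lambda>i \<omega>. f i * \<xi> (C i) \<omega>) {0..<n}"
    by (rule indep_vars_compose2) simp
  from char_distr_sum[OF this, of u]
  have *: "(CLINT \<omega>|M. iexp (u * (\<Sum>i\<in>{0..<n}. f i * \<xi> (C i) \<omega>)))
      = (\<Prod>i\<in>{0..<n}. CLINT \<omega>|M. iexp (u * (f i * \<xi> (C i) \<omega>)))"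
    unfolding char_def by (simp add: integral_distr C_def cong: prod.cong)
  have single: "(CLINT \<omega>|M. iexp (u * (\<alpha> * \<xi> (B \<alpha>) \<omega>)))
      = exp (of_real (measure lborel (B \<alpha>)) * \<Psi> (u * \<alpha>))" for \<alpha>
    unfolding mult.assoc[symmetric]
    using noise B[of \<alpha>] unfolding symmetric_levy_noise_def by blast
  have "SI h A = (\<lambda>\<omega>. \<Sum>i\<in>{0..<n}. f i * \<xi> (C i) \<omega>)"
    unfolding simple_noise_integral_def[abs_def] B_def[symmetric] n_def
    by (subst sum.reindex_bij_betw[OF f, symmetric]) (auto simp: C_def n_def)
  then have "(CLINT \<omega>|M. iexp (u * SI h A \<omega>))
      = (\<Prod>i\<in>{0..<n}. CLINT \<omega>|M. iexp (u * (f i * \<xi> (C i) \<omega>)))"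
    using * by simp
  also have "\<dots> = (\<Prod>i\<in>{0..<n}. exp (of_real (measure lborel (B (f i))) * \<Psi> (u * f i)))"
  proof (rule prod.cong[OF refl])
    fix i assume "i \<in> {0..<n}"
    then have "C i = B (f i)" by (simp add: C_def)
    then show "(CLINT \<omega>|M. iexp (u * (f i * \<xi> (C i) \<omega>)))
        = exp (of_real (measure lborel (B (f i))) * \<Psi> (u * f i))"
      by (simp only: single)
  qed
  also have "\<dots> = (\<Prod>\<alpha>\<in>h ` D. exp (of_real (measure lborel (B \<alpha>)) * \<Psi> (u * \<alpha>)))"
    unfolding n_def by (rule prod.reindex_bij_betw[OF f])
  also have "\<dots> = exp (CLINT x|leb_on D. indicator A x * \<Psi> (u * h x))"
    unfolding exponent_integral_simple[OF h A] B_def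
    by (rule exp_sum[symmetric]) (rule finite_simple_range[OF h])
  finally show ?thesis .
qed

end

section \<open>Continuity of simple integrals and uniqueness of their limits\<close>

context levy_white_noise
begin

lemma measurable_exponent_simple:
  assumes h: "simple_function (leb_on D) h"
  shows "(\<lambda>x. \<Psi> (u * h x)) \<in> borel_measurable (leb_on D)"
  using simple_function_compose[OF h, of "\<lambda>y. \<Psi> (u * y)"]
  by (intro borel_measurable_simple_function) (simp add: o_def)

lemma integrable_exponent_simple:
  assumes h: "simple_function (leb_on D) h" and A: "A \<in> sets (leb_on D)"
  shows "complex_integrable (leb_on D) (\<lambda>x. indicator A x * \<Psi> (u * h x))"
proof -
  obtain C where C: "0 \<le> C" "\<And>v. cmod (\<Psi> v) \<le> 1 + C * v\<^sup>2"
    using levy_exponent_bound[OF levy, of 1 b \<sigma>] by auto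
  have [measurable]: "A \<in> sets (leb_on D)" by (rule A)
  note [measurable] = measurable_exponent_simple[OF h]
  show ?thesis
  proof (rule Bochner_Integration.integrable_bound)
    show "integrable (leb_on D) (\<lambda>x. 1 + C * u\<^sup>2 * (h x)\<^sup>2)"
      using L2_fun_square[OF L2_fun_simple[OF h]] by simp
    show "AE x in leb_on D. cmod (indicator A x * \<Psi> (u * h x)) \<le> norm (1 + C * u\<^sup>2 * (h x)\<^sup>2)"
    proof (intro AE_I2)
      fix x
      have "cmod (indicator A x * \<Psi> (u * h x)) \<le> cmod (\<Psi> (u * h x))"
        by (simp add: indicator_def)
      also have "\<dots> \<le> 1 + C * (u * h x)\<^sup>2" by (rule C)
      also have "\<dots> = 1 + C * u\<^sup>2 * (h x)\<^sup>2" by (simp add: power_mult_distrib)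
      also have "\<dots> \<le> norm (1 + C * u\<^sup>2 * (h x)\<^sup>2)" by simp
      finally show "cmod (indicator A x * \<Psi> (u * h x)) \<le> norm (1 + C * u\<^sup>2 * (h x)\<^sup>2)" .
    qed
  qed measurable
qed

lemma Re_exponent_integral_nonpos:
  assumes h: "simple_function (leb_on D) h" and A: "A \<in> sets (leb_on D)"
  shows "Re (CLINT x|leb_on D. indicator A x * \<Psi> (u * h x)) \<le> 0"
proof -
  have "Re (CLINT x|leb_on D. indicator A x * \<Psi> (u * h x))
      = - (LINT x|leb_on D. - Re (indicator A x * \<Psi> (u * h x)))"
    unfolding integral_Re[OF integrable_exponent_simple[OF h A], symmetric]
    by (simp only: Bochner_Integration.integral_minus minus_minus)
  also have "\<dots> \<le> 0"
    using Re_levy_exponent_nonpos[OF levy, of b \<sigma>]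
    by (auto intro!: Bochner_Integration.integral_nonneg simp: indicator_def)
  finally show ?thesis .
qed

text \<open>Writing 1 as exp 0 reduces the claim to the size of the exponent. Restriction to
  \<open>A\<close> only lowers the modulus of the integrand, so the bound is uniform in
  \<open>A\<close>.\<close>

lemma SI_char_bound:
  assumes C: "\<And>v. cmod (\<Psi> v) \<le> \<eta> + C * v\<^sup>2" and C0: "0 \<le> C" "0 \<le> \<eta>"
    and h: "simple_function (leb_on D) h" and A: "A \<in> sets (leb_on D)"
  shows "cmod (1 - (CLINT \<omega>|M. iexp (g * SI h A \<omega>))) \<le> \<eta> * vol + C * sqn h * g\<^sup>2"
proof -
  let ?w = "CLINT x|leb_on D. indicator A x * \<Psi> (g * h x)"
  have "cmod (1 - (CLINT \<omega>|M. iexp (g * SI h A \<omega>))) = cmod (exp 0 - exp ?w)"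
    by (simp only: SI_char[OF h A] exp_zero)
  also have "\<dots> \<le> cmod (0 - ?w)"
    by (rule norm_exp_diff_le) (use Re_exponent_integral_nonpos[OF h A] in auto)
  also have "\<dots> = cmod ?w" by simp
  also have "\<dots> \<le> (LINT x|leb_on D. \<eta> + C * g\<^sup>2 * (h x)\<^sup>2)"
  proof (rule norm_integral_le[OF integrable_exponent_simple[OF h A]])
    show "integrable (leb_on D) (\<lambda>x. \<eta> + C * g\<^sup>2 * (h x)\<^sup>2)"
      using L2_fun_square[OF L2_fun_simple[OF h]] by simp
    fix x
    have "cmod (indicator A x * \<Psi> (g * h x)) \<le> cmod (\<Psi> (g * h x))"
      by (simp add: indicator_def)
    also have "\<dots> \<le> \<eta> + C * (g * h x)\<^sup>2" by (rule C)
    finally show "cmod (indicator A x * \<Psi> (g * h x)) \<le> \<eta> + C * g\<^sup>2 * (h x)\<^sup>2"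
      by (simp add: power_mult_distrib)
  qed
  also have "\<dots> = \<eta> * vol + C * sqn h * g\<^sup>2"
    using L2_fun_square[OF L2_fun_simple[OF h]] by (simp add: space_leb_on)
  finally show ?thesis .
qed

text \<open>Stated for any \<open>X\<close> with a bound of this form, so that it serves the simple
  integrals and then their L2 limits. The order of choice matters: \<eta> from \<epsilon>, then
  \<open>C\<close> from \<eta>, then \<delta> from \<open>C\<close>.\<close>

lemma prob_dist_small_of_char:
  assumes "0 < \<epsilon>"
  obtains \<delta> where "0 < \<delta>"
    "\<And>X s. X \<in> borel_measurable M \<Longrightarrow> 0 \<le> s \<Longrightarrow> s \<le> \<delta> \<Longrightarrow>
      (\<And>\<eta> C g. (\<And>v. cmod (\<Psi> v) \<le> \<eta> + C * v\<^sup>2) \<Longrightarrow> 0 \<le> C \<Longrightarrow> 0 \<le> \<eta> \<Longrightarrow>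
        cmod (1 - (CLINT \<omega>|M. iexp (g * X \<omega>))) \<le> \<eta> * vol + C * s * g\<^sup>2) \<Longrightarrow>
      prob_dist M X (\<lambda>_. 0) \<le> \<epsilon>"
proof -
  define V where "V = vol + 1"
  have V: "0 < V" "vol \<le> V" unfolding V_def by (auto intro: add_nonneg_pos)
  \<comment> \<open>\<eta> here and \<delta> below give each of the two terms the share
    \<epsilon>^2/6, which the factor 3 of \<open>prob_dist_le_of_char\<close> turns into
    \<epsilon>^2 in total. The 1 added in \<open>V\<close> and in \<open>C\<close> keeps the
    divisors positive.\<close>
  define \<eta> where "\<eta> = \<epsilon>\<^sup>2 / (6 * V)"
  have \<eta>: "0 < \<eta>" unfolding \<eta>_def using assms V by (intro divide_pos_pos) auto
  obtain C0 where C0: "0 \<le> C0" "\<And>v. cmod (\<Psi> v) \<le> \<eta> + C0 * v\<^sup>2"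
    using levy_exponent_bound[OF levy \<eta>, of b \<sigma>] by auto
  define C where "C = C0 + 1"
  have C_pos: "0 < C" using C0(1) by (simp add: C_def)
  have C: "cmod (\<Psi> v) \<le> \<eta> + C * v\<^sup>2" for v
    using C0(2)[of v] zero_le_power2[of v] unfolding C_def distrib_right by linarith
  define \<delta> where "\<delta> = \<epsilon>\<^sup>2 / (6 * C)"
  have \<delta>: "0 < \<delta>" unfolding \<delta>_def using assms C_pos by (intro divide_pos_pos) auto
  show ?thesis
  proof (rule that[OF \<delta>])
    fix X and s :: real
    assume X: "X \<in> borel_measurable M" and s: "0 \<le> s" "s \<le> \<delta>"
      and bound: "\<And>\<eta> C g. (\<And>v. cmod (\<Psi> v) \<le> \<eta> + C * v\<^sup>2) \<Longrightarrow> 0 \<le> C \<Longrightarrow> 0 \<le> \<eta> \<Longrightarrow>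
        cmod (1 - (CLINT \<omega>|M. iexp (g * X \<omega>))) \<le> \<eta> * vol + C * s * g\<^sup>2"
    have "(prob_dist M X (\<lambda>_. 0))\<^sup>2 \<le> 3 * (\<eta> * vol + C * s)"
      by (rule prob_dist_le_of_char[OF X bound[OF C]]) (use \<eta> C_pos in auto)
    also have "\<dots> \<le> 3 * (\<epsilon>\<^sup>2 / 6 + \<epsilon>\<^sup>2 / 6)"
    proof (intro mult_left_mono add_mono)
      have "\<eta> * vol \<le> \<eta> * V" by (rule mult_left_mono) (use \<eta> V in auto)
      also have "\<dots> = \<epsilon>\<^sup>2 / 6" using V(1) by (simp add: \<eta>_def)
      finally show "\<eta> * vol \<le> \<epsilon>\<^sup>2 / 6" .
      have "C * s \<le> C * \<delta>" by (rule mult_left_mono) (use s C_pos in auto)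
      also have "\<dots> = \<epsilon>\<^sup>2 / 6" using C_pos by (simp add: \<delta>_def)
      finally show "C * s \<le> \<epsilon>\<^sup>2 / 6" .
    qed simp
    also have "\<dots> = \<epsilon>\<^sup>2" by simp
    finally have "(prob_dist M X (\<lambda>_. 0))\<^sup>2 \<le> \<epsilon>\<^sup>2" .
    then show "prob_dist M X (\<lambda>_. 0) \<le> \<epsilon>"
      by (rule power2_le_imp_le) (use assms in simp)
  qed
qed

lemma SI_small:
  assumes "0 < \<epsilon>"
  obtains \<delta> where "0 < \<delta>"
    "\<And>h A. simple_function (leb_on D) h \<Longrightarrow> A \<in> sets (leb_on D) \<Longrightarrow> sqn h \<le> \<delta> \<Longrightarrow>
      prob_dist M (SI h A) (\<lambda>_. 0) \<le> \<epsilon>"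
proof (rule prob_dist_small_of_char[OF assms])
  fix \<delta> :: real
  assume "0 < \<delta>" and \<delta>: "\<And>X s. X \<in> borel_measurable M \<Longrightarrow> 0 \<le> s \<Longrightarrow> s \<le> \<delta> \<Longrightarrow>
      (\<And>\<eta> C g. (\<And>v. cmod (\<Psi> v) \<le> \<eta> + C * v\<^sup>2) \<Longrightarrow> 0 \<le> C \<Longrightarrow> 0 \<le> \<eta> \<Longrightarrow>
        cmod (1 - (CLINT \<omega>|M. iexp (g * X \<omega>))) \<le> \<eta> * vol + C * s * g\<^sup>2) \<Longrightarrow>
      prob_dist M X (\<lambda>_. 0) \<le> \<epsilon>"
  show thesis
  proof (rule that[OF \<open>0 < \<delta>\<close>])
    fix h A assume h: "simple_function (leb_on D) h" "A \<in> sets (leb_on D)" and le: "sqn h \<le> \<delta>"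
    show "prob_dist M (SI h A) (\<lambda>_. 0) \<le> \<epsilon>"
      by (rule \<delta>[OF measurable_SI[OF h] sqn_nonneg le]) (rule SI_char_bound[OF _ _ _ h])
  qed
qed

lemma SI_prob_dist_diff:
  assumes f: "simple_function (leb_on D) f" and g: "simple_function (leb_on D) g"
    and A: "A \<in> sets (leb_on D)"
  shows "prob_dist M (SI f A) (SI g A) = prob_dist M (SI (\<lambda>x. f x - g x) A) (\<lambda>_. 0)"
proof -
  have "AE \<omega> in M. SI (\<lambda>x. f x - g x) A \<omega> = SI f A \<omega> - SI g A \<omega>"
    using SI_linear[OF f g A, of "-1"] by simp
  then have "(LINT \<omega>|M. min 1 \<bar>SI f A \<omega> - SI g A \<omega>\<bar>) = (LINT \<omega>|M. min 1 \<bar>SI (\<lambda>x. f x - g x) A \<omega>\<bar>)"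
    using measurable_SI[OF f A] measurable_SI[OF g A]
      measurable_SI[OF simple_function_diff[OF f g] A]
    by (intro integral_cong_AE) auto
  then show ?thesis by (simp add: prob_dist_def)
qed

lemma AE_zero_of_char:
  assumes [measurable]: "Y \<in> borel_measurable M"
    and char: "\<And>u. (CLINT \<omega>|M. iexp (u * Y \<omega>)) = 1"
  shows "AE \<omega> in M. Y \<omega> = 0"
proof (rule prob_dist_eq_0_imp_AE)
  have "(prob_dist M Y (\<lambda>_. 0))\<^sup>2 \<le> 3 * (0 + 0)"
    by (rule prob_dist_le_of_char) (use char in auto)
  then show "prob_dist M Y (\<lambda>_. 0) = 0" by simp
qed auto

text \<open>The stochastic integral does not depend on the approximating sequence. For simple
  \<open>H n \<rightarrow> 0\<close> the exponents \<open>\<integral> \<bar>\<Psi> (u * H n)\<bar>\<close> may only concentrate on ever smaller sets. Choosing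
  disjoint blocks that carry almost all of \<open>H (n k)\<close> and letting \<open>A\<close> be the union of the even
  blocks makes the characteristic functions of the integrals over \<open>A\<close> oscillate between those
  of the full integrals and \<open>1\<close>, so convergence over \<open>A\<close> forces the limit \<open>1\<close>.\<close>

lemma SI_limit_zero:
  assumes H: "\<And>n. simple_function (leb_on D) (H n)"
    and H0: "AE x in leb_on D. (\<lambda>n. H n x) \<longlonglongrightarrow> 0"
    and conv: "\<And>A. A \<in> sets (leb_on D) \<Longrightarrow> \<exists>Y. conv_in_prob M (\<lambda>n. SI (H n) A) Y"
    and Y: "conv_in_prob M (\<lambda>n. SI (H n) D) Y"
  shows "AE \<omega> in M. Y \<omega> = 0"
proof (rule AE_zero_of_char)
  show "Y \<in> borel_measurable M" using Y by (simp add: conv_in_prob_def)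
  fix u
  have top [measurable]: "D \<in> sets (leb_on D)" using D_borel by (simp add: sets_leb_on)
  have [measurable]: "H n \<in> borel_measurable (leb_on D)" for n
    using H by (rule borel_measurable_simple_function)
  note [measurable] = measurable_exponent_simple[OF H]
  obtain C where C: "0 \<le> C" "\<And>v. cmod (\<Psi> v) \<le> 1 + C * v\<^sup>2"
    using levy_exponent_bound[OF levy, of 1 b \<sigma>] by auto
  define p where "p n x = cmod (\<Psi> (u * H n x))" for n x
  have [measurable]: "p n \<in> borel_measurable (leb_on D)" for n unfolding p_def by measurable
  have int_p: "integrable (leb_on D) (\<lambda>x. indicator A x * p n x)" if "A \<in> sets (leb_on D)" for A n
  proof -
    have "integrable (leb_on D) (\<lambda>x. cmod (indicator A x * \<Psi> (u * H n x)))"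
      by (intro integrable_norm integrable_exponent_simple H that)
    moreover have "(\<lambda>x. cmod (indicator A x * \<Psi> (u * H n x))) = (\<lambda>x. indicator A x * p n x)"
      by (auto simp: p_def indicator_def)
    ultimately show ?thesis by simp
  qed
  define \<mu> where "\<mu> n A = (CLINT x|leb_on D. indicator A x * \<Psi> (u * H n x))" for n A
  define m where "m n A = (LINT x|leb_on D. indicator A x * p n x)" for n A
  \<comment> \<open>Sets increasing to almost all of \<open>D\<close>, on which the exponents from
    index \<open>k\<close> on are bounded. So the mass inside a fixed \<open>S k\<close> dies out as
    \<open>n\<close> grows, and for fixed \<open>n\<close> the mass outside \<open>S k\<close> dies
    out as \<open>k\<close> grows.\<close>
  define S where "S k = {x\<in>D. \<forall>n\<ge>k. \<bar>H n x\<bar> \<le> 1}" for k :: nat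
  have S [measurable]: "S k \<in> sets (leb_on D)" for k
  proof -
    have "{x\<in>space (leb_on D). \<forall>n\<ge>k. \<bar>H n x\<bar> \<le> 1} \<in> sets (leb_on D)" by measurable
    then show ?thesis by (simp add: S_def space_leb_on)
  qed
  have S_mono: "S k \<subseteq> S l" if "k \<le> l" for k l using that by (auto simp: S_def)
  have \<mu>_diff: "cmod (\<mu> n A - \<mu> n B) \<le> m n E"
    if [measurable]: "A \<in> sets (leb_on D)" "B \<in> sets (leb_on D)" "E \<in> sets (leb_on D)"
      and sub: "(A - B) \<union> (B - A) \<subseteq> E" for n A B E
  proof -
    have "\<mu> n A - \<mu> n B
        = (CLINT x|leb_on D. indicator A x * \<Psi> (u * H n x) - indicator B x * \<Psi> (u * H n x))"
      unfolding \<mu>_def by (intro Bochner_Integration.integral_diff[symmetric] integrable_exponent_simple H that)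
    also have "cmod \<dots> \<le> m n E"
      unfolding m_def
      by (intro norm_integral_le Bochner_Integration.integrable_diff integrable_exponent_simple H that int_p)
         (use sub in \<open>auto simp: p_def indicator_def\<close>)
    finally show ?thesis .
  qed
  have m_mono: "m n A \<le> m n B" if "A \<in> sets (leb_on D)" "B \<in> sets (leb_on D)" "A \<subseteq> B" for n A B
    unfolding m_def using that
    by (intro integral_mono int_p) (auto simp: p_def indicator_def)
  have m_Un: "m n (A \<union> B) \<le> m n A + m n B" if "A \<in> sets (leb_on D)" "B \<in> sets (leb_on D)" for n A B
  proof -
    have "m n (A \<union> B) \<le> (LINT x|leb_on D. indicator A x * p n x + indicator B x * p n x)"
      unfolding m_def using that
      by (intro integral_mono Bochner_Integration.integrable_add int_p sets.Un) (auto simp: p_def indicator_def)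
    also have "\<dots> = m n A + m n B"
      unfolding m_def using that by (intro Bochner_Integration.integral_add int_p)
    finally show ?thesis .
  qed
  have small_inside: "(\<lambda>n. m n (S k)) \<longlonglongrightarrow> 0" for k
  proof (rule LIMSEQ_offset[where k=k])
    have "(\<lambda>n. m (n + k) (S k)) \<longlonglongrightarrow> (LINT x|leb_on D. 0)"
      unfolding m_def
    proof (rule integral_dominated_convergence[where w="\<lambda>_. 1 + C * u\<^sup>2"])
      show "AE x in leb_on D. (\<lambda>n. indicator (S k) x * p (n + k) x) \<longlonglongrightarrow> 0"
        using H0
      proof eventually_elim
        case (elim x)
        have "(\<lambda>n. u * H (n + k) x) \<longlonglongrightarrow> 0"
          by (intro tendsto_mult_right_zero LIMSEQ_ignore_initial_segment elim)
        then have "(\<lambda>n. p (n + k) x) \<longlonglongrightarrow> 0"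
          unfolding p_def by (intro tendsto_norm_zero levy_exponent_tendsto_0[OF levy])
        then show ?case by (rule tendsto_mult_right_zero)
      qed
      show "AE x in leb_on D. norm (indicator (S k) x * p (n + k) x) \<le> 1 + C * u\<^sup>2" for n
      proof (intro AE_I2)
        fix x
        show "norm (indicator (S k) x * p (n + k) x) \<le> 1 + C * u\<^sup>2"
        proof (cases "x \<in> S k")
          case True
          then have "\<bar>H (n + k) x\<bar> \<le> 1" by (simp add: S_def)
          then have "(H (n + k) x)\<^sup>2 \<le> 1" by (simp add: abs_square_le_1)
          then have "C * u\<^sup>2 * (H (n + k) x)\<^sup>2 \<le> C * u\<^sup>2 * 1"
            using C(1) by (intro mult_left_mono) auto
          then have "1 + C * (u * H (n + k) x)\<^sup>2 \<le> 1 + C * u\<^sup>2"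
            by (simp add: power_mult_distrib mult.assoc)
          with C(2)[of "u * H (n + k) x"] have "p (n + k) x \<le> 1 + C * u\<^sup>2"
            unfolding p_def by linarith
          then show ?thesis using True by (simp add: p_def)
        next
          case False
          then show ?thesis using C(1) by simp
        qed
      qed
    qed auto
    then show "(\<lambda>n. m (n + k) (S k)) \<longlonglongrightarrow> 0" by simp
  qed
  have small_outside: "(\<lambda>k. m n (D - S k)) \<longlonglongrightarrow> 0" for n
  proof -
    have "(\<lambda>k. m n (D - S k)) \<longlonglongrightarrow> (LINT x|leb_on D. 0)"
      unfolding m_def
    proof (rule integral_dominated_convergence[where w="\<lambda>x. indicator D x * p n x"])
      show "integrable (leb_on D) (\<lambda>x. indicator D x * p n x)" by (rule int_p[OF top])
      show "AE x in leb_on D. (\<lambda>k. indicator (D - S k) x * p n x) \<longlonglongrightarrow> 0"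
        using H0
      proof eventually_elim
        case (elim x)
        then have "(\<lambda>n. \<bar>H n x\<bar>) \<longlonglongrightarrow> 0" by (rule tendsto_rabs_zero)
        then have "\<forall>\<^sub>F n in sequentially. \<bar>H n x\<bar> < 1" by (rule order_tendstoD) simp
        then obtain k0 where "\<And>n. n \<ge> k0 \<Longrightarrow> \<bar>H n x\<bar> < 1" by (auto simp: eventually_sequentially)
        then have "indicator (D - S k) x * p n x = 0" if "k0 \<le> k" for k
          using that by (auto simp: S_def indicator_def intro: less_imp_le)
        then have "\<forall>\<^sub>F k in sequentially. indicator (D - S k) x * p n x = 0"
          unfolding eventually_sequentially by blast
        then show ?case by (rule tendsto_eventually)
      qed
    qed (auto simp: p_def indicator_def)
    then show ?thesis by simp
  qed
  \<comment> \<open>The pairs are (level, index). Each step first raises the level until the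
    previous index has little mass outside \<open>S\<close>, then raises the index until the new one
    has little mass inside.\<close>
  have "\<exists>f. \<forall>j. (j \<le> snd (f j) \<and> m (snd (f j)) (S (fst (f j))) \<le> (1/2)^j) \<and>
      (fst (f j) \<le> fst (f (Suc j)) \<and> m (snd (f j)) (D - S (fst (f (Suc j)))) \<le> (1/2)^j)"
  proof (rule dependent_nat_choice)
    have ex: "\<exists>n. j \<le> n \<and> m n (S k) \<le> (1/2)^j" for j k
    proof -
      have "\<forall>\<^sub>F n in sequentially. m n (S k) < (1/2)^j"
        by (rule order_tendstoD(2)[OF small_inside]) simp
      from eventually_happens[OF eventually_conj[OF this eventually_ge_at_top[of j]]]
      show ?thesis by (auto intro: less_imp_le)
    qed
    from ex[of 0 0] show "\<exists>kn. 0 \<le> snd kn \<and> m (snd kn) (S (fst kn)) \<le> (1/2)^0" by auto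
    fix kn :: "nat \<times> nat" and j
    have "\<forall>\<^sub>F k in sequentially. m (snd kn) (D - S k) < (1/2)^j"
      by (rule order_tendstoD(2)[OF small_outside]) simp
    from eventually_happens[OF eventually_conj[OF this eventually_ge_at_top[of "fst kn"]]]
    obtain k where "m (snd kn) (D - S k) < (1/2)^j" "fst kn \<le> k" by auto
    moreover obtain n where "Suc j \<le> n" "m n (S k) \<le> (1/2)^Suc j" using ex[of "Suc j" k] by blast
    ultimately show "\<exists>y. (Suc j \<le> snd y \<and> m (snd y) (S (fst y)) \<le> (1/2)^Suc j) \<and>
        (fst kn \<le> fst y \<and> m (snd kn) (D - S (fst y)) \<le> (1/2)^j)"
      by (intro exI[of _ "(k, n)"]) auto
  qed
  then obtain F where F: "\<And>j. (j \<le> snd (F j) \<and> m (snd (F j)) (S (fst (F j))) \<le> (1/2)^j) \<and>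
      (fst (F j) \<le> fst (F (Suc j)) \<and> m (snd (F j)) (D - S (fst (F (Suc j)))) \<le> (1/2)^j)"
    by blast
  define K where "K j = fst (F j)" for j
  define N where "N j = snd (F j)" for j
  have KN: "\<And>j. j \<le> N j" "\<And>j. m (N j) (S (K j)) \<le> (1/2)^j"
      "\<And>j. K j \<le> K (Suc j)" "\<And>j. m (N j) (D - S (K (Suc j))) \<le> (1/2)^j"
    using F unfolding K_def N_def by blast+
  have K_mono: "K i \<le> K j" if "i \<le> j" for i j using KN(3) that by (rule lift_Suc_mono_le)
  \<comment> \<open>The shell between consecutive levels carries all but 2 * 2^(-j) of the mass of
    index \<open>N j\<close>; monotonicity of \<open>S\<close> makes the shells disjoint.\<close>
  define E where "E j = S (K (Suc j)) - S (K j)" for j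
  have E [measurable]: "E j \<in> sets (leb_on D)" for j by (simp add: E_def sets.Diff S)
  have E_disj: "E i \<inter> E j = {}" if "i < j" for i j
    using S_mono[OF K_mono[of "Suc i" j]] that by (auto simp: E_def)
  have small: "m (N j) (D - E j) \<le> 2 * (1/2)^j" for j
  proof -
    have "m (N j) (D - E j) \<le> m (N j) (S (K j) \<union> (D - S (K (Suc j))))"
      by (rule m_mono) (auto simp: E_def)
    also have "\<dots> \<le> m (N j) (S (K j)) + m (N j) (D - S (K (Suc j)))" by (rule m_Un) auto
    finally show ?thesis using KN(2,4)[of j] by simp
  qed
  define A where "A = (\<Union>j. E (2 * j))"
  have A [measurable]: "A \<in> sets (leb_on D)" unfolding A_def by measurable
  have AD: "A \<subseteq> D" using A by (simp add: sets_leb_on)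
  have even: "cmod (\<mu> (N (2 * j)) A - \<mu> (N (2 * j)) D) \<le> 2 * (1/2)^(2 * j)" for j
  proof -
    have "E (2 * j) \<subseteq> A" by (auto simp: A_def)
    then have "cmod (\<mu> (N (2 * j)) A - \<mu> (N (2 * j)) D) \<le> m (N (2 * j)) (D - E (2 * j))"
      using AD by (intro \<mu>_diff) auto
    then show ?thesis using small[of "2 * j"] by linarith
  qed
  have odd: "cmod (\<mu> (N (2 * j + 1)) A - \<mu> (N (2 * j + 1)) {}) \<le> 2 * (1/2)^(2 * j + 1)" for j
  proof -
    have "E (2 * i) \<inter> E (2 * j + 1) = {}" for i
    proof (cases "2 * i < 2 * j + 1")
      case True
      then show ?thesis by (rule E_disj)
    next
      case False
      then have "2 * j + 1 < 2 * i" by presburger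
      then show ?thesis using E_disj[of "2 * j + 1" "2 * i"] by blast
    qed
    then have "A \<inter> E (2 * j + 1) = {}" by (auto simp: A_def)
    then have "cmod (\<mu> (N (2 * j + 1)) A - \<mu> (N (2 * j + 1)) {}) \<le> m (N (2 * j + 1)) (D - E (2 * j + 1))"
      using AD by (intro \<mu>_diff) auto
    then show ?thesis using small[of "2 * j + 1"] by linarith
  qed
  have char: "(CLINT \<omega>|M. iexp (u * SI (H n) B \<omega>)) = exp (\<mu> n B)" if "B \<in> sets (leb_on D)" for n B
    unfolding \<mu>_def by (rule SI_char[OF H that])
  have Re: "Re (\<mu> n B) \<le> 0" if "B \<in> sets (leb_on D)" for n B
    unfolding \<mu>_def by (rule Re_exponent_integral_nonpos[OF H that])
  have N_lim: "filterlim N at_top sequentially"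
    by (rule filterlim_at_top_mono[OF filterlim_ident]) (use KN(1) in auto)
  have N_even: "filterlim (\<lambda>j. N (2 * j)) at_top sequentially"
    by (rule filterlim_compose[OF N_lim]) (rule filterlim_subseq, simp add: strict_mono_def)
  have N_odd: "filterlim (\<lambda>j. N (2 * j + 1)) at_top sequentially"
    by (rule filterlim_compose[OF N_lim]) (rule filterlim_subseq, simp add: strict_mono_def)
  obtain Y' where "conv_in_prob M (\<lambda>n. SI (H n) A) Y'" using conv[OF A] by blast
  from conv_in_prob_char[OF this, of u]
  obtain L where L: "(\<lambda>n. exp (\<mu> n A)) \<longlonglongrightarrow> L" unfolding char[OF A] by blast
  have LD: "(\<lambda>n. exp (\<mu> n D)) \<longlonglongrightarrow> (CLINT \<omega>|M. iexp (u * Y \<omega>))"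
    using conv_in_prob_char[OF Y, of u] by (simp only: char[OF top])
  have pow: "(\<lambda>j. 2 * (1/2::real)^(2 * j)) \<longlonglongrightarrow> 0" "(\<lambda>j. 2 * (1/2::real)^(2 * j + 1)) \<longlonglongrightarrow> 0"
    by real_asymp+
  \<comment> \<open>Along the odd indices \<open>A\<close> misses the shell carrying the mass, so
    the limit \<open>L\<close> is 1. Along the even ones \<open>A\<close> contains it, so
    \<open>L\<close> is also the characteristic function of \<open>Y\<close>.\<close>
  have "(\<lambda>j. exp (\<mu> (N (2 * j + 1)) A) - 1) \<longlonglongrightarrow> 0"
  proof (rule Lim_null_comparison[OF _ pow(2)], rule always_eventually, rule allI)
    fix j
    have "\<mu> (N (2 * j + 1)) {} = 0" by (simp add: \<mu>_def)
    then show "cmod (exp (\<mu> (N (2 * j + 1)) A) - 1) \<le> 2 * (1/2)^(2 * j + 1)"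
      using odd[of j] norm_exp_diff_le[OF Re[OF A], of 0 "N (2 * j + 1)"] by simp
  qed
  then have "(\<lambda>j. exp (\<mu> (N (2 * j + 1)) A)) \<longlonglongrightarrow> 1" by (simp add: LIM_zero_iff)
  with filterlim_compose[OF L N_odd] have "L = 1" by (rule LIMSEQ_unique)
  have "(\<lambda>j. exp (\<mu> (N (2 * j)) A) - exp (\<mu> (N (2 * j)) D)) \<longlonglongrightarrow> 0"
  proof (rule Lim_null_comparison[OF _ pow(1)], rule always_eventually, rule allI)
    fix j
    show "cmod (exp (\<mu> (N (2 * j)) A) - exp (\<mu> (N (2 * j)) D)) \<le> 2 * (1/2)^(2 * j)"
      using even[of j] norm_exp_diff_le[OF Re[OF A] Re[OF top], of "N (2 * j)" "N (2 * j)"] by linarith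
  qed
  moreover have "(\<lambda>j. exp (\<mu> (N (2 * j)) A) - exp (\<mu> (N (2 * j)) D)) \<longlonglongrightarrow> L - (CLINT \<omega>|M. iexp (u * Y \<omega>))"
    using filterlim_compose[OF L N_even] filterlim_compose[OF LD N_even] by (rule tendsto_diff)
  ultimately have "0 = L - (CLINT \<omega>|M. iexp (u * Y \<omega>))" by (rule LIMSEQ_unique)
  with \<open>L = 1\<close> show "(CLINT \<omega>|M. iexp (u * Y \<omega>)) = 1" by simp
qed

end

section \<open>The stochastic integral of square integrable functions\<close>

context levy_white_noise
begin

abbreviation "NI \<equiv> noise_integral M D \<xi>"

lemma top_leb: "D \<in> sets (leb_on D)"
  using D_borel by (simp add: sets_leb_on)

lemma SI_null:
  assumes H: "\<And>n. simple_function (leb_on D) (H n)" and lim: "(\<lambda>n. sqn (H n)) \<longlonglongrightarrow> 0"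
    and A: "A \<in> sets (leb_on D)"
  shows "(\<lambda>n. prob_dist M (SI (H n) A) (\<lambda>_. 0)) \<longlonglongrightarrow> 0"
proof (rule order_tendstoI)
  fix a :: real assume "a < 0"
  then show "\<forall>\<^sub>F n in sequentially. a < prob_dist M (SI (H n) A) (\<lambda>_. 0)"
    by (intro always_eventually allI) (rule less_le_trans[OF _ prob_dist_nonneg])
next
  fix a :: real assume "0 < a"
  then have "0 < a / 2" by simp
  then obtain \<delta> where \<delta>: "0 < \<delta>"
    "\<And>h A. simple_function (leb_on D) h \<Longrightarrow> A \<in> sets (leb_on D) \<Longrightarrow> sqn h \<le> \<delta> \<Longrightarrow>
      prob_dist M (SI h A) (\<lambda>_. 0) \<le> a / 2"
    using SI_small by blast
  have "\<forall>\<^sub>F n in sequentially. sqn (H n) < \<delta>" by (rule order_tendstoD(2)[OF lim \<delta>(1)])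
  then show "\<forall>\<^sub>F n in sequentially. prob_dist M (SI (H n) A) (\<lambda>_. 0) < a"
  proof eventually_elim
    case (elim n)
    have "prob_dist M (SI (H n) A) (\<lambda>_. 0) \<le> a / 2"
      by (rule \<delta>(2)[OF H A]) (use elim in simp)
    also have "a / 2 < a" using \<open>0 < a\<close> by simp
    finally show ?case .
  qed
qed

text \<open>The threshold of \<open>SI_small\<close> does not depend on \<open>A\<close>. Hence one
  subsequence, fast enough in L2, makes the integrals over each \<open>A\<close> converge almost
  surely, as \<open>noise_approx\<close> demands of a single sequence.\<close>

lemma L2_noise_approx:
  assumes f: "L2_fun D f"
  obtains F where "noise_approx M D \<xi> f F" "(\<lambda>n. sqn (\<lambda>x. F n x - f x)) \<longlonglongrightarrow> 0"
proof -
  have "\<forall>j::nat. \<exists>\<delta>. 0 < \<delta> \<and> (\<forall>h A. simple_function (leb_on D) h \<longrightarrow> A \<in> sets (leb_on D) \<longrightarrow>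
      sqn h \<le> \<delta> \<longrightarrow> prob_dist M (SI h A) (\<lambda>_. 0) \<le> (1/2)^j)"
  proof
    fix j :: nat
    have pos: "0 < (1/2::real)^j" by simp
    obtain \<delta> where "0 < \<delta>" "\<And>h A. simple_function (leb_on D) h \<Longrightarrow> A \<in> sets (leb_on D) \<Longrightarrow> sqn h \<le> \<delta> \<Longrightarrow>
        prob_dist M (SI h A) (\<lambda>_. 0) \<le> (1/2)^j"
      using SI_small[OF pos] by blast
    then show "\<exists>\<delta>. 0 < \<delta> \<and> (\<forall>h A. simple_function (leb_on D) h \<longrightarrow> A \<in> sets (leb_on D) \<longrightarrow>
      sqn h \<le> \<delta> \<longrightarrow> prob_dist M (SI h A) (\<lambda>_. 0) \<le> (1/2)^j)"
      by blast
  qed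
  from choice[OF this] obtain \<delta> :: "nat \<Rightarrow> real" where \<delta>: "\<And>j. 0 < \<delta> j"
    "\<And>j h A. simple_function (leb_on D) h \<Longrightarrow> A \<in> sets (leb_on D) \<Longrightarrow> sqn h \<le> \<delta> j \<Longrightarrow>
      prob_dist M (SI h A) (\<lambda>_. 0) \<le> (1/2)^j"
    by blast
  \<comment> \<open>A running minimum, so that the approximants at \<open>j\<close> and
    \<open>Suc j\<close> both lie within \<open>d j / 4\<close>; the factors 2 in
    \<open>sqn_diff_le\<close> then add up to \<open>d j\<close>.\<close>
  define d where "d j = Min (\<delta> ` {..j})" for j :: nat
  have d_pos: "0 < d j" for j unfolding d_def using \<delta>(1) by (subst Min_gr_iff) auto
  have d_le: "d j \<le> \<delta> j" for j unfolding d_def by (intro Min_le) auto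
  have d_anti: "d (Suc j) \<le> d j" for j unfolding d_def by (intro Min_antimono) auto
  obtain F where F: "\<And>n. simple_function (leb_on D) (F n)"
    "\<And>x. x \<in> D \<Longrightarrow> (\<lambda>n. F n x) \<longlonglongrightarrow> f x" "(\<lambda>n. sqn (\<lambda>x. F n x - f x)) \<longlonglongrightarrow> 0"
    using L2_simple_approx[OF f] by blast
  have "\<exists>n\<ge>j. sqn (\<lambda>x. F n x - f x) \<le> d j / 4" for j
  proof -
    have "\<forall>\<^sub>F n in sequentially. sqn (\<lambda>x. F n x - f x) < d j / 4"
      by (rule order_tendstoD(2)[OF F(3)]) (use d_pos[of j] in simp)
    from eventually_happens[OF eventually_conj[OF this eventually_ge_at_top[of j]]]
    show ?thesis by (auto intro: less_imp_le)
  qed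
  then obtain r where r: "\<And>j. j \<le> r j" "\<And>j. sqn (\<lambda>x. F (r j) x - f x) \<le> d j / 4" by metis
  have r_lim: "filterlim r at_top sequentially"
    by (rule filterlim_at_top_mono[OF filterlim_ident]) (use r(1) in auto)
  have L2: "L2_fun D (F n)" for n using F(1) by (rule L2_fun_simple)
  have "noise_approx M D \<xi> f (\<lambda>j. F (r j))"
    unfolding noise_approx_def
  proof (intro conjI allI ballI)
    show "simple_function (leb_on D) (F (r j))" for j by (rule F)
    show "AE x in leb_on D. (\<lambda>j. F (r j) x) \<longlonglongrightarrow> f x"
    proof (intro AE_I2)
      fix x assume "x \<in> space (leb_on D)"
      then have "x \<in> D" by (simp add: space_leb_on)
      from filterlim_compose[OF F(2)[OF this] r_lim] show "(\<lambda>j. F (r j) x) \<longlonglongrightarrow> f x" .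
    qed
    fix A assume A: "A \<in> sets (leb_on D)"
    note meas = measurable_SI[OF F(1) A]
    have "prob_dist M (SI (F (r (Suc j))) A) (SI (F (r j)) A) \<le> (1/2)^j" for j
    proof -
      have "sqn (\<lambda>x. F (r (Suc j)) x - F (r j) x)
          \<le> 2 * sqn (\<lambda>x. F (r (Suc j)) x - f x) + 2 * sqn (\<lambda>x. F (r j) x - f x)"
        by (intro sqn_diff_le L2 f)
      also have "\<dots> \<le> \<delta> j"
        using r(2)[of j] r(2)[of "Suc j"] d_anti[of j] d_le[of j] by linarith
      finally have "prob_dist M (SI (\<lambda>x. F (r (Suc j)) x - F (r j) x) A) (\<lambda>_. 0) \<le> (1/2)^j"
        by (rule \<delta>(2)[OF simple_function_diff[OF F(1) F(1)] A])
      then show ?thesis by (simp add: SI_prob_dist_diff[OF F(1) F(1) A])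
    qed
    then have "AE \<omega> in M. convergent (\<lambda>j. SI (F (r j)) A \<omega>)"
      by (rule AE_convergent_of_summable_prob_dist[OF meas]) (simp add: summable_geometric)
    then have "AE \<omega> in M. (\<lambda>j. SI (F (r j)) A \<omega>) \<longlonglongrightarrow> lim (\<lambda>j. SI (F (r j)) A \<omega>)"
      by eventually_elim (simp add: convergent_LIMSEQ_iff)
    then have "conv_in_prob M (\<lambda>j. SI (F (r j)) A) (\<lambda>\<omega>. lim (\<lambda>j. SI (F (r j)) A \<omega>))"
      by (intro conv_in_prob_of_AE meas borel_measurable_lim_metric) auto
    then show "\<exists>Y. conv_in_prob M (\<lambda>j. SI (F (r j)) A) Y" by blast
  qed
  moreover from filterlim_compose[OF F(3) r_lim] have "(\<lambda>j. sqn (\<lambda>x. F (r j) x - f x)) \<longlonglongrightarrow> 0" .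
  ultimately show ?thesis by (rule that)
qed

lemma noise_integrable_L2:
  assumes "L2_fun D f" shows "noise_integrable M D \<xi> f"
  using L2_noise_approx[OF assms] L2_fun_borel[OF assms] unfolding noise_integrable_def by blast

text \<open>The sequence \<open>F'\<close> behind the choice in \<open>NI\<close> need not converge
  in L2. \<open>SI_limit_zero\<close>, applied to its difference from an L2 approximation
  \<open>F\<close>, shows that both have the same limit; \<open>H\<close> is then compared with
  \<open>F\<close> in L2.\<close>

lemma noise_integral_conv:
  assumes f: "L2_fun D f" and H: "\<And>n. simple_function (leb_on D) (H n)"
    and lim: "(\<lambda>n. sqn (\<lambda>x. H n x - f x)) \<longlonglongrightarrow> 0"
  shows "conv_in_prob M (\<lambda>n. SI (H n) D) (NI f)"
proof -
  obtain F where F: "noise_approx M D \<xi> f F" and F_lim: "(\<lambda>n. sqn (\<lambda>x. F n x - f x)) \<longlonglongrightarrow> 0"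
    by (rule L2_noise_approx[OF f])
  from F obtain Z where Z: "conv_in_prob M (\<lambda>n. SI (F n) D) Z"
    using top_leb unfolding noise_approx_def by blast
  have "\<exists>Y F. noise_approx M D \<xi> f F \<and> conv_in_prob M (\<lambda>n. SI (F n) D) Y"
    using F Z by blast
  from someI_ex[OF this]
  have "\<exists>F'. noise_approx M D \<xi> f F' \<and> conv_in_prob M (\<lambda>n. SI (F' n) D) (NI f)"
    unfolding noise_integral_def .
  then obtain F' where F': "noise_approx M D \<xi> f F'" and Y: "conv_in_prob M (\<lambda>n. SI (F' n) D) (NI f)"
    by blast
  have sF: "\<And>n. simple_function (leb_on D) (F n)" "\<And>n. simple_function (leb_on D) (F' n)"
    using F F' unfolding noise_approx_def by blast+
  have diff: "conv_in_prob M (\<lambda>n. SI (\<lambda>x. P n x - Q n x) A) (\<lambda>\<omega>. X \<omega> + (-1) * X' \<omega>)"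
    if P: "\<And>n. simple_function (leb_on D) (P n)" and Q: "\<And>n. simple_function (leb_on D) (Q n)"
      and A: "A \<in> sets (leb_on D)" and "conv_in_prob M (\<lambda>n. SI (P n) A) X" "conv_in_prob M (\<lambda>n. SI (Q n) A) X'"
    for P Q A X X'
  proof (rule conv_in_prob_cong_AE)
    show *: "conv_in_prob M (\<lambda>n \<omega>. SI (P n) A \<omega> + (-1) * SI (Q n) A \<omega>) (\<lambda>\<omega>. X \<omega> + (-1) * X' \<omega>)"
      by (rule conv_in_prob_linear) fact+
    show "(\<lambda>\<omega>. X \<omega> + (-1) * X' \<omega>) \<in> borel_measurable M" using * by (simp only: conv_in_prob_iff)
    show "SI (\<lambda>x. P n x - Q n x) A \<in> borel_measurable M" for n
      by (intro measurable_SI simple_function_diff P Q A)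
    show "AE \<omega> in M. SI (P n) A \<omega> + (-1) * SI (Q n) A \<omega> = SI (\<lambda>x. P n x - Q n x) A \<omega>" for n
      using SI_linear[OF P Q A, of n "-1" n] by eventually_elim simp
  qed simp
  have "AE \<omega> in M. NI f \<omega> + (-1) * Z \<omega> = 0"
  proof (rule SI_limit_zero[of "\<lambda>n x. F' n x - F n x"])
    show "simple_function (leb_on D) (\<lambda>x. F' n x - F n x)" for n by (intro simple_function_diff sF)
    show "AE x in leb_on D. (\<lambda>n. F' n x - F n x) \<longlonglongrightarrow> 0"
    proof -
      have "AE x in leb_on D. (\<lambda>n. F' n x) \<longlonglongrightarrow> f x" "AE x in leb_on D. (\<lambda>n. F n x) \<longlonglongrightarrow> f x"
        using F F' unfolding noise_approx_def by blast+
      then show ?thesis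
      proof eventually_elim
        case (elim x)
        from tendsto_diff[OF this] show ?case by simp
      qed
    qed
    show "\<exists>Y. conv_in_prob M (\<lambda>n. SI (\<lambda>x. F' n x - F n x) A) Y" if A: "A \<in> sets (leb_on D)" for A
    proof -
      obtain X X' where "conv_in_prob M (\<lambda>n. SI (F' n) A) X" "conv_in_prob M (\<lambda>n. SI (F n) A) X'"
        using F F' A unfolding noise_approx_def by blast
      from diff[OF sF(2) sF(1) A this] show ?thesis by blast
    qed
    show "conv_in_prob M (\<lambda>n. SI (\<lambda>x. F' n x - F n x) D) (\<lambda>\<omega>. NI f \<omega> + (-1) * Z \<omega>)"
      by (rule diff[OF sF(2) sF(1) top_leb Y Z])
  qed
  then have eq: "AE \<omega> in M. Z \<omega> = NI f \<omega>" by eventually_elim simp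
  have L2: "L2_fun D (H n)" "L2_fun D (F n)" for n using H sF by (auto intro: L2_fun_simple)
  have "(\<lambda>n. sqn (\<lambda>x. H n x - F n x)) \<longlonglongrightarrow> 0"
  proof (rule Lim_null_comparison[OF always_eventually], rule allI)
    show "norm (sqn (\<lambda>x. H n x - F n x)) \<le> 2 * sqn (\<lambda>x. H n x - f x) + 2 * sqn (\<lambda>x. F n x - f x)" for n
      using sqn_diff_le[OF L2 f, of n n] sqn_nonneg by simp
    show "(\<lambda>n. 2 * sqn (\<lambda>x. H n x - f x) + 2 * sqn (\<lambda>x. F n x - f x)) \<longlonglongrightarrow> 0"
      by (intro tendsto_add_zero tendsto_mult_right_zero lim F_lim)
  qed
  then have null: "(\<lambda>n. prob_dist M (SI (\<lambda>x. H n x - F n x) D) (\<lambda>_. 0)) \<longlonglongrightarrow> 0"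
    by (intro SI_null simple_function_diff H sF top_leb)
  have meas: "SI (H n) D \<in> borel_measurable M" "SI (F n) D \<in> borel_measurable M" for n
    by (intro measurable_SI H sF top_leb)+
  have Zm: "Z \<in> borel_measurable M" "NI f \<in> borel_measurable M" using Z Y by (auto simp: conv_in_prob_iff)
  have "(\<lambda>n. prob_dist M (SI (H n) D) Z) \<longlonglongrightarrow> 0"
  proof (rule Lim_null_comparison[OF always_eventually], rule allI)
    show "norm (prob_dist M (SI (H n) D) Z)
        \<le> prob_dist M (SI (\<lambda>x. H n x - F n x) D) (\<lambda>_. 0) + prob_dist M (SI (F n) D) Z" for n
      using prob_dist_triangle[OF meas Zm(1), of n n] prob_dist_nonneg
      by (simp add: SI_prob_dist_diff[OF H sF(1) top_leb])
    show "(\<lambda>n. prob_dist M (SI (\<lambda>x. H n x - F n x) D) (\<lambda>_. 0) + prob_dist M (SI (F n) D) Z) \<longlonglongrightarrow> 0"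
      by (intro tendsto_add_zero null) (use Z in \<open>simp add: conv_in_prob_iff\<close>)
  qed
  then have "conv_in_prob M (\<lambda>n. SI (H n) D) Z" using meas Zm by (simp add: conv_in_prob_iff)
  then show ?thesis by (rule conv_in_prob_cong_AE) (use meas Zm eq in auto)
qed

lemma noise_integral_approx:
  assumes f: "L2_fun D f"
  obtains H where "\<And>n. simple_function (leb_on D) (H n)"
    "(\<lambda>n. sqn (\<lambda>x. H n x - f x)) \<longlonglongrightarrow> 0" "conv_in_prob M (\<lambda>n. SI (H n) D) (NI f)"
proof -
  obtain H where H: "\<And>n. simple_function (leb_on D) (H n)"
    "\<And>x. x \<in> D \<Longrightarrow> (\<lambda>n. H n x) \<longlonglongrightarrow> f x" "(\<lambda>n. sqn (\<lambda>x. H n x - f x)) \<longlonglongrightarrow> 0"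
    using L2_simple_approx[OF f] by blast
  show ?thesis by (rule that[OF H(1,3) noise_integral_conv[OF f H(1,3)]])
qed

lemma measurable_noise_integral: "L2_fun D f \<Longrightarrow> NI f \<in> borel_measurable M"
  by (rule noise_integral_approx) (auto simp: conv_in_prob_iff)

lemma noise_integral_linear:
  assumes f: "L2_fun D f" and g: "L2_fun D g"
  shows "AE \<omega> in M. NI (\<lambda>x. f x + c * g x) \<omega> = NI f \<omega> + c * NI g \<omega>"
proof -
  obtain F where F: "\<And>n. simple_function (leb_on D) (F n)"
    "(\<lambda>n. sqn (\<lambda>x. F n x - f x)) \<longlonglongrightarrow> 0" "conv_in_prob M (\<lambda>n. SI (F n) D) (NI f)"
    using noise_integral_approx[OF f] by blast
  obtain G where G: "\<And>n. simple_function (leb_on D) (G n)"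
    "(\<lambda>n. sqn (\<lambda>x. G n x - g x)) \<longlonglongrightarrow> 0" "conv_in_prob M (\<lambda>n. SI (G n) D) (NI g)"
    using noise_integral_approx[OF g] by blast
  have simple: "simple_function (leb_on D) (\<lambda>x. F n x + c * G n x)" for n
    by (intro simple_function_add simple_function_mult simple_function_const F G)
  have L2: "L2_fun D (F n)" "L2_fun D (G n)" for n using F G by (auto intro: L2_fun_simple)
  have "(\<lambda>n. sqn (\<lambda>x. (F n x + c * G n x) - (f x + c * g x))) \<longlonglongrightarrow> 0"
  proof (rule Lim_null_comparison[OF always_eventually], rule allI)
    fix n
    have "sqn (\<lambda>x. (F n x - f x) + c * (G n x - g x))
        \<le> 2 * sqn (\<lambda>x. F n x - f x) + 2 * sqn (\<lambda>x. c * (G n x - g x))"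
      by (intro sqn_add_le L2_fun_cmult L2_fun_diff L2 f g)
    then have le: "sqn (\<lambda>x. (F n x - f x) + c * (G n x - g x))
        \<le> 2 * sqn (\<lambda>x. F n x - f x) + 2 * c\<^sup>2 * sqn (\<lambda>x. G n x - g x)"
      by (simp add: power_mult_distrib mult.assoc)
    have eq: "(F n x + c * G n x) - (f x + c * g x) = (F n x - f x) + c * (G n x - g x)" for x
      by (simp add: algebra_simps)
    show "norm (sqn (\<lambda>x. (F n x + c * G n x) - (f x + c * g x)))
        \<le> 2 * sqn (\<lambda>x. F n x - f x) + 2 * c\<^sup>2 * sqn (\<lambda>x. G n x - g x)"
      unfolding eq real_norm_def abs_of_nonneg[OF sqn_nonneg] by (rule le)
    show "(\<lambda>n. 2 * sqn (\<lambda>x. F n x - f x) + 2 * c\<^sup>2 * sqn (\<lambda>x. G n x - g x)) \<longlonglongrightarrow> 0"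
      by (intro tendsto_add_zero tendsto_mult_right_zero F G)
  qed
  then have 1: "conv_in_prob M (\<lambda>n. SI (\<lambda>x. F n x + c * G n x) D) (NI (\<lambda>x. f x + c * g x))"
    by (intro noise_integral_conv L2_fun_linear f g simple)
  have 2: "conv_in_prob M (\<lambda>n \<omega>. SI (F n) D \<omega> + c * SI (G n) D \<omega>) (\<lambda>\<omega>. NI f \<omega> + c * NI g \<omega>)"
    by (intro conv_in_prob_linear F G)
  have "conv_in_prob M (\<lambda>n. SI (\<lambda>x. F n x + c * G n x) D) (\<lambda>\<omega>. NI f \<omega> + c * NI g \<omega>)"
  proof (rule conv_in_prob_cong_AE[OF 2])
    show "SI (\<lambda>x. F n x + c * G n x) D \<in> borel_measurable M" for n by (intro measurable_SI simple top_leb)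
    show "(\<lambda>\<omega>. NI f \<omega> + c * NI g \<omega>) \<in> borel_measurable M" using 2 by (simp only: conv_in_prob_iff)
    show "AE \<omega> in M. SI (F n) D \<omega> + c * SI (G n) D \<omega> = SI (\<lambda>x. F n x + c * G n x) D \<omega>" for n
      using SI_linear[OF F(1) G(1) top_leb, of n c n] by eventually_elim simp
  qed simp
  from conv_in_prob_unique[OF 1 this] show ?thesis .
qed

lemma noise_integral_char_bound:
  assumes C: "\<And>v. cmod (\<Psi> v) \<le> \<eta> + C * v\<^sup>2" and C0: "0 \<le> C" "0 \<le> \<eta>" and f: "L2_fun D f"
  shows "cmod (1 - (CLINT \<omega>|M. iexp (g * NI f \<omega>))) \<le> \<eta> * vol + C * sqn f * g\<^sup>2"
proof -
  obtain F where F: "\<And>n. simple_function (leb_on D) (F n)"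
    "(\<lambda>n. sqn (\<lambda>x. F n x - f x)) \<longlonglongrightarrow> 0" "conv_in_prob M (\<lambda>n. SI (F n) D) (NI f)"
    using noise_integral_approx[OF f] by blast
  have L2: "L2_fun D (F n)" for n using F by (auto intro: L2_fun_simple)
  have inner: "(\<lambda>n. L2_inner D (F n) f) \<longlonglongrightarrow> L2_inner D f f"
    by (rule L2_inner_tendsto[OF L2 f f F(2)])
  have "sqn (F n) = sqn (\<lambda>x. F n x - f x) + 2 * L2_inner D (F n) f - sqn f" for n
    using sqn_linear[OF L2 f, of n "-1"] by simp
  moreover have "(\<lambda>n. sqn (\<lambda>x. F n x - f x) + 2 * L2_inner D (F n) f - sqn f)
      \<longlonglongrightarrow> 0 + 2 * L2_inner D f f - sqn f"
    by (intro tendsto_intros F inner)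
  ultimately have sq: "(\<lambda>n. sqn (F n)) \<longlonglongrightarrow> sqn f"
    by (simp add: L2_inner_def power2_eq_square)
  show ?thesis
  proof (rule LIMSEQ_le)
    show "(\<lambda>n. cmod (1 - (CLINT \<omega>|M. iexp (g * SI (F n) D \<omega>))))
        \<longlonglongrightarrow> cmod (1 - (CLINT \<omega>|M. iexp (g * NI f \<omega>)))"
      by (intro tendsto_norm tendsto_diff tendsto_const conv_in_prob_char F)
    show "(\<lambda>n. \<eta> * vol + C * sqn (F n) * g\<^sup>2) \<longlonglongrightarrow> \<eta> * vol + C * sqn f * g\<^sup>2"
      by (intro tendsto_intros sq)
    show "\<exists>N. \<forall>n\<ge>N. cmod (1 - (CLINT \<omega>|M. iexp (g * SI (F n) D \<omega>))) \<le> \<eta> * vol + C * sqn (F n) * g\<^sup>2"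
      using SI_char_bound[OF C C0 F(1) top_leb] by blast
  qed
qed

lemma noise_integral_small:
  assumes "0 < \<epsilon>"
  obtains \<delta> where "0 < \<delta>"
    "\<And>f. L2_fun D f \<Longrightarrow> sqn f \<le> \<delta> \<Longrightarrow> prob_dist M (NI f) (\<lambda>_. 0) \<le> \<epsilon>"
proof (rule prob_dist_small_of_char[OF assms])
  fix \<delta> :: real
  assume "0 < \<delta>" and \<delta>: "\<And>X s. X \<in> borel_measurable M \<Longrightarrow> 0 \<le> s \<Longrightarrow> s \<le> \<delta> \<Longrightarrow>
      (\<And>\<eta> C g. (\<And>v. cmod (\<Psi> v) \<le> \<eta> + C * v\<^sup>2) \<Longrightarrow> 0 \<le> C \<Longrightarrow> 0 \<le> \<eta> \<Longrightarrow>
        cmod (1 - (CLINT \<omega>|M. iexp (g * X \<omega>))) \<le> \<eta> * vol + C * s * g\<^sup>2) \<Longrightarrow>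
      prob_dist M X (\<lambda>_. 0) \<le> \<epsilon>"
  show thesis
  proof (rule that[OF \<open>0 < \<delta>\<close>])
    fix f assume f: "L2_fun D f" and le: "sqn f \<le> \<delta>"
    show "prob_dist M (NI f) (\<lambda>_. 0) \<le> \<epsilon>"
      by (rule \<delta>[OF measurable_noise_integral[OF f] sqn_nonneg le])
         (rule noise_integral_char_bound[OF _ _ _ f])
  qed
qed

lemma noise_integral_prob_dist_diff:
  assumes f: "L2_fun D f" and g: "L2_fun D g"
  shows "prob_dist M (NI f) (NI g) = prob_dist M (NI (\<lambda>x. f x - g x)) (\<lambda>_. 0)"
proof -
  have "AE \<omega> in M. NI (\<lambda>x. f x - g x) \<omega> = NI f \<omega> - NI g \<omega>"
    using noise_integral_linear[OF f g, of "-1"] by simp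
  then have "(LINT \<omega>|M. min 1 \<bar>NI f \<omega> - NI g \<omega>\<bar>) = (LINT \<omega>|M. min 1 \<bar>NI (\<lambda>x. f x - g x) \<omega>\<bar>)"
    using measurable_noise_integral[OF f] measurable_noise_integral[OF g]
      measurable_noise_integral[OF L2_fun_diff[OF f g]]
    by (intro integral_cong_AE) auto
  then show ?thesis by (simp add: prob_dist_def)
qed

lemma noise_integral_L2_tendsto:
  assumes g: "\<And>n. L2_fun D (g n)" and f: "L2_fun D f"
    and lim: "(\<lambda>n. sqn (\<lambda>x. g n x - f x)) \<longlonglongrightarrow> 0"
  shows "conv_in_prob M (\<lambda>n. NI (g n)) (NI f)"
proof -
  have "(\<lambda>n. prob_dist M (NI (g n)) (NI f)) \<longlonglongrightarrow> 0"
  proof (rule order_tendstoI)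
    fix a :: real assume "a < 0"
    then show "\<forall>\<^sub>F n in sequentially. a < prob_dist M (NI (g n)) (NI f)"
      by (intro always_eventually allI) (rule less_le_trans[OF _ prob_dist_nonneg])
  next
    fix a :: real assume "0 < a"
    then have "0 < a / 2" by simp
    then obtain \<delta> where \<delta>: "0 < \<delta>"
      "\<And>f. L2_fun D f \<Longrightarrow> sqn f \<le> \<delta> \<Longrightarrow> prob_dist M (NI f) (\<lambda>_. 0) \<le> a / 2"
      using noise_integral_small by blast
    have "\<forall>\<^sub>F n in sequentially. sqn (\<lambda>x. g n x - f x) < \<delta>" by (rule order_tendstoD(2)[OF lim \<delta>(1)])
    then show "\<forall>\<^sub>F n in sequentially. prob_dist M (NI (g n)) (NI f) < a"
    proof eventually_elim
      case (elim n)
      have "prob_dist M (NI (g n)) (NI f) \<le> a / 2"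
        unfolding noise_integral_prob_dist_diff[OF g f]
        by (rule \<delta>(2)[OF L2_fun_diff[OF g f]]) (use elim in simp)
      also have "a / 2 < a" using \<open>0 < a\<close> by simp
    finally show ?case .
    qed
  qed
  then show ?thesis using measurable_noise_integral f g by (simp add: conv_in_prob_iff)
qed

lemma noise_integral_zero: "AE \<omega> in M. NI (\<lambda>_. 0) \<omega> = 0"
  using noise_integral_linear[OF L2_fun_zero L2_fun_zero, of 1] by simp

lemma noise_integral_sum:
  assumes "finite I" "\<And>i. i \<in> I \<Longrightarrow> L2_fun D (f i)"
  shows "AE \<omega> in M. NI (\<lambda>x. \<Sum>i\<in>I. c i * f i x) \<omega> = (\<Sum>i\<in>I. c i * NI (f i) \<omega>)"
  using assms
proof (induction I)
  case empty
  then show ?case using noise_integral_zero by simp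
next
  case (insert i I)
  have "AE \<omega> in M. NI (\<lambda>x. (\<Sum>i\<in>I. c i * f i x) + c i * f i x) \<omega>
      = NI (\<lambda>x. \<Sum>i\<in>I. c i * f i x) \<omega> + c i * NI (f i) \<omega>"
    using insert.prems by (intro noise_integral_linear L2_fun_sum) auto
  moreover have "AE \<omega> in M. NI (\<lambda>x. \<Sum>i\<in>I. c i * f i x) \<omega> = (\<Sum>i\<in>I. c i * NI (f i) \<omega>)"
    using insert.prems by (intro insert.IH) auto
  ultimately show ?case
    by eventually_elim (use insert.hyps in \<open>simp add: add.commute\<close>)
qed

end

section \<open>A weighted mean value property\<close>

lemma lborel_integral_affine:
  fixes f :: "'a::euclidean_space \<Rightarrow> real"
  assumes [measurable]: "f \<in> borel_measurable borel" and c: "0 < c"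
  shows "(LINT y|lborel. f y) = c ^ DIM('a) * (LINT y|lborel. f (t + c *\<^sub>R y))"
proof -
  have "(LINT y|lborel. f y)
      = (LINT y|density (distr lborel borel (\<lambda>x. t + c *\<^sub>R x)) (\<lambda>_. \<bar>c\<bar> ^ DIM('a)). f y)"
    using lborel_affine[of c t] c by simp
  also have "\<dots> = (LINT y|distr lborel borel (\<lambda>x. t + c *\<^sub>R x). c ^ DIM('a) * f y)"
    using c by (subst integral_density) auto
  also have "\<dots> = (LINT y|lborel. c ^ DIM('a) * f (t + c *\<^sub>R y))"
    by (subst integral_distr) auto
  finally show ?thesis by simp
qed

lemma lborel_integrable_translate:
  fixes f :: "'a::euclidean_space \<Rightarrow> real"
  assumes "integrable lborel f"
  shows "integrable lborel (\<lambda>y. f (y + v))"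
proof -
  have eq: "lborel = distr lborel borel (\<lambda>y::'a. v + y)"
    using lborel_affine[of 1 v] by (simp add: density_1)
  have "integrable (distr lborel borel (\<lambda>y. v + y)) f" using assms eq by metis
  then show ?thesis by (subst (asm) integrable_distr_eq) (use assms in \<open>auto simp: add.commute\<close>)
qed

lemma integrable_indicator_cball:
  "integrable lborel (indicator (cball (c::'a::euclidean_space) R) :: 'a \<Rightarrow> real)"
  by (rule integrable_real_indicator[OF _ emeasure_lborel_cball_finite]) simp

text \<open>Translation invariance makes the difference quotients of \<open>G\<close> integrate to
  0. The mean value theorem bounds them by \<open>B\<close>, and dominated convergence passes to the
  derivative.\<close>

lemma integral_directional_derivative:
  fixes G G' :: "'a::euclidean_space \<Rightarrow> real"
  assumes deriv: "\<And>y. ((\<lambda>t. G (y + t *\<^sub>R v)) has_real_derivative G' y) (at 0)"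
    and int: "integrable lborel G" and bound: "\<And>y. \<bar>G' y\<bar> \<le> B"
    and supp: "\<And>y. R < norm y \<Longrightarrow> G y = 0" and v: "norm v \<le> 1"
  shows "(LINT y|lborel. G' y) = 0"
proof -
  define h where "h n = 1 / (real n + 1)" for n
  have h: "0 < h n" "h n \<le> 1" for n by (auto simp: h_def)
  have h_lim: "h \<longlonglongrightarrow> 0"
    unfolding h_def using LIMSEQ_inverse_real_of_nat by (simp add: inverse_eq_divide add.commute)
  define q where "q n y = (G (y + h n *\<^sub>R v) - G y) / h n" for n y
  have [measurable]: "G \<in> borel_measurable borel" using int by auto
  have [measurable]: "q n \<in> borel_measurable borel" for n unfolding q_def by measurable
  have q_lim: "(\<lambda>n. q n y) \<longlonglongrightarrow> G' y" for y
  proof -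
    have "(\<lambda>t. (G (y + (0 + t) *\<^sub>R v) - G (y + 0 *\<^sub>R v)) / t) \<midarrow>0\<rightarrow> G' y"
      using deriv[of y] by (rule DERIV_D)
    moreover have "filterlim h (at 0) sequentially"
      using h_lim h(1) by (intro filterlim_atI) (auto intro!: always_eventually simp: less_imp_neq[symmetric])
    ultimately have "(\<lambda>n. (G (y + (0 + h n) *\<^sub>R v) - G (y + 0 *\<^sub>R v)) / h n) \<longlonglongrightarrow> G' y"
      by (rule filterlim_compose)
    then show ?thesis by (simp add: q_def)
  qed
  have q_bound: "\<bar>q n y\<bar> \<le> B" for n y
  proof -
    have deriv': "((\<lambda>t. G (y + t *\<^sub>R v)) has_real_derivative G' (y + s *\<^sub>R v)) (at s)" for s
    proof -
      have "(\<lambda>t. G ((y + s *\<^sub>R v) + t *\<^sub>R v)) = (\<lambda>t. (\<lambda>t. G (y + t *\<^sub>R v)) (t + s))"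
        by (simp add: algebra_simps)
      with deriv[of "y + s *\<^sub>R v"]
      have "((\<lambda>t. (\<lambda>t. G (y + t *\<^sub>R v)) (t + s)) has_real_derivative G' (y + s *\<^sub>R v)) (at 0)" by simp
      then show ?thesis
        using DERIV_shift[of "\<lambda>t. G (y + t *\<^sub>R v)" "G' (y + s *\<^sub>R v)" 0 s] by simp
    qed
    obtain z where "G (y + h n *\<^sub>R v) - G (y + 0 *\<^sub>R v) = (h n - 0) * G' (y + z *\<^sub>R v)"
      using MVT2[of 0 "h n" "\<lambda>t. G (y + t *\<^sub>R v)" "\<lambda>s. G' (y + s *\<^sub>R v)"] h(1)[of n] deriv' by blast
    then have "q n y = G' (y + z *\<^sub>R v)" using h(1)[of n] by (simp add: q_def)
    then show ?thesis using bound by simp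
  qed
  \<comment> \<open>The radius grows by 1 because the shift \<open>h n *\<^sub>R v\<close> has norm
    at most 1.\<close>
  have q_supp: "q n y = 0" if "R + 1 < norm y" for n y
  proof -
    have "norm (h n *\<^sub>R v) \<le> 1 * 1"
      unfolding norm_scaleR using h[of n] v by (intro mult_mono) auto
    moreover have "norm y \<le> norm (y + h n *\<^sub>R v) + norm (h n *\<^sub>R v)"
      using norm_triangle_ineq4[of "y + h n *\<^sub>R v" "h n *\<^sub>R v"] by simp
    ultimately have "R < norm (y + h n *\<^sub>R v)" using that by linarith
    then show ?thesis using that by (simp add: q_def supp)
  qed
  have "0 \<le> B" using bound[of 0] by (rule order_trans[OF abs_ge_zero])
  have "(\<lambda>n. LINT y|lborel. q n y) \<longlonglongrightarrow> (LINT y|lborel. G' y)"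
  proof (rule integral_dominated_convergence[where w="\<lambda>y. B * indicator (cball 0 (R + 1)) y"])
    show "G' \<in> borel_measurable lborel"
      by (rule borel_measurable_LIMSEQ_real[where u=q]) (use q_lim in auto)
    show "integrable lborel (\<lambda>y. B * indicator (cball (0::'a) (R + 1)) y)"
      by (rule integrable_mult_right, rule integrable_indicator_cball)
    show "AE y in lborel. norm (q n y) \<le> B * indicator (cball 0 (R + 1)) y" for n
      using q_bound q_supp \<open>0 \<le> B\<close> by (auto simp: indicator_def not_le)
  qed (use q_lim in auto)
  moreover have "(LINT y|lborel. q n y) = 0" for n
  proof -
    have int': "integrable lborel (\<lambda>y. G (y + h n *\<^sub>R v))"
      by (rule lborel_integrable_translate[OF int])
    have "(LINT y|lborel. q n y) = ((LINT y|lborel. G (y + h n *\<^sub>R v)) - (LINT y|lborel. G y)) / h n"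
      unfolding q_def using int int' by simp
    also have "(LINT y|lborel. G (y + h n *\<^sub>R v)) = (LINT y|lborel. G y)"
      using lborel_integral_affine[of G 1 "h n *\<^sub>R v"] by (simp add: add.commute)
    finally show ?thesis by simp
  qed
  ultimately show ?thesis by (simp add: LIMSEQ_const_iff)
qed

text \<open>The weights satisfy \<open>\<nabla> bump_potential y = - bump y *\<^sub>R y\<close>.\<close>

definition bump :: "'a::euclidean_space \<Rightarrow> real" where
  "bump y = max 0 (1 - y \<bullet> y)"

definition bump_potential :: "'a::euclidean_space \<Rightarrow> real" where
  "bump_potential y = (max 0 (1 - y \<bullet> y))\<^sup>2 / 4"

lemma bump_bounds: "0 \<le> bump y" "bump y \<le> 1"
  by (auto simp: bump_def)

lemma bump_outside: "1 \<le> norm y \<Longrightarrow> bump y = 0" "1 \<le> norm y \<Longrightarrow> bump_potential y = 0"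
  using power_mono[of 1 "norm y" 2]
  by (auto simp: bump_def bump_potential_def power2_norm_eq_inner[symmetric])

lemma continuous_bump: "continuous_on S bump" "continuous_on S bump_potential"
  unfolding bump_def[abs_def] bump_potential_def[abs_def] by (intro continuous_intros; simp)+

lemma measurable_bump [measurable]:
  "bump \<in> borel_measurable borel" "bump_potential \<in> borel_measurable borel"
  by (rule borel_measurable_continuous_onI[OF continuous_bump(1)])
     (rule borel_measurable_continuous_onI[OF continuous_bump(2)])

text \<open>Squaring removes the kink of the positive part: the first-order Taylor remainder is at
  most t^2 in each of the four sign cases.\<close>

lemma DERIV_max_square: "((\<lambda>s. (max 0 s)\<^sup>2) has_real_derivative 2 * max 0 s) (at s)" for s :: real
proof -
  have taylor: "\<bar>(max 0 (s + t))\<^sup>2 - (max 0 s)\<^sup>2 - 2 * max 0 s * t\<bar> \<le> t\<^sup>2" for t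
  proof (cases "0 \<le> s"; cases "0 \<le> s + t")
    assume "0 \<le> s" "0 \<le> s + t"
    then show ?thesis by (simp add: max_def power2_eq_square algebra_simps)
  next
    assume st: "0 \<le> s" "\<not> 0 \<le> s + t"
    have "(max 0 (s + t))\<^sup>2 - (max 0 s)\<^sup>2 - 2 * max 0 s * t = s * s + 2 * (s * (- (s + t)))"
      using st by (simp add: max_def power2_eq_square algebra_simps)
    moreover have "0 \<le> s * (- (s + t))" using st by (intro mult_nonneg_nonneg) auto
    moreover have "t\<^sup>2 = s * s + 2 * (s * (- (s + t))) + (s + t)\<^sup>2"
      by (simp add: power2_eq_square algebra_simps)
    moreover have "0 \<le> s * s" "0 \<le> (s + t)\<^sup>2" by auto
    ultimately show ?thesis by linarith
  next
    assume st: "\<not> 0 \<le> s" "0 \<le> s + t"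
    then have "(s + t)\<^sup>2 \<le> t\<^sup>2" by (intro power_mono) auto
    then show ?thesis using st by (simp add: max_def)
  next
    assume "\<not> 0 \<le> s" "\<not> 0 \<le> s + t"
    then show ?thesis by (simp add: max_def)
  qed
  have "(\<lambda>t. ((max 0 (s + t))\<^sup>2 - (max 0 s)\<^sup>2) / t - 2 * max 0 s) \<midarrow>0\<rightarrow> 0"
  proof (rule Lim_null_comparison[where g="\<lambda>t. \<bar>t\<bar>"])
    show "\<forall>\<^sub>F t in at (0::real). norm (((max 0 (s + t))\<^sup>2 - (max 0 s)\<^sup>2) / t - 2 * max 0 s) \<le> \<bar>t\<bar>"
      unfolding eventually_at_filter
    proof (intro always_eventually allI impI)
      fix t :: real assume t: "t \<noteq> 0"
      have "((max 0 (s + t))\<^sup>2 - (max 0 s)\<^sup>2) / t - 2 * max 0 s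
          = ((max 0 (s + t))\<^sup>2 - (max 0 s)\<^sup>2 - 2 * max 0 s * t) / t"
        using t by (simp add: diff_divide_distrib)
      then have "norm (((max 0 (s + t))\<^sup>2 - (max 0 s)\<^sup>2) / t - 2 * max 0 s)
          = \<bar>(max 0 (s + t))\<^sup>2 - (max 0 s)\<^sup>2 - 2 * max 0 s * t\<bar> / \<bar>t\<bar>"
        by simp
      also have "\<dots> \<le> t\<^sup>2 / \<bar>t\<bar>" by (intro divide_right_mono taylor) simp
      also have "\<dots> = \<bar>t\<bar>" using t by (cases "0 < t") (auto simp: power2_eq_square)
      finally show "norm (((max 0 (s + t))\<^sup>2 - (max 0 s)\<^sup>2) / t - 2 * max 0 s) \<le> \<bar>t\<bar>" .
    qed
    show "((\<lambda>t. \<bar>t\<bar>) \<longlongrightarrow> 0) (at (0::real))"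
      by (rule tendsto_rabs_zero) simp
  qed
  then show ?thesis unfolding DERIV_def by (simp only: LIM_zero_iff)
qed

lemma DERIV_bump_potential:
  fixes v :: "'a::euclidean_space"
  shows "((\<lambda>t. bump_potential (y + t *\<^sub>R v)) has_real_derivative - (y \<bullet> v) * bump y) (at 0)"
proof -
  have inner: "((\<lambda>t. 1 - (y + t *\<^sub>R v) \<bullet> (y + t *\<^sub>R v)) has_real_derivative - (2 * (y \<bullet> v))) (at 0)"
  proof -
    have "(\<lambda>t. 1 - (y + t *\<^sub>R v) \<bullet> (y + t *\<^sub>R v)) = (\<lambda>t. 1 - (y \<bullet> y + 2 * t * (y \<bullet> v) + t\<^sup>2 * (v \<bullet> v)))"
      by (auto simp: inner_add inner_commute power2_eq_square algebra_simps)
    moreover have "((\<lambda>t. 1 - (y \<bullet> y + 2 * t * (y \<bullet> v) + t\<^sup>2 * (v \<bullet> v))) has_real_derivative - (2 * (y \<bullet> v))) (at 0)"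
      by (auto intro!: derivative_eq_intros)
    ultimately show ?thesis by simp
  qed
  have "((\<lambda>t. (max 0 (1 - (y + t *\<^sub>R v) \<bullet> (y + t *\<^sub>R v)))\<^sup>2) has_real_derivative
      2 * max 0 (1 - (y + 0 *\<^sub>R v) \<bullet> (y + 0 *\<^sub>R v)) * - (2 * (y \<bullet> v))) (at 0)"
    by (rule DERIV_chain2[OF DERIV_max_square inner])
  from DERIV_cdivide[OF this, of 4] show ?thesis
    unfolding bump_potential_def bump_def by (simp add: mult.commute)
qed

lemma integrable_supported_cball:
  fixes f :: "'a::euclidean_space \<Rightarrow> real"
  assumes "continuous_on (cball 0 1) f" "\<And>y. 1 < norm y \<Longrightarrow> f y = 0"
  shows "integrable lborel f"
proof -
  have "integrable lborel (\<lambda>y. indicator (cball 0 1) y *\<^sub>R f y)"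
    by (rule borel_integrable_compact[OF compact_cball assms(1)])
  moreover have "(\<lambda>y. indicator (cball 0 1) y *\<^sub>R f y) = f"
    using assms(2) by (auto simp: fun_eq_iff indicator_def not_le)
  ultimately show ?thesis by simp
qed

text \<open>The derivative of the left-hand side in the radius is, after an integration by parts
  against \<open>bump_potential\<close>, an average of the Laplacian.\<close>

lemma harmonic_weighted_mean:
  fixes F :: "'a::euclidean_space \<Rightarrow> real"
  assumes r: "0 < r"
    and F: "\<And>z. z \<in> cball x r \<Longrightarrow> (F has_derivative F' z) (at z)"
    and F': "\<And>z i. z \<in> cball x r \<Longrightarrow> i \<in> Basis \<Longrightarrow> ((\<lambda>z. F' z i) has_derivative F'' i z) (at z)"
    and cont: "\<And>i. i \<in> Basis \<Longrightarrow> continuous_on (cball x r) (\<lambda>z. F'' i z i)"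
    and harm: "\<And>z. z \<in> cball x r \<Longrightarrow> (\<Sum>i\<in>Basis. F'' i z i) = 0"
  shows "(LINT y|lborel. F (x + r *\<^sub>R y) * bump y) = F x * (LINT y|lborel. bump (y::'a))"
proof -
  have in_ball: "x + \<rho> *\<^sub>R y \<in> cball x r" if "0 \<le> \<rho>" "\<rho> \<le> r" "norm y \<le> 1" for \<rho> y
  proof -
    have "\<bar>\<rho>\<bar> * norm y \<le> r * 1" using that r by (intro mult_mono) auto
    then show ?thesis by (simp add: dist_norm)
  qed
  have comp: "continuous_on (cball 0 1) (\<lambda>y. h (x + \<rho> *\<^sub>R y))"
    if "0 \<le> \<rho>" "\<rho> \<le> r" "continuous_on (cball x r) h" for \<rho> and h :: "'a \<Rightarrow> real"
    by (rule continuous_on_compose2[OF that(3)]) (use that in_ball in \<open>auto intro!: continuous_intros simp: dist_norm\<close>)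
  have contF: "continuous_on (cball x r) F"
    using F by (intro continuous_at_imp_continuous_on ballI has_derivative_continuous)
  have cont': "continuous_on (cball x r) (\<lambda>z. F' z i)" if "i \<in> Basis" for i
    using F'[OF _ that] by (intro continuous_at_imp_continuous_on ballI has_derivative_continuous)
  have bdd: "\<exists>B. \<forall>z\<in>cball x r. \<bar>h z\<bar> \<le> B" if "continuous_on (cball x r) h" for h :: "'a \<Rightarrow> real"
    using compact_imp_bounded[OF compact_continuous_image[OF that compact_cball]]
    by (auto simp: bounded_iff)
  \<comment> \<open>The integrand is the derivative in direction \<open>i\<close> of
    \<open>F' (x + \<rho> *\<^sub>R y) i * bump_potential y\<close>, so its integral
    vanishes.\<close>
  have parts: "(LINT y|lborel. \<rho> * F'' i (x + \<rho> *\<^sub>R y) i * bump_potential y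
      - F' (x + \<rho> *\<^sub>R y) i * (y \<bullet> i) * bump y) = 0"
    if \<rho>: "0 \<le> \<rho>" "\<rho> \<le> r" and i: "i \<in> Basis" for \<rho> i
  proof -
    let ?G = "\<lambda>y. F' (x + \<rho> *\<^sub>R y) i * bump_potential y"
    let ?G' = "\<lambda>y. \<rho> * F'' i (x + \<rho> *\<^sub>R y) i * bump_potential y
      - F' (x + \<rho> *\<^sub>R y) i * (y \<bullet> i) * bump y"
    have "continuous_on (cball 0 1) ?G'"
      by (intro continuous_intros comp[OF \<rho>] cont cont' i continuous_bump)
    from compact_imp_bounded[OF compact_continuous_image[OF this compact_cball]]
    obtain B where "\<forall>z\<in>?G' ` cball 0 1. norm z \<le> B" unfolding bounded_iff by blast
    then have B: "\<bar>?G' y\<bar> \<le> B" if "norm y \<le> 1" for y using that by simp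
    show ?thesis
    proof (rule integral_directional_derivative[where G="?G" and v=i and R=1 and B="max 0 B"])
      show "integrable lborel ?G"
        by (rule integrable_supported_cball)
           (auto intro!: continuous_intros comp[OF \<rho>] cont' i continuous_bump simp: bump_outside)
      show "?G y = 0" if "1 < norm y" for y using that by (simp add: bump_outside)
      show "\<bar>?G' y\<bar> \<le> max 0 B" for y
      proof (cases "norm y \<le> 1")
        case True
        from B[OF this] show ?thesis by linarith
      next
        case False
        then show ?thesis by (simp add: bump_outside)
      qed
      show "norm i \<le> 1" using i by simp
      show "((\<lambda>t. ?G (y + t *\<^sub>R i)) has_real_derivative ?G' y) (at 0)" for y
      proof (cases "norm y \<le> 1")
        case True
        have lin: "((\<lambda>t. x + \<rho> *\<^sub>R (y + t *\<^sub>R i)) has_derivative (\<lambda>t. (\<rho> * t) *\<^sub>R i)) (at 0)"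
          by (auto intro!: derivative_eq_intros)
        have "((\<lambda>z. F' z i) has_derivative F'' i (x + \<rho> *\<^sub>R y)) (at (x + \<rho> *\<^sub>R (y + 0 *\<^sub>R i)))"
          using F'[OF in_ball[OF \<rho> True] i] by simp
        from has_derivative_compose[OF lin this]
        have 1: "((\<lambda>t. F' (x + \<rho> *\<^sub>R (y + t *\<^sub>R i)) i) has_derivative
            (\<lambda>t. F'' i (x + \<rho> *\<^sub>R y) ((\<rho> * t) *\<^sub>R i))) (at 0)" .
        have "linear (F'' i (x + \<rho> *\<^sub>R y))"
          using F'[OF in_ball[OF \<rho> True] i] by (rule has_derivative_linear)
        then have "(\<lambda>t. F'' i (x + \<rho> *\<^sub>R y) ((\<rho> * t) *\<^sub>R i)) = (*) (\<rho> * F'' i (x + \<rho> *\<^sub>R y) i)"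
          by (auto simp: linear_cmul)
        with 1 have "((\<lambda>t. F' (x + \<rho> *\<^sub>R (y + t *\<^sub>R i)) i) has_real_derivative
            \<rho> * F'' i (x + \<rho> *\<^sub>R y) i) (at 0)"
          by (simp add: has_field_derivative_def)
        from DERIV_mult[OF this DERIV_bump_potential[of y i]] show ?thesis
          by (simp add: algebra_simps)
      next
        \<comment> \<open>Nothing is assumed about \<open>F\<close> outside the ball. A point beyond
          the closed unit ball has a neighbourhood where \<open>bump_potential\<close> vanishes, so
          the product is constantly 0 there.\<close>
        case False
        then have "y \<in> - cball 0 1" by simp
        then obtain d where d: "0 < d" "ball y d \<subseteq> - cball 0 1"
          using open_Compl[OF closed_cball] open_contains_ball_eq by blast
        have "((\<lambda>t. 0) has_real_derivative ?G' y) (at 0)"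
          using False by (simp add: bump_outside)
        then show ?thesis
        proof (rule has_field_derivative_transform_within[OF _ d(1)])
          fix t :: real assume "dist t 0 < d"
          then have "y + t *\<^sub>R i \<in> ball y d" using i by (simp add: dist_norm)
          then have "1 < norm (y + t *\<^sub>R i)" using d(2) by auto
          then show "0 = ?G (y + t *\<^sub>R i)" by (simp add: bump_outside)
        qed simp
      qed
    qed
  qed
  have F'_eq: "F' z y = (\<Sum>i\<in>Basis. (y \<bullet> i) * F' z i)" if "z \<in> cball x r" for z y
  proof -
    have lin: "linear (F' z)" using F[OF that] by (rule has_derivative_linear)
    have "F' z y = F' z (\<Sum>i\<in>Basis. (y \<bullet> i) *\<^sub>R i)" by (simp add: euclidean_representation)
    also have "\<dots> = (\<Sum>i\<in>Basis. (y \<bullet> i) * F' z i)"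
      by (simp add: linear_sum[OF lin] linear_cmul[OF lin])
    finally show ?thesis .
  qed
  \<comment> \<open>Summed over the basis, the second-order terms of \<open>parts\<close> combine to
    a multiple of the Laplacian and vanish; what is left is the derivative of the mean in the radius
    \<rho>.\<close>
  have radial: "(LINT y|lborel. F' (x + \<rho> *\<^sub>R y) y * bump y) = 0"
    if \<rho>: "0 \<le> \<rho>" "\<rho> \<le> r" for \<rho>
  proof -
    let ?a = "\<lambda>i y. \<rho> * F'' i (x + \<rho> *\<^sub>R y) i * bump_potential y"
    let ?b = "\<lambda>i y. F' (x + \<rho> *\<^sub>R y) i * (y \<bullet> i) * bump y"
    have int: "integrable lborel (\<lambda>y. ?a i y - ?b i y)" if "i \<in> Basis" for i
      by (rule integrable_supported_cball)
         (auto intro!: continuous_intros comp[OF \<rho>] cont cont' that continuous_bump simp: bump_outside)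
    have "F' (x + \<rho> *\<^sub>R y) y * bump y = - (\<Sum>i\<in>Basis. ?a i y - ?b i y)" for y
    proof (cases "norm y \<le> 1")
      case True
      note z = in_ball[OF \<rho> True]
      have "(\<Sum>i\<in>Basis. ?a i y) = \<rho> * (\<Sum>i\<in>Basis. F'' i (x + \<rho> *\<^sub>R y) i) * bump_potential y"
        by (simp add: sum_distrib_left sum_distrib_right)
      also have "\<dots> = 0" using harm[OF z] by simp
      finally have "(\<Sum>i\<in>Basis. ?a i y - ?b i y) = - (\<Sum>i\<in>Basis. ?b i y)"
        by (simp add: sum_subtractf)
      also have "(\<Sum>i\<in>Basis. ?b i y) = F' (x + \<rho> *\<^sub>R y) y * bump y"
        unfolding F'_eq[OF z, of y] by (simp add: sum_distrib_left mult.commute mult.left_commute)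
      finally show ?thesis by simp
    next
      case False
      then show ?thesis by (simp add: bump_outside)
    qed
    then have "(LINT y|lborel. F' (x + \<rho> *\<^sub>R y) y * bump y)
        = - (LINT y|lborel. (\<Sum>i\<in>Basis. ?a i y - ?b i y))"
      by (simp only: Bochner_Integration.integral_minus)
    also have "(LINT y|lborel. (\<Sum>i\<in>Basis. ?a i y - ?b i y)) = (\<Sum>i\<in>Basis. LINT y|lborel. ?a i y - ?b i y)"
      by (rule Bochner_Integration.integral_sum) (rule int)
    also have "\<dots> = 0" using parts[OF \<rho>] by simp
    finally show ?thesis by simp
  qed
  obtain B1 where B1: "\<And>i z. i \<in> Basis \<Longrightarrow> z \<in> cball x r \<Longrightarrow> \<bar>F' z i\<bar> \<le> B1 i"
    using bdd[OF cont'] by metis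
  define B where "B = (\<Sum>i\<in>Basis. B1 i)"
  have F'_bound: "\<bar>F' z y\<bar> \<le> B" if z: "z \<in> cball x r" and y: "norm y \<le> 1" for z y
  proof -
    have "\<bar>F' z y\<bar> \<le> (\<Sum>i\<in>Basis. \<bar>(y \<bullet> i) * F' z i\<bar>)"
      unfolding F'_eq[OF z, of y] by (rule sum_abs)
    also have "\<dots> \<le> B" unfolding B_def
    proof (rule sum_mono)
      fix i :: 'a assume i: "i \<in> Basis"
      have "\<bar>y \<bullet> i\<bar> \<le> 1" using Basis_le_norm[OF i, of y] y by linarith
      then have "\<bar>y \<bullet> i\<bar> * \<bar>F' z i\<bar> \<le> 1 * B1 i"
        using B1[OF i z] by (intro mult_mono) auto
      then show "\<bar>(y \<bullet> i) * F' z i\<bar> \<le> B1 i" by (simp add: abs_mult)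
    qed
    finally show ?thesis .
  qed
  have ray: "((\<lambda>t. F (x + t *\<^sub>R y)) has_real_derivative F' (x + \<rho> *\<^sub>R y) y) (at \<rho>)"
    if \<rho>: "0 \<le> \<rho>" "\<rho> \<le> r" and y: "norm y \<le> 1" for \<rho> y
  proof -
    note z = in_ball[OF \<rho> y]
    have lin: "((\<lambda>t. x + t *\<^sub>R y) has_derivative (\<lambda>t. t *\<^sub>R y)) (at \<rho>)"
      by (auto intro!: derivative_eq_intros)
    have "((\<lambda>t. F (x + t *\<^sub>R y)) has_derivative (\<lambda>t. F' (x + \<rho> *\<^sub>R y) (t *\<^sub>R y))) (at \<rho>)"
      by (rule has_derivative_compose[OF lin F[OF z]])
    moreover have "(\<lambda>t. F' (x + \<rho> *\<^sub>R y) (t *\<^sub>R y)) = (*) (F' (x + \<rho> *\<^sub>R y) y)"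
      by (auto simp: linear_cmul[OF has_derivative_linear[OF F[OF z]]])
    ultimately show ?thesis by (simp add: has_field_derivative_def)
  qed
  define m where "m \<rho> = (LINT y|lborel. F (x + \<rho> *\<^sub>R y) * bump y)" for \<rho>
  have int_m: "integrable lborel (\<lambda>y. F (x + \<rho> *\<^sub>R y) * bump y)" if "0 \<le> \<rho>" "\<rho> \<le> r" for \<rho>
    by (rule integrable_supported_cball)
       (auto intro!: continuous_intros comp[OF that] contF continuous_bump simp: bump_outside)
  have B0: "0 \<le> B" using F'_bound[of x 0] r by (intro order_trans[OF abs_ge_zero]) auto
  \<comment> \<open>Differentiation under the integral sign by dominated convergence along
    sequences. The quotients stay inside \<open>{0..r}\<close>, where \<open>F\<close> is
    controlled, and this covers the end points too.\<close>
  have deriv_m: "(m has_real_derivative 0) (at \<rho> within {0..r})" if \<rho>_in: "\<rho> \<in> {0..r}" for \<rho>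
    unfolding has_field_derivative_iff tendsto_at_iff_sequentially o_def
  proof (intro allI impI)
    have \<rho>: "0 \<le> \<rho>" "\<rho> \<le> r" using \<rho>_in by auto
    fix X :: "nat \<Rightarrow> real"
    assume X: "\<forall>n. X n \<in> {0..r} - {\<rho>}" and lim: "X \<longlonglongrightarrow> \<rho>"
    let ?q = "\<lambda>n y. (F (x + X n *\<^sub>R y) * bump y - F (x + \<rho> *\<^sub>R y) * bump y) / (X n - \<rho>)"
    have X0: "0 \<le> X n" "X n \<le> r" "X n \<noteq> \<rho>" for n using X by auto
    have q_lim: "(\<lambda>n. ?q n y) \<longlonglongrightarrow> F' (x + \<rho> *\<^sub>R y) y * bump y" for y
    proof (cases "norm y \<le> 1")
      case True
      have "((\<lambda>t. (F (x + t *\<^sub>R y) - F (x + \<rho> *\<^sub>R y)) / (t - \<rho>)) \<longlongrightarrow> F' (x + \<rho> *\<^sub>R y) y) (at \<rho>)"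
        using ray[OF \<rho> True] by (simp add: has_field_derivative_iff)
      moreover have "filterlim X (at \<rho>) sequentially"
        using lim X0(3) by (intro filterlim_atI) auto
      ultimately have "(\<lambda>n. (F (x + X n *\<^sub>R y) - F (x + \<rho> *\<^sub>R y)) / (X n - \<rho>)) \<longlonglongrightarrow> F' (x + \<rho> *\<^sub>R y) y"
        by (rule filterlim_compose)
      from tendsto_mult[OF this tendsto_const[of "bump y"]]
      show ?thesis by (simp add: left_diff_distrib)
    next
      case False
      then show ?thesis by (simp add: bump_outside)
    qed
    have meas: "?q n \<in> borel_measurable lborel" for n
      using int_m[OF X0(1,2)[of n]] int_m[OF \<rho>] by auto
    have meas': "(\<lambda>y. F' (x + \<rho> *\<^sub>R y) y * bump y) \<in> borel_measurable lborel"
      by (rule borel_measurable_LIMSEQ_real[OF q_lim meas])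
    have q_lim_AE: "AE y in lborel. (\<lambda>n. ?q n y) \<longlonglongrightarrow> F' (x + \<rho> *\<^sub>R y) y * bump y"
      by (rule AE_I2, rule q_lim)
    have int_B: "integrable lborel (\<lambda>y. B * indicator (cball (0::'a) 1) y)"
      by (rule integrable_mult_right, rule integrable_indicator_cball)
    have q_le: "AE y in lborel. norm (?q n y) \<le> B * indicator (cball 0 1) y" for n
    proof (intro AE_I2)
      fix y :: 'a
      show "norm (?q n y) \<le> B * indicator (cball 0 1) y"
      proof (cases "norm y \<le> 1")
        case True
        have "norm (F (x + X n *\<^sub>R y) - F (x + \<rho> *\<^sub>R y)) \<le> B * norm (X n - \<rho>)"
        proof (rule field_differentiable_bound[where S="{0..r}" and f'="\<lambda>\<rho>. F' (x + \<rho> *\<^sub>R y) y"])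
          show "((\<lambda>t. F (x + t *\<^sub>R y)) has_real_derivative F' (x + t *\<^sub>R y) y) (at t within {0..r})"
            if "t \<in> {0..r}" for t
            using that by (intro has_field_derivative_at_within[OF ray[OF _ _ True]]) auto
          show "norm (F' (x + t *\<^sub>R y) y) \<le> B" if "t \<in> {0..r}" for t
            using F'_bound[OF in_ball[OF _ _ True] True, of t] that by auto
        qed (use X0[of n] \<rho> in auto)
        then have le: "\<bar>(F (x + X n *\<^sub>R y) - F (x + \<rho> *\<^sub>R y)) / (X n - \<rho>)\<bar> \<le> B"
          using X0(3)[of n] by (simp add: abs_divide divide_le_eq)
        have "?q n y = (F (x + X n *\<^sub>R y) - F (x + \<rho> *\<^sub>R y)) / (X n - \<rho>) * bump y"
          by (simp only: left_diff_distrib[symmetric] times_divide_eq_left)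
        then have "norm (?q n y) = \<bar>(F (x + X n *\<^sub>R y) - F (x + \<rho> *\<^sub>R y)) / (X n - \<rho>)\<bar> * bump y"
          by (simp only: real_norm_def abs_mult abs_of_nonneg[OF bump_bounds(1)])
        also have "\<dots> \<le> B * 1"
          using le bump_bounds[of y] B0 by (intro mult_mono) auto
        finally show ?thesis using True by simp
      next
        case False
        then show ?thesis using B0 by (simp add: bump_outside)
      qed
    qed
    have "(\<lambda>n. LINT y|lborel. ?q n y) \<longlonglongrightarrow> (LINT y|lborel. F' (x + \<rho> *\<^sub>R y) y * bump y)"
      by (rule integral_dominated_convergence[OF meas' meas int_B q_lim_AE q_le])
    then have conv: "(\<lambda>n. LINT y|lborel. ?q n y) \<longlonglongrightarrow> 0" unfolding radial[OF \<rho>] .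
    have eq: "(LINT y|lborel. ?q n y) = (m (X n) - m \<rho>) / (X n - \<rho>)" for n
      unfolding m_def using int_m[OF X0(1,2)[of n]] int_m[OF \<rho>] by simp
    show "(\<lambda>n. (m (X n) - m \<rho>) / (X n - \<rho>)) \<longlonglongrightarrow> 0"
      using conv unfolding eq .
  qed
  obtain c where c: "\<And>\<rho>. \<rho> \<in> {0..r} \<Longrightarrow> m \<rho> = c"
    using has_field_derivative_zero_constant[of "{0..r}" m] deriv_m by auto
  \<comment> \<open>At radius 0 the mean is \<open>F x\<close> times the total weight.\<close>
  have "m r = m 0" using c[of r] c[of 0] r by simp
  then show ?thesis by (simp add: m_def)
qed

section \<open>Local bounds for eigenfunctions\<close>

locale dirichlet_region = bounded_region D
  for D :: "'a::euclidean_space set" +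
  fixes e :: "nat \<Rightarrow> 'a \<Rightarrow> real" and lam :: "nat \<Rightarrow> real"
  assumes D_open: "open D" and eigenbasis: "dirichlet_eigenbasis D e lam"
begin

lemma L2_fun_e: "L2_fun D (e k)"
  using eigenbasis unfolding dirichlet_eigenbasis_def L2_orthonormal_basis_def by blast

lemma orthonormal: "L2_inner D (e j) (e k) = (if j = k then 1 else 0)"
  using eigenbasis unfolding dirichlet_eigenbasis_def L2_orthonormal_basis_def by blast

lemma lam_pos: "0 < lam k"
  using eigenbasis unfolding dirichlet_eigenbasis_def by blast

lemma lam_at_top: "filterlim lam at_top sequentially"
  using eigenbasis unfolding dirichlet_eigenbasis_def by blast

lemma sqn_eq_inner: "sqn f = L2_inner D f f"
  by (simp add: L2_inner_def power2_eq_square)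

lemma inner_lincomb_e:
  assumes "finite S"
  shows "L2_inner D (\<lambda>x. \<Sum>k\<in>S. c k * e k x) (e j) = (if j \<in> S then c j else 0)"
proof -
  have "L2_inner D (\<lambda>x. \<Sum>k\<in>S. c k * e k x) (e j) = (\<Sum>k\<in>S. c k * L2_inner D (e k) (e j))"
    by (intro L2_inner_sum L2_fun_e)
  also have "\<dots> = (\<Sum>k\<in>S. if k = j then c j else 0)"
    by (intro sum.cong) (auto simp: orthonormal)
  finally show ?thesis using assms by simp
qed

lemma sqn_lincomb:
  assumes "finite S"
  shows "sqn (\<lambda>x. \<Sum>k\<in>S. c k * e k x) = (\<Sum>k\<in>S. (c k)\<^sup>2)"
proof -
  let ?P = "\<lambda>x. \<Sum>k\<in>S. c k * e k x"
  have "L2_inner D ?P ?P = (\<Sum>k\<in>S. c k * L2_inner D (e k) ?P)"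
    by (intro L2_inner_sum L2_fun_e L2_fun_sum)
  also have "\<dots> = (\<Sum>k\<in>S. (c k)\<^sup>2)"
    using inner_lincomb_e[OF assms, of c]
    by (intro sum.cong) (auto simp: L2_inner_commute[of "e _"] power2_eq_square)
  finally show ?thesis by (simp only: sqn_eq_inner)
qed

lemma sqn_residual:
  assumes h: "L2_fun D h" and S: "finite S"
  shows "sqn (\<lambda>x. h x - (\<Sum>k\<in>S. L2_inner D h (e k) * e k x)) = sqn h - (\<Sum>k\<in>S. (L2_inner D h (e k))\<^sup>2)"
proof -
  let ?P = "\<lambda>x. \<Sum>k\<in>S. L2_inner D h (e k) * e k x"
  have "L2_inner D ?P h = (\<Sum>k\<in>S. L2_inner D h (e k) * L2_inner D (e k) h)"
    by (intro L2_inner_sum L2_fun_e h)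
  then have "L2_inner D h ?P = (\<Sum>k\<in>S. (L2_inner D h (e k))\<^sup>2)"
    by (simp add: L2_inner_commute[of _ h] power2_eq_square)
  moreover have "sqn (\<lambda>x. h x + (-1) * ?P x) = sqn h + 2 * (-1) * L2_inner D h ?P + (-1)\<^sup>2 * sqn ?P"
    by (intro sqn_linear h L2_fun_sum L2_fun_e)
  ultimately show ?thesis by (simp add: sqn_lincomb[OF S])
qed

lemma Bessel:
  assumes h: "L2_fun D h" and S: "finite S"
  shows "(\<Sum>k\<in>S. (L2_inner D h (e k))\<^sup>2) \<le> sqn h"
  using sqn_residual[OF assms] sqn_nonneg[of "\<lambda>x. h x - (\<Sum>k\<in>S. L2_inner D h (e k) * e k x)"] by linarith

lemma Parseval:
  assumes h: "L2_fun D h"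
  shows "(\<lambda>n. \<Sum>k<n. (L2_inner D h (e k))\<^sup>2) \<longlonglongrightarrow> sqn h"
proof -
  have "L2_tendsto D (\<lambda>n y. \<Sum>k<n. L2_inner D h (e k) * e k y) h"
    using eigenbasis h unfolding dirichlet_eigenbasis_def L2_orthonormal_basis_def by blast
  then have "(\<lambda>n. sqn (\<lambda>x. h x - (\<Sum>k<n. L2_inner D h (e k) * e k x))) \<longlonglongrightarrow> 0"
    unfolding L2_tendsto_def by (simp only: power2_commute)
  then have "(\<lambda>n. sqn h - (\<Sum>k<n. (L2_inner D h (e k))\<^sup>2)) \<longlonglongrightarrow> 0"
    by (simp only: sqn_residual[OF h finite_lessThan])
  from tendsto_diff[OF tendsto_const[of "sqn h"] this] show ?thesis by simp
qed

lemma eigenfunction_derivatives: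
  shows "x \<in> D \<Longrightarrow> e k differentiable at x"
    and "x \<in> D \<Longrightarrow> i \<in> Basis \<Longrightarrow> (\<lambda>x. frechet_derivative (e k) (at x) i) differentiable at x"
    and "i \<in> Basis \<Longrightarrow> j \<in> Basis \<Longrightarrow>
      continuous_on D (\<lambda>x. frechet_derivative (\<lambda>x. frechet_derivative (e k) (at x) i) (at x) j)"
    and "x \<in> D \<Longrightarrow> laplacian (e k) x = - lam k * e k x"
proof -
  have "Ck_on (Suc (Suc 0)) (e k) D"
    using eigenbasis unfolding dirichlet_eigenbasis_def by (simp add: numeral_2_eq_2)
  then show "x \<in> D \<Longrightarrow> e k differentiable at x"
    and "x \<in> D \<Longrightarrow> i \<in> Basis \<Longrightarrow> (\<lambda>x. frechet_derivative (e k) (at x) i) differentiable at x"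
    and "i \<in> Basis \<Longrightarrow> j \<in> Basis \<Longrightarrow>
      continuous_on D (\<lambda>x. frechet_derivative (\<lambda>x. frechet_derivative (e k) (at x) i) (at x) j)"
    by (simp_all only: Ck_on.simps)
  have "x \<in> D \<Longrightarrow> - laplacian (e k) x = lam k * e k x"
    using eigenbasis unfolding dirichlet_eigenbasis_def by blast
  then show "x \<in> D \<Longrightarrow> laplacian (e k) x = - lam k * e k x" by simp
qed

lemma continuous_on_e: "continuous_on D (e k)"
  using eigenfunction_derivatives(1)
  by (intro continuous_at_imp_continuous_on ballI differentiable_imp_continuous_within)

end

lemma has_derivative_times_fst_snd:
  fixes f :: "'a::euclidean_space \<Rightarrow> real" and g :: "real \<Rightarrow> real"
  assumes "(f has_derivative f') (at (fst p))" "(g has_real_derivative g') (at (snd p))"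
  shows "((\<lambda>p. f (fst p) * g (snd p)) has_derivative (\<lambda>h. f' (fst h) * g (snd p) + f (fst p) * (g' * snd h))) (at p)"
proof -
  have 1: "((\<lambda>p. f (fst p)) has_derivative (\<lambda>h. f' (fst h))) (at p)"
    by (rule has_derivative_compose[OF has_derivative_fst[OF has_derivative_ident] assms(1)])
  have "(g has_derivative (*) g') (at (snd p))" using assms(2) by (simp add: has_field_derivative_def)
  from has_derivative_compose[OF has_derivative_snd[OF has_derivative_ident] this]
  have 2: "((\<lambda>p. g (snd p)) has_derivative (\<lambda>h. g' * snd h)) (at p)" .
  show ?thesis using has_derivative_mult[OF 1 2] by (simp add: add.commute)
qed

lemma integral_bump_pos: "0 < (LINT y|lborel. bump (y::'a::euclidean_space))"
proof -
  \<comment> \<open>On the ball of radius 1/2 the weight is at least 1 - 1/4.\<close>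
  have "0 < 3 / 4 * measure lborel (cball (0::'a) (1/2))" by (simp add: content_cball_pos)
  also have "\<dots> = (LINT y|lborel. 3 / 4 * indicator (cball (0::'a) (1/2)) y)" by simp
  also have "\<dots> \<le> (LINT y|lborel. bump (y::'a))"
  proof (rule integral_mono)
    show "integrable lborel (\<lambda>y. 3 / 4 * indicator (cball (0::'a) (1/2)) y :: real)"
      by (rule integrable_mult_right, rule integrable_indicator_cball)
    show "integrable lborel (\<lambda>y::'a. bump y)"
      by (rule integrable_supported_cball) (auto simp: continuous_bump bump_outside)
    fix y :: 'a
    show "3 / 4 * indicator (cball 0 (1/2)) y \<le> bump y"
    proof (cases "norm y \<le> 1/2")
      case True
      then have "(norm y)\<^sup>2 \<le> (1/2)\<^sup>2" by (intro power_mono) auto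
      then show ?thesis using True by (simp add: bump_def power2_norm_eq_inner power2_eq_square[of "1/2"])
    next
      case False
      then show ?thesis using bump_bounds(1)[of y] by simp
    qed
  qed
  finally show ?thesis .
qed

context dirichlet_region
begin

text \<open>The extension \<open>e k y * cosh (sqrt (lam k) * s)\<close> is harmonic in \<open>D \<times> \<real>\<close>.\<close>

lemma eigenfunction_mean:
  assumes r: "0 < r" and sub: "cball x r \<subseteq> D" and \<mu>: "\<mu>\<^sup>2 = lam k"
  shows "e k x * (LINT p|lborel. bump (p::'a \<times> real))
    = (LINT p|lborel. e k (x + r *\<^sub>R fst p) * cosh (\<mu> * (r * snd p)) * bump p)"
proof -
  let ?f = "e k" and ?f1 = "\<lambda>i x. frechet_derivative (e k) (at x) i"
  let ?f2 = "\<lambda>i x. frechet_derivative (\<lambda>x. frechet_derivative (e k) (at x) i) (at x)"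
  define F where "F p = ?f (fst p) * cosh (\<mu> * snd p)" for p :: "'a \<times> real"
  \<comment> \<open>The case distinction makes \<open>F'\<close> vanish where \<open>frechet_derivative\<close> is unspecified.\<close>
  define F' where "F' p h = (if fst h = 0 then 0 else frechet_derivative (e k) (at (fst p)) (fst h)) * cosh (\<mu> * snd p)
      + ?f (fst p) * (\<mu> * sinh (\<mu> * snd p) * snd h)" for p h :: "'a \<times> real"
  define F'' where "F'' i p h =
      (if snd i = 0
       then ?f2 (fst i) (fst p) (fst h) * cosh (\<mu> * snd p) + ?f1 (fst i) (fst p) * (\<mu> * sinh (\<mu> * snd p) * snd h)
       else frechet_derivative (e k) (at (fst p)) (fst h) * (\<mu> * sinh (\<mu> * snd p))
         + ?f (fst p) * (\<mu> * \<mu> * cosh (\<mu> * snd p) * snd h))" for i p h :: "'a \<times> real"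
  have in_D: "fst p \<in> D" if "p \<in> cball (x, 0) r" for p :: "'a \<times> real"
    using that sub dist_fst_le[of p "(x, 0)"] by (auto simp: dist_commute)
  have ch: "((\<lambda>s. cosh (\<mu> * s)) has_real_derivative \<mu> * sinh (\<mu> * s)) (at s)"
    and sh: "((\<lambda>s. \<mu> * sinh (\<mu> * s)) has_real_derivative \<mu> * \<mu> * cosh (\<mu> * s)) (at s)" for s
    by (auto intro!: derivative_eq_intros)
  have zero: "frechet_derivative g (at z) 0 = 0" if "g differentiable at z" for g :: "'a \<Rightarrow> real" and z
    using that unfolding frechet_derivative_works by (rule linear_0[OF has_derivative_linear])
  have "(LINT p|lborel. F ((x, 0) + r *\<^sub>R p) * bump p) = F (x, 0) * (LINT p|lborel. bump (p::'a \<times> real))"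
  proof (rule harmonic_weighted_mean[OF r, where F'=F' and F''=F''])
    fix p :: "'a \<times> real" assume p: "p \<in> cball (x, 0) r"
    note z = in_D[OF p]
    have "(F has_derivative (\<lambda>h. frechet_derivative (e k) (at (fst p)) (fst h) * cosh (\<mu> * snd p)
        + ?f (fst p) * (\<mu> * sinh (\<mu> * snd p) * snd h))) (at p)"
      unfolding F_def[abs_def]
      by (rule has_derivative_times_fst_snd[OF _ ch])
         (use eigenfunction_derivatives(1)[OF z] in \<open>simp add: frechet_derivative_works\<close>)
    moreover have "F' p = (\<lambda>h. frechet_derivative (e k) (at (fst p)) (fst h) * cosh (\<mu> * snd p)
        + ?f (fst p) * (\<mu> * sinh (\<mu> * snd p) * snd h))"
      unfolding F'_def using zero[OF eigenfunction_derivatives(1)[OF z]] by auto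
    ultimately show "(F has_derivative F' p) (at p)" by simp
    show "(\<Sum>i\<in>Basis. F'' i p i) = 0"
    proof -
      \<comment> \<open>The spatial second derivatives contribute the factor \<open>- lam k\<close>
        and the vertical one \<open>\<mu>\<^sup>2 = lam k\<close>; they cancel.\<close>
      have "(\<Sum>i\<in>Basis. F'' i p i) = (\<Sum>i\<in>(\<lambda>u. (u, 0)) ` Basis. F'' i p i) + (\<Sum>i\<in>(\<lambda>v. (0, v)) ` Basis. F'' i p i)"
        unfolding Basis_prod_def by (rule sum.union_disjoint) auto
      also have "(\<Sum>i\<in>(\<lambda>u. (u, 0)) ` Basis. F'' i p i) = (\<Sum>u\<in>Basis. F'' (u, 0) p (u, 0))"
        by (subst sum.reindex) (auto simp: inj_on_def)
      also have "(\<Sum>u\<in>Basis. F'' (u, 0) p (u, 0)) = laplacian (e k) (fst p) * cosh (\<mu> * snd p)"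
        by (simp add: F''_def laplacian_def sum_distrib_right)
      also have "(\<Sum>i\<in>(\<lambda>v::real. (0, v)) ` Basis. F'' i p i) = F'' (0, 1) p (0, 1)"
        by simp
      also have "\<dots> = lam k * e k (fst p) * cosh (\<mu> * snd p)"
        using zero[OF eigenfunction_derivatives(1)[OF z]] \<mu> by (simp add: F''_def power2_eq_square)
      finally show ?thesis using eigenfunction_derivatives(4)[OF z] by simp
    qed
    fix i :: "'a \<times> real" assume "i \<in> Basis"
    then consider u where "i = (u, 0)" "u \<in> Basis" | "i = (0, 1)"
      by (auto simp: Basis_prod_def)
    then show "((\<lambda>p. F' p i) has_derivative F'' i p) (at p)"
    proof cases
      case 1
      have "((\<lambda>p. ?f1 u (fst p) * cosh (\<mu> * snd p)) has_derivative
          (\<lambda>h. ?f2 u (fst p) (fst h) * cosh (\<mu> * snd p) + ?f1 u (fst p) * (\<mu> * sinh (\<mu> * snd p) * snd h))) (at p)"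
        by (rule has_derivative_times_fst_snd[OF _ ch])
           (use eigenfunction_derivatives(2)[OF z 1(2)] in \<open>simp add: frechet_derivative_works\<close>)
      then show ?thesis using 1 nonzero_Basis[OF 1(2)] by (simp add: F'_def F''_def[abs_def])
    next
      case 2
      have "((\<lambda>p. ?f (fst p) * (\<mu> * sinh (\<mu> * snd p))) has_derivative
          (\<lambda>h. frechet_derivative (e k) (at (fst p)) (fst h) * (\<mu> * sinh (\<mu> * snd p))
            + ?f (fst p) * (\<mu> * \<mu> * cosh (\<mu> * snd p) * snd h))) (at p)"
        by (rule has_derivative_times_fst_snd[OF _ sh])
           (use eigenfunction_derivatives(1)[OF z] in \<open>simp add: frechet_derivative_works\<close>)
      then show ?thesis using 2 by (simp add: F'_def F''_def[abs_def])
    qed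
  next
    fix i :: "'a \<times> real" assume "i \<in> Basis"
    then consider u where "i = (u, 0)" "u \<in> Basis" | "i = (0, 1)"
      by (auto simp: Basis_prod_def)
    note cases = this
    have fst: "continuous_on (cball (x, 0::real) r) (\<lambda>p. h (fst p))" if "continuous_on D h"
      for h :: "'a \<Rightarrow> real"
      by (rule continuous_on_compose2[OF that]) (use in_D in \<open>auto intro!: continuous_intros\<close>)
    from cases show "continuous_on (cball (x, 0) r) (\<lambda>p. F'' i p i)"
    proof cases
      case 1
      then have eq: "(\<lambda>p. F'' i p i) = (\<lambda>p. ?f2 u (fst p) u * cosh (\<mu> * snd p))"
        by (auto simp: F''_def)
      show ?thesis unfolding eq
        by (intro continuous_intros fst eigenfunction_derivatives(3)) (use 1 in auto)
    next
      case 2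
      have eq: "F'' i p i = ?f (fst p) * (\<mu> * \<mu> * cosh (\<mu> * snd p))" if "p \<in> cball (x, 0) r" for p
        using zero[OF eigenfunction_derivatives(1)[OF in_D[OF that]]] 2 by (simp add: F''_def)
      have cont: "continuous_on (cball (x, 0) r) (\<lambda>p. ?f (fst p) * (\<mu> * \<mu> * cosh (\<mu> * snd p)))"
        by (intro continuous_intros fst continuous_on_e)
      show ?thesis by (rule iffD2[OF continuous_on_cong[OF refl eq] cont])
    qed
  qed
  then show ?thesis by (simp add: F_def)
qed

end

section \<open>Bessel's inequality on slices of the mean value identity\<close>

context dirichlet_region
begin

text \<open>Fubini splits the mean into slices at height \<open>s\<close>. Each slice pairs
  \<open>e k\<close> with a weight independent of \<open>k\<close>, as Bessel's inequality will
  require. The other factor, the hyperbolic cosine, is at most \<open>cosh 1\<close> since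
  \<open>sqrt (lam k) * r \<le> 1\<close> and \<open>\<bar>s\<bar> \<le> 1\<close>; Cauchy-Schwarz
  removes it, and 2 is the length of \<open>{-1..1}\<close>.\<close>

lemma eigenfunction_mean_slices:
  assumes r: "0 < r" and sub: "cball x r \<subseteq> D" and small: "lam k * r\<^sup>2 \<le> 1"
  defines "a \<equiv> \<lambda>s. LINT y|lborel. indicator (cball 0 1) y * e k (x + r *\<^sub>R y) * bump (y, s::real)"
  shows "a \<in> borel_measurable borel"
    and "(e k x * (LINT p|lborel. bump (p::'a \<times> real)))\<^sup>2 \<le> 2 * (cosh 1)\<^sup>2 * (LINT s|leb_on {-1..1}. (a s)\<^sup>2)"
    and "\<exists>K. \<forall>s. \<bar>a s\<bar> \<le> K"
proof -
  interpret I: bounded_region "{-1..1::real}" by standard auto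
  define \<mu> where "\<mu> = sqrt (lam k)"
  have \<mu>: "\<mu>\<^sup>2 = lam k" "0 \<le> \<mu>" using lam_pos[of k] by (auto simp: \<mu>_def)
  have "(\<mu> * r)\<^sup>2 \<le> 1\<^sup>2" using small \<mu> by (simp add: power_mult_distrib)
  then have \<mu>r: "\<mu> * r \<le> 1" by (rule power2_le_imp_le) simp
  \<comment> \<open>The cut-off keeps the argument in \<open>D\<close>, where \<open>e k\<close> is
    continuous, so that \<open>E\<close> is Borel on the whole space and bounded.\<close>
  define E where "E y = indicator (cball 0 1) y * e k (x + r *\<^sub>R y)" for y
  have in_D: "x + r *\<^sub>R y \<in> D" if "norm y \<le> 1" for y
  proof -
    have "x + r *\<^sub>R y \<in> cball x r" using that r by (simp add: dist_norm mult_left_le)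
    then show ?thesis using sub by blast
  qed
  have contE: "continuous_on (cball 0 1) (\<lambda>y. e k (x + r *\<^sub>R y))"
    by (rule continuous_on_compose2[OF continuous_on_e]) (use in_D in \<open>auto intro!: continuous_intros\<close>)
  have E_meas [measurable]: "E \<in> borel_measurable borel"
    using borel_measurable_continuous_on_indicator[OF _ contE] by (simp add: E_def[abs_def])
  from compact_imp_bounded[OF compact_continuous_image[OF contE compact_cball]]
  obtain K0 where K0: "\<forall>z\<in>(\<lambda>y. e k (x + r *\<^sub>R y)) ` cball 0 1. norm z \<le> K0" unfolding bounded_iff by blast
  define K where "K = max 0 K0"
  have K: "\<bar>E y\<bar> \<le> K * indicator (cball 0 1) y" for y
  proof (cases "norm y \<le> 1")
    case True
    then have "\<bar>e k (x + r *\<^sub>R y)\<bar> \<le> K0" using K0 by simp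
    then show ?thesis using True by (simp add: E_def K_def)
  qed (simp add: E_def)
  have K_nonneg: "0 \<le> K" by (simp add: K_def)
  have a_eq: "a s = (LINT y|lborel. E y * bump (y, s))" for s by (simp add: a_def E_def)
  have bump2 [measurable]: "(\<lambda>p. bump (fst p :: 'a, snd p :: real)) \<in> borel_measurable (lborel \<Otimes>\<^sub>M lborel)"
    using measurable_bump(1)[where 'a="'a \<times> real"] by (simp add: lborel_prod)
  show meas: "a \<in> borel_measurable borel"
  proof -
    have "(\<lambda>s. LINT y|lborel. E y * bump (y, s)) \<in> borel_measurable (lborel :: real measure)"
    proof (rule lborel.borel_measurable_lebesgue_integral)
      have "(\<lambda>p. (snd p, fst p)) \<in> measurable (lborel \<Otimes>\<^sub>M lborel) (lborel \<Otimes>\<^sub>M (lborel :: real measure))"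
        by measurable
      from measurable_compose[OF this bump2]
      show "(\<lambda>(s, y). E y * bump (y, s)) \<in> borel_measurable ((lborel :: real measure) \<Otimes>\<^sub>M lborel)"
        by (simp add: case_prod_unfold)
    qed
    then show ?thesis by (simp add: a_eq[abs_def])
  qed
  have bump_zero: "bump (y, s) = 0" if "1 \<le> norm y \<or> 1 \<le> \<bar>s\<bar>" for y :: 'a and s :: real
    using that norm_fst_le[of y s] norm_snd_le[where x=y and y=s] by (intro bump_outside) (auto simp del: norm_Pair)
  have a_bound: "\<bar>a s\<bar> \<le> K * measure lborel (cball (0::'a) 1)" for s
  proof -
    have intK: "integrable lborel (\<lambda>y. K * indicator (cball (0::'a) 1) y)"
      by (rule integrable_mult_right, rule integrable_indicator_cball)
    have le: "norm (E y * bump (y, s)) \<le> K * indicator (cball 0 1) y" for y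
    proof -
      have "norm (E y * bump (y, s)) \<le> \<bar>E y\<bar> * 1"
        unfolding real_norm_def abs_mult using bump_bounds[of "(y, s)"] by (intro mult_left_mono) auto
      then show ?thesis using K[of y] by simp
    qed
    have "continuous_on UNIV (\<lambda>y::'a. bump (y, s))"
      by (rule continuous_on_compose2[OF continuous_bump(1)[of UNIV]]) (auto intro!: continuous_intros)
    then have [measurable]: "(\<lambda>y::'a. bump (y, s)) \<in> borel_measurable borel"
      by (rule borel_measurable_continuous_onI)
    have "(\<lambda>y. E y * bump (y, s)) \<in> borel_measurable lborel" by simp
    then have "integrable lborel (\<lambda>y. E y * bump (y, s))"
      by (rule Bochner_Integration.integrable_bound[OF intK]) (rule AE_I2, rule order_trans[OF le], simp)
    then have "norm (LINT y|lborel. E y * bump (y, s)) \<le> (LINT y|lborel. K * indicator (cball (0::'a) 1) y)"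
      by (rule norm_integral_le[OF _ intK le])
    then show ?thesis by (simp add: a_eq)
  qed
  then show "\<exists>K. \<forall>s. \<bar>a s\<bar> \<le> K" by blast
  have a_outside: "a s = 0" if "1 \<le> \<bar>s\<bar>" for s
    using that by (simp add: a_eq bump_zero)
  define g where "g y s = E y * cosh (\<mu> * (r * s)) * bump (y, s)" for y s
  let ?f = "\<lambda>p::'a \<times> real. e k (x + r *\<^sub>R fst p) * cosh (\<mu> * (r * snd p)) * bump p"
  have f_eq: "?f p = (case p of (y, s) \<Rightarrow> g y s)" for p
  proof (cases p)
    case (Pair y s)
    then show ?thesis by (cases "norm y \<le> 1") (auto simp: g_def E_def bump_zero)
  qed
  have int_f: "integrable lborel ?f"
  proof (rule integrable_supported_cball)
    have "continuous_on (cball 0 1) (\<lambda>p::'a \<times> real. e k (x + r *\<^sub>R fst p))"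
    proof (rule continuous_on_compose2[OF continuous_on_e])
      show "(\<lambda>p. x + r *\<^sub>R fst p) ` cball (0::'a \<times> real) 1 \<subseteq> D"
      proof (rule image_subsetI)
        fix p :: "'a \<times> real" assume "p \<in> cball 0 1"
        then have "norm (fst p) \<le> 1" using norm_fst_le[of "fst p" "snd p"] by simp
        then show "x + r *\<^sub>R fst p \<in> D" by (rule in_D)
      qed
    qed (intro continuous_intros)
    then show "continuous_on (cball 0 1) ?f"
      by (intro continuous_on_mult continuous_on_cosh continuous_on_const continuous_on_snd continuous_on_id continuous_bump)
  qed (simp add: bump_outside)
  then have int_g: "integrable (lborel \<Otimes>\<^sub>M lborel) (\<lambda>(y, s). g y s)"
    unfolding f_eq by (simp only: lborel_prod)
  have "e k x * (LINT p|lborel. bump (p::'a \<times> real)) = (LINT p|lborel. ?f p)"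
    by (rule eigenfunction_mean[OF r sub \<mu>(1)])
  also have "\<dots> = (LINT p|(lborel \<Otimes>\<^sub>M lborel). (case p of (y, s) \<Rightarrow> g y s))"
    unfolding f_eq by (simp only: lborel_prod)
  also have "\<dots> = (LINT s|lborel. LINT y|lborel. g y s)"
    by (rule lborel_pair.integral_snd[OF int_g, symmetric])
  also have "\<dots> = (LINT s|lborel. cosh (\<mu> * (r * s)) * a s)"
  proof (rule Bochner_Integration.integral_cong[OF refl])
    fix s
    have "(LINT y|lborel. g y s) = (LINT y|lborel. cosh (\<mu> * (r * s)) * (E y * bump (y, s)))"
      by (simp add: g_def mult.commute mult.left_commute)
    then show "(LINT y|lborel. g y s) = cosh (\<mu> * (r * s)) * a s" by (simp add: a_eq)
  qed
  also have "\<dots> = (LINT s|lborel. indicator {-1..1} s *\<^sub>R (cosh (\<mu> * (r * s)) * a s))"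
  proof (rule Bochner_Integration.integral_cong[OF refl])
    show "cosh (\<mu> * (r * s)) * a s = indicator {-1..1} s *\<^sub>R (cosh (\<mu> * (r * s)) * a s)" for s
    proof (cases "s \<in> {-1..1}")
      case False
      then have "1 \<le> \<bar>s\<bar>" by auto
      then show ?thesis by (simp add: a_outside)
    qed simp
  qed
  also have "\<dots> = L2_inner {-1..1} (\<lambda>s. cosh (\<mu> * (r * s))) a"
    unfolding L2_inner_def by (rule integral_restrict_space[symmetric]) simp
  finally have eq: "e k x * (LINT p|lborel. bump (p::'a \<times> real)) = L2_inner {-1..1} (\<lambda>s. cosh (\<mu> * (r * s))) a" .
  have ch: "\<bar>cosh (\<mu> * (r * s))\<bar> \<le> cosh 1" if "s \<in> {-1..1}" for s
  proof -
    have "\<bar>\<mu> * (r * s)\<bar> = (\<mu> * r) * \<bar>s\<bar>" using \<mu> r by (simp add: abs_mult)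
    also have "\<dots> \<le> 1 * 1" using that \<mu>r \<mu> r by (intro mult_mono) auto
    finally have "cosh \<bar>\<mu> * (r * s)\<bar> \<le> cosh 1" by (subst cosh_real_nonneg_le_iff) auto
    then show ?thesis by (simp only: cosh_real_abs) simp
  qed
  have cosh_L2: "L2_fun {-1..1} (\<lambda>s. cosh (\<mu> * (r * s)))"
  proof (rule I.L2_fun_bounded[OF _ ch])
    have "(\<lambda>s. cosh (\<mu> * (r * s))) \<in> borel_measurable borel"
      by (intro borel_measurable_continuous_onI continuous_intros)
    then show "(\<lambda>s. cosh (\<mu> * (r * s))) \<in> borel_measurable (leb_on {-1..1})"
      by (intro measurable_restrict_space1) simp
  qed
  have a_L2: "L2_fun {-1..1} a"
    by (rule I.L2_fun_bounded[OF _ a_bound]) (use meas in \<open>auto intro!: measurable_restrict_space1\<close>)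
  have "(e k x * (LINT p|lborel. bump (p::'a \<times> real)))\<^sup>2 \<le> I.sqn (\<lambda>s. cosh (\<mu> * (r * s))) * I.sqn a"
    unfolding eq by (rule I.L2_Cauchy_Schwarz[OF cosh_L2 a_L2])
  also have "\<dots> \<le> (2 * (cosh 1)\<^sup>2) * I.sqn a"
  proof (rule mult_right_mono[OF _ I.sqn_nonneg])
    have "I.sqn (\<lambda>s. cosh (\<mu> * (r * s))) \<le> (LINT s|leb_on {-1..1::real}. (cosh 1)\<^sup>2)"
    proof (rule integral_mono)
      show "(cosh (\<mu> * (r * s)))\<^sup>2 \<le> (cosh 1)\<^sup>2" if "s \<in> space (leb_on {-1..1})" for s
        using power_mono[OF ch[of s], of 2] that by (simp add: I.space_leb_on)
    qed (use I.L2_fun_square[OF cosh_L2] in auto)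
    also have "\<dots> = 2 * (cosh 1)\<^sup>2"
      unfolding I.integral_const_leb using I.measure_leb_on[of "{-1..1}"] by (simp add: I.sets_leb_on)
    finally show "I.sqn (\<lambda>s. cosh (\<mu> * (r * s))) \<le> 2 * (cosh 1)\<^sup>2" .
  qed
  finally show "(e k x * (LINT p|lborel. bump (p::'a \<times> real)))\<^sup>2 \<le> 2 * (cosh 1)\<^sup>2 * I.sqn a" .
qed

text \<open>Up to the Jacobian r^d the slices are the Fourier coefficients of the one function
  \<open>g\<close>. Its squared norm is at most r^d times the volume of the unit ball, and dividing
  by the squared Jacobian leaves r^(-d).\<close>

lemma slice_Bessel:
  assumes r: "0 < r" and sub: "cball x r \<subseteq> D" and S: "finite S"
  shows "(\<Sum>k\<in>S. (LINT y|lborel. indicator (cball 0 1) y * e k (x + r *\<^sub>R y) * bump (y, s::real))\<^sup>2)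
    \<le> measure lborel (cball (0::'a) 1) / r ^ DIM('a)"
proof -
  define g where "g z = bump ((1 / r) *\<^sub>R (z - x), s)" for z
  have [measurable]: "g \<in> borel_measurable borel"
  proof -
    have "continuous_on UNIV (\<lambda>z. bump ((1 / r) *\<^sub>R (z - x), s))"
      by (rule continuous_on_compose2[OF continuous_bump(1)[of UNIV]]) (auto intro!: continuous_intros)
    then show ?thesis unfolding g_def[abs_def] by (rule borel_measurable_continuous_onI)
  qed
  have g_le: "0 \<le> g z" "g z \<le> 1" for z unfolding g_def by (rule bump_bounds)+
  have g_aff: "g (x + r *\<^sub>R y) = bump (y, s)" for y using r by (simp add: g_def)
  have bump_zero: "bump (y, s) = 0" if "1 \<le> norm y" for y :: 'a
    using that norm_fst_le[of y s] by (intro bump_outside) simp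
  have g_meas: "g \<in> borel_measurable (leb_on D)" by (intro measurable_restrict_space1) simp
  have g_L2: "L2_fun D g"
    by (rule L2_fun_bounded[OF g_meas, of 1]) (use g_le in auto)
  have D_int: "D \<inter> space lborel \<in> sets lborel" using D_borel by simp
  have in_D: "x + r *\<^sub>R y \<in> D" if "norm y \<le> 1" for y
  proof -
    have "x + r *\<^sub>R y \<in> cball x r" using that r by (simp add: dist_norm mult_left_le)
    then show ?thesis using sub by blast
  qed
  have inner: "L2_inner D g (e k)
      = r ^ DIM('a) * (LINT y|lborel. indicator (cball 0 1) y * e k (x + r *\<^sub>R y) * bump (y, s))" for k
  proof -
    have m: "(\<lambda>z. indicator D z *\<^sub>R (g z * e k z)) \<in> borel_measurable borel"
      using D_borel borel_measurable_continuous_on_indicator[OF D_borel continuous_on_e, of k]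
      by (simp add: mult.left_commute)
    have "L2_inner D g (e k) = (LINT z|lborel. indicator D z *\<^sub>R (g z * e k z))"
      unfolding L2_inner_def by (rule integral_restrict_space[OF D_int])
    also have "\<dots> = r ^ DIM('a) * (LINT y|lborel. indicator D (x + r *\<^sub>R y) *\<^sub>R (g (x + r *\<^sub>R y) * e k (x + r *\<^sub>R y)))"
      by (rule lborel_integral_affine[OF m r])
    also have "(\<lambda>y. indicator D (x + r *\<^sub>R y) *\<^sub>R (g (x + r *\<^sub>R y) * e k (x + r *\<^sub>R y)))
        = (\<lambda>y. indicator (cball 0 1) y * e k (x + r *\<^sub>R y) * bump (y, s))"
    proof
      fix y
      show "indicator D (x + r *\<^sub>R y) *\<^sub>R (g (x + r *\<^sub>R y) * e k (x + r *\<^sub>R y))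
          = indicator (cball 0 1) y * e k (x + r *\<^sub>R y) * bump (y, s)"
        unfolding g_aff using in_D[of y] by (cases "norm y \<le> 1") (auto simp: bump_zero)
    qed
    finally show ?thesis .
  qed
  have "sqn g = (LINT z|lborel. indicator D z *\<^sub>R (g z)\<^sup>2)"
    by (rule integral_restrict_space[OF D_int])
  also have "\<dots> = r ^ DIM('a) * (LINT y|lborel. indicator D (x + r *\<^sub>R y) *\<^sub>R (g (x + r *\<^sub>R y))\<^sup>2)"
    by (rule lborel_integral_affine[OF _ r]) (use D_borel in simp)
  also have "\<dots> \<le> r ^ DIM('a) * (LINT y|lborel. indicator (cball (0::'a) 1) y)"
  proof (rule mult_left_mono[OF integral_mono'])
    show "integrable lborel (indicator (cball (0::'a) 1) :: 'a \<Rightarrow> real)"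
      by (rule integrable_indicator_cball)
    fix y :: 'a
    show "indicator D (x + r *\<^sub>R y) *\<^sub>R (g (x + r *\<^sub>R y))\<^sup>2 \<le> indicator (cball 0 1) y"
    proof (cases "norm y \<le> 1")
      case True
      have "(g (x + r *\<^sub>R y))\<^sup>2 \<le> 1" using g_le[of "x + r *\<^sub>R y"] by (simp add: power_le_one)
      then show ?thesis using True by (simp add: indicator_def)
    qed (simp add: g_aff bump_zero)
  qed (use r in auto)
  finally have sqn_g: "sqn g \<le> r ^ DIM('a) * measure lborel (cball (0::'a) 1)" by simp
  have "(r ^ DIM('a))\<^sup>2 * (\<Sum>k\<in>S. (LINT y|lborel. indicator (cball 0 1) y * e k (x + r *\<^sub>R y) * bump (y, s))\<^sup>2)
      = (\<Sum>k\<in>S. (L2_inner D g (e k))\<^sup>2)"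
    by (simp add: inner sum_distrib_left power_mult_distrib)
  also have "\<dots> \<le> r ^ DIM('a) * measure lborel (cball (0::'a) 1)"
    using Bessel[OF g_L2 S] sqn_g by linarith
  finally show ?thesis
    using r by (simp add: power2_eq_square field_simps)
qed

text \<open>The sum over \<open>k\<close> is taken under the integral in \<open>s\<close>, where
  each slice obeys Bessel's inequality. In the constant, 4 is the 2 from Cauchy-Schwarz times the
  length of \<open>{-1..1}\<close>, and \<open>c\<close> normalises the weight; it depends on the
  dimension alone.\<close>

lemma local_spectral_bound:
  obtains C where "0 \<le> C"
    "\<And>x r S. 0 < r \<Longrightarrow> cball x r \<subseteq> D \<Longrightarrow> finite S \<Longrightarrow> (\<And>k. k \<in> S \<Longrightarrow> lam k * r\<^sup>2 \<le> 1) \<Longrightarrow>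
      (\<Sum>k\<in>S. (e k x)\<^sup>2) \<le> C / r ^ DIM('a)"
proof -
  interpret I: bounded_region "{-1..1::real}" by standard auto
  define c where "c = (LINT p|lborel. bump (p::'a \<times> real))"
  define V where "V = measure lborel (cball (0::'a) 1)"
  have c: "0 < c" unfolding c_def by (rule integral_bump_pos)
  show ?thesis
  proof (rule that[of "4 * (cosh 1)\<^sup>2 * V / c\<^sup>2"])
    show "0 \<le> 4 * (cosh 1)\<^sup>2 * V / c\<^sup>2" using c by (simp add: V_def)
    fix x r S
    assume r: "0 < r" and sub: "cball x r \<subseteq> D" and S: "finite S"
      and small: "\<And>k. k \<in> S \<Longrightarrow> lam k * r\<^sup>2 \<le> 1"
    define a where "a k s = (LINT y|lborel. indicator (cball 0 1) y * e k (x + r *\<^sub>R y) * bump (y, s::real))" for k s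
    have slices: "(\<lambda>s. a k s) \<in> borel_measurable borel" "\<exists>K. \<forall>s. \<bar>a k s\<bar> \<le> K"
      "(e k x * c)\<^sup>2 \<le> 2 * (cosh 1)\<^sup>2 * (LINT s|leb_on {-1..1}. (a k s)\<^sup>2)" if k: "k \<in> S" for k
      using eigenfunction_mean_slices[OF r sub small[OF k]] by (simp_all only: a_def c_def)
    have a_L2: "L2_fun {-1..1} (a k)" if k: "k \<in> S" for k
    proof -
      obtain K where K: "\<And>s. \<bar>a k s\<bar> \<le> K" using slices(2)[OF k] by blast
      have "a k \<in> borel_measurable (leb_on {-1..1})"
        using slices(1)[OF k] by (intro measurable_restrict_space1) simp
      then show ?thesis by (rule I.L2_fun_bounded) (rule K)
    qed
    have "c\<^sup>2 * (\<Sum>k\<in>S. (e k x)\<^sup>2) = (\<Sum>k\<in>S. (e k x * c)\<^sup>2)"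
      by (simp add: sum_distrib_left power_mult_distrib mult.commute)
    also have "\<dots> \<le> (\<Sum>k\<in>S. 2 * (cosh 1)\<^sup>2 * I.sqn (a k))"
      by (intro sum_mono slices(3))
    also have "\<dots> = 2 * (cosh 1)\<^sup>2 * (LINT s|leb_on {-1..1}. (\<Sum>k\<in>S. (a k s)\<^sup>2))"
      using I.L2_fun_square[OF a_L2] by (subst Bochner_Integration.integral_sum) (auto simp: sum_distrib_left)
    also have "\<dots> \<le> 2 * (cosh 1)\<^sup>2 * (LINT s|leb_on {-1..1::real}. V / r ^ DIM('a))"
    proof (rule mult_left_mono[OF integral_mono])
      show "integrable (leb_on {-1..1}) (\<lambda>s. \<Sum>k\<in>S. (a k s)\<^sup>2)"
        by (intro Bochner_Integration.integrable_sum I.L2_fun_square a_L2)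
      show "(\<Sum>k\<in>S. (a k s)\<^sup>2) \<le> V / r ^ DIM('a)" for s
        unfolding a_def V_def by (rule slice_Bessel[OF r sub S])
    qed auto
    also have "\<dots> = 4 * (cosh 1)\<^sup>2 * V / r ^ DIM('a)"
      unfolding I.integral_const_leb using I.measure_leb_on[of "{-1..1}"] by (simp add: I.sets_leb_on)
    finally have "c\<^sup>2 * (\<Sum>k\<in>S. (e k x)\<^sup>2) / c\<^sup>2 \<le> 4 * (cosh 1)\<^sup>2 * V / r ^ DIM('a) / c\<^sup>2"
      by (rule divide_right_mono) simp
    then show "(\<Sum>k\<in>S. (e k x)\<^sup>2) \<le> 4 * (cosh 1)\<^sup>2 * V / c\<^sup>2 / r ^ DIM('a)"
      using c by (simp add: mult.commute)
  qed
qed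

end

section \<open>The Green function\<close>

context dirichlet_region
begin

lemma spectral_sum_bound:
  assumes \<gamma>: "\<gamma> > real DIM('a) / 4" and R: "0 < R"
  obtains K where "0 \<le> K"
    "\<And>x n. cball x R \<subseteq> D \<Longrightarrow> (\<Sum>k<n. (lam k powr (-\<gamma>) * e k x)\<^sup>2) \<le> K"
proof -
  obtain C where C: "0 \<le> C"
    "\<And>x r S. 0 < r \<Longrightarrow> cball x r \<subseteq> D \<Longrightarrow> finite S \<Longrightarrow> (\<And>k. k \<in> S \<Longrightarrow> lam k * r\<^sup>2 \<le> 1) \<Longrightarrow>
      (\<Sum>k\<in>S. (e k x)\<^sup>2) \<le> C / r ^ DIM('a)"
    using local_spectral_bound by blast
  define d where "d = real DIM('a)"
  have "0 \<le> real DIM('a) / 4" by simp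
  with \<gamma> have \<gamma>_pos: "0 < \<gamma>" by linarith
  define r where "r j = R / 2 ^ j" for j :: nat
  have r_pos: "0 < r j" and r_le: "r j \<le> R" for j
    using R by (auto simp: r_def divide_le_eq)
  have r_lim: "r \<longlonglongrightarrow> 0" unfolding r_def using R by real_asymp
  have ex: "\<exists>j. lam k * (r j)\<^sup>2 \<le> 1" for k
  proof -
    have "(\<lambda>j. lam k * (r j)\<^sup>2) \<longlonglongrightarrow> lam k * 0\<^sup>2" by (intro tendsto_intros r_lim)
    then have "\<forall>\<^sub>F j in sequentially. lam k * (r j)\<^sup>2 < 1" by (rule order_tendstoD) simp
    from eventually_happens[OF this] show ?thesis by (auto intro: less_imp_le)
  qed
  \<comment> \<open>The dyadic scale of \<open>lam k\<close>. For \<open>J k > 0\<close> minimality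
    bounds \<open>lam k\<close> from below by \<open>1 / (2 * r (J k))\<^sup>2\<close>, since the
    radius one step earlier is twice as large.\<close>
  define J where "J k = (LEAST j. lam k * (r j)\<^sup>2 \<le> 1)" for k
  have J: "lam k * (r (J k))\<^sup>2 \<le> 1" for k unfolding J_def by (rule LeastI_ex[OF ex])
  have J_least: "1 < lam k * (r j)\<^sup>2" if "j < J k" for k j
    using not_less_Least[of j "\<lambda>j. lam k * (r j)\<^sup>2 \<le> 1"] that by (simp add: J_def)
  \<comment> \<open>Eigenvalues with \<open>J k = 0\<close> get no lower bound from minimality, and
    \<open>lam\<close> need not be ordered. The uniform lower bound \<open>m\<close> and the factor
    \<open>B\<close> take care of them.\<close>
  obtain N where N: "\<And>k. N \<le> k \<Longrightarrow> 1 \<le> lam k"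
    using lam_at_top unfolding filterlim_at_top eventually_sequentially by meson
  define m where "m = Min (insert 1 (lam ` {..<N}))"
  have m_pos: "0 < m" unfolding m_def using lam_pos by (subst Min_gr_iff) auto
  have m_le: "m \<le> lam k" for k
  proof (cases "k < N")
    case True
    then show ?thesis unfolding m_def by (intro Min_le) auto
  next
    case False
    then have "m \<le> 1" "1 \<le> lam k" using N[of k] unfolding m_def by (auto intro: Min_le)
    then show ?thesis by linarith
  qed
  define A where "A j = (2 * r j) powr (4 * \<gamma>)" for j
  have A_pos: "0 < A j" for j using r_pos[of j] by (simp add: A_def)
  define B where "B = max 1 (m powr (-2 * \<gamma>) / A 0)"
  have B: "1 \<le> B" by (simp add: B_def)
  have coeff: "(lam k powr (-\<gamma>))\<^sup>2 \<le> B * A (J k)" for k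
  proof -
    have sq: "(lam k powr (-\<gamma>))\<^sup>2 = lam k powr (-2 * \<gamma>)"
      by (simp add: power2_eq_square powr_add[symmetric])
    show ?thesis
    proof (cases "J k")
      case 0
      have "lam k powr (-2 * \<gamma>) \<le> m powr (-2 * \<gamma>)"
        using m_pos m_le[of k] \<gamma>_pos by (intro powr_mono2') auto
      also have "\<dots> = m powr (-2 * \<gamma>) / A 0 * A 0" using A_pos[of 0] by simp
      also have "\<dots> \<le> B * A 0" using A_pos[of 0] unfolding B_def by (intro mult_right_mono) auto
      finally show ?thesis using 0 sq by simp
    next
      case (Suc j)
      have r_eq: "r j = 2 * r (J k)" by (simp add: Suc r_def)
      have "1 < lam k * (r j)\<^sup>2" using Suc by (intro J_least) simp
      then have "1 / (2 * r (J k))\<^sup>2 \<le> lam k"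
        using r_pos[of "J k"] by (simp add: r_eq field_simps)
      moreover have "0 < 1 / (2 * r (J k))\<^sup>2" using r_pos[of "J k"] by simp
      ultimately have "lam k powr (-2 * \<gamma>) \<le> (1 / (2 * r (J k))\<^sup>2) powr (-2 * \<gamma>)"
        using \<gamma>_pos by (intro powr_mono2') auto
      also have "1 / (2 * r (J k))\<^sup>2 = (2 * r (J k)) powr (-2)"
        using r_pos[of "J k"] by (simp add: powr_minus_divide powr_numeral)
      also have "((2 * r (J k)) powr (-2)) powr (-2 * \<gamma>) = A (J k)"
        by (simp add: A_def powr_powr)
      also have "\<dots> \<le> B * A (J k)" using B A_pos[of "J k"] by simp
      finally show ?thesis using sq by simp
    qed
  qed
  \<comment> \<open>The ratio of the series over the dyadic scales: the squared coefficients decay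
    like \<open>r j powr (4 * \<gamma>)\<close> while the spectral bound grows like
    \<open>r j powr (- d)\<close>. It is below 1 exactly when \<gamma> > d/4.\<close>
  define \<theta> where "\<theta> = 2 powr (- (4 * \<gamma> - d))"
  have ex_pos: "0 < 4 * \<gamma> - d" using \<gamma> by (simp add: d_def)
  have \<theta>: "0 < \<theta>" "\<theta> < 1"
    unfolding \<theta>_def using ex_pos by (auto intro: powr_less_one)
  define P where "P = 2 powr (4 * \<gamma>) * R powr (4 * \<gamma> - d)"
  have P: "0 \<le> P" by (simp add: P_def)
  have A_r: "A j / r j ^ DIM('a) = P * \<theta> ^ j" for j
  proof -
    have "A j / r j ^ DIM('a) = 2 powr (4 * \<gamma>) * (r j powr (4 * \<gamma>) / r j powr d)"
      using r_pos[of j] by (simp add: A_def powr_mult d_def powr_realpow)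
    also have "r j powr (4 * \<gamma>) / r j powr d = r j powr (4 * \<gamma> - d)"
      by (simp add: powr_diff)
    also have "\<dots> = R powr (4 * \<gamma> - d) * (2 ^ j) powr (- (4 * \<gamma> - d))"
      using R by (simp only: r_def powr_divide powr_minus_divide) (simp add: powr_divide)
    also have "((2::real) ^ j) powr (- (4 * \<gamma> - d)) = \<theta> ^ j"
      by (simp add: \<theta>_def powr_realpow[symmetric] powr_powr mult.commute)
    finally show ?thesis by (simp add: P_def)
  qed
  show ?thesis
  proof (rule that[of "B * C * P / (1 - \<theta>)"])
    show "0 \<le> B * C * P / (1 - \<theta>)" using B C(1) P \<theta> by simp
    fix x n
    assume sub: "cball x R \<subseteq> D"
    have "(\<Sum>k<n. (lam k powr (-\<gamma>) * e k x)\<^sup>2)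
        = (\<Sum>j\<in>J ` {..<n}. \<Sum>k\<in>{k\<in>{..<n}. J k = j}. (lam k powr (-\<gamma>) * e k x)\<^sup>2)"
      by (rule sum.image_gen) simp
    also have "\<dots> \<le> (\<Sum>j\<in>J ` {..<n}. B * C * P * \<theta> ^ j)"
    proof (rule sum_mono)
      fix j assume "j \<in> J ` {..<n}"
      let ?S = "{k\<in>{..<n}. J k = j}"
      have "(\<Sum>k\<in>?S. (lam k powr (-\<gamma>) * e k x)\<^sup>2) \<le> (\<Sum>k\<in>?S. B * A j * (e k x)\<^sup>2)"
      proof (rule sum_mono)
        fix k assume "k \<in> ?S"
        then show "(lam k powr (-\<gamma>) * e k x)\<^sup>2 \<le> B * A j * (e k x)\<^sup>2"
          using coeff[of k] by (auto simp: power_mult_distrib intro: mult_right_mono)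
      qed
      also have "\<dots> = B * A j * (\<Sum>k\<in>?S. (e k x)\<^sup>2)" by (simp add: sum_distrib_left)
      also have "\<dots> \<le> B * A j * (C / r j ^ DIM('a))"
      proof (rule mult_left_mono)
        show "(\<Sum>k\<in>?S. (e k x)\<^sup>2) \<le> C / r j ^ DIM('a)"
        proof (rule C(2)[OF r_pos])
          show "cball x (r j) \<subseteq> D" using sub r_le[of j] by (meson subset_cball order_trans)
          show "lam k * (r j)\<^sup>2 \<le> 1" if "k \<in> ?S" for k using J[of k] that by auto
        qed simp
        show "0 \<le> B * A j" using B A_pos[of j] by simp
      qed
      also have "\<dots> = B * C * (A j / r j ^ DIM('a))" by simp
      also have "\<dots> = B * C * P * \<theta> ^ j" by (simp only: A_r mult.assoc)
      finally show "(\<Sum>k\<in>?S. (lam k powr (-\<gamma>) * e k x)\<^sup>2) \<le> B * C * P * \<theta> ^ j" .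
    qed
    also have "\<dots> = B * C * P * (\<Sum>j\<in>J ` {..<n}. \<theta> ^ j)" by (simp add: sum_distrib_left)
    also have "\<dots> \<le> B * C * P * (1 / (1 - \<theta>))"
    proof (rule mult_left_mono)
      have "(\<Sum>j\<in>J ` {..<n}. \<theta> ^ j) \<le> (\<Sum>j. \<theta> ^ j)"
        using \<theta> by (intro sum_le_suminf summable_geometric) auto
      then show "(\<Sum>j\<in>J ` {..<n}. \<theta> ^ j) \<le> 1 / (1 - \<theta>)"
        using \<theta> by (simp add: suminf_geometric)
      show "0 \<le> B * C * P" using B C(1) P by simp
    qed
    finally show "(\<Sum>k<n. (lam k powr (-\<gamma>) * e k x)\<^sup>2) \<le> B * C * P / (1 - \<theta>)" by simp
  qed
qed

end

section \<open>The Green function as an L2 limit of partial sums\<close>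

locale green_region = dirichlet_region D e lam
  for D :: "'a::euclidean_space set" and e lam +
  fixes \<gamma> :: real
  assumes \<gamma>: "\<gamma> > real DIM('a) / 4"
begin

definition coef :: "nat \<Rightarrow> real" where "coef k = lam k powr (-\<gamma>)"
abbreviation "G \<equiv> green D e lam \<gamma>"
definition Gsum :: "nat \<Rightarrow> 'a \<Rightarrow> 'a \<Rightarrow> real" where
  "Gsum n x y = (\<Sum>k<n. (coef k * e k x) * e k y)"
text \<open>For \<open>x\<close> in \<open>D\<close> this is, by orthonormality, the squared L2 norm
  of the Green series beyond \<open>n\<close>. Being measurable in \<open>x\<close>, it can be used
  to select truncation indices.\<close>

definition tail :: "nat \<Rightarrow> 'a \<Rightarrow> real" where
  "tail n x = (\<Sum>k. (coef k * e k x)\<^sup>2) - (\<Sum>k<n. (coef k * e k x)\<^sup>2)"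

lemma summable_coef_e:
  assumes "x \<in> D"
  shows "summable (\<lambda>k. (coef k * e k x)\<^sup>2)"
proof -
  obtain R where R: "0 < R" "cball x R \<subseteq> D"
    using D_open assms open_contains_cball by blast
  obtain K where "\<And>x n. cball x R \<subseteq> D \<Longrightarrow> (\<Sum>k<n. (lam k powr (-\<gamma>) * e k x)\<^sup>2) \<le> K"
    using spectral_sum_bound[OF \<gamma> R(1)] by blast
  then have "(\<Sum>k<n. (coef k * e k x)\<^sup>2) \<le> K" for n using R(2) by (simp add: coef_def)
  then show ?thesis by (intro summableI_nonneg_bounded) auto
qed

lemma sum_le_tail:
  assumes "x \<in> D" "n \<le> m"
  shows "(\<Sum>k\<in>{n..<m}. (coef k * e k x)\<^sup>2) \<le> tail n x"
proof -
  have "(\<Sum>k<n. (coef k * e k x)\<^sup>2) + (\<Sum>k\<in>{n..<m}. (coef k * e k x)\<^sup>2) = (\<Sum>k<m. (coef k * e k x)\<^sup>2)"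
    using assms(2) by (simp add: sum.atLeastLessThan_concat[of 0 n m, simplified] lessThan_atLeast0)
  also have "\<dots> \<le> (\<Sum>k. (coef k * e k x)\<^sup>2)"
    by (intro sum_le_suminf summable_coef_e assms) auto
  finally show ?thesis by (simp add: tail_def)
qed

lemma tail_tendsto: "x \<in> D \<Longrightarrow> (\<lambda>n. tail n x) \<longlonglongrightarrow> 0"
proof -
  assume "x \<in> D"
  from tendsto_diff[OF tendsto_const[of "\<Sum>k. (coef k * e k x)\<^sup>2"] summable_LIMSEQ[OF summable_coef_e[OF this]]]
  show ?thesis by (simp add: tail_def)
qed

lemma L2_fun_Gsum: "L2_fun D (Gsum n x)"
  unfolding Gsum_def[abs_def] by (intro L2_fun_sum L2_fun_e)

lemma Gsum_diff:
  assumes "n \<le> m"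
  shows "Gsum m x y - Gsum n x y = (\<Sum>k\<in>{n..<m}. (coef k * e k x) * e k y)"
  using assms sum.atLeastLessThan_concat[of 0 n m "\<lambda>k. coef k * e k x * e k y"]
  by (simp add: Gsum_def lessThan_atLeast0)

lemma sqn_Gsum_diff:
  assumes "x \<in> D" "n \<le> m"
  shows "sqn (\<lambda>y. Gsum m x y - Gsum n x y) \<le> tail n x"
  unfolding Gsum_diff[OF assms(2)] sqn_lincomb[OF finite_atLeastLessThan] by (rule sum_le_tail[OF assms])

text \<open>\<open>G x\<close> is an unspecified choice, so it is compared with the limit
  \<open>f\<close> supplied by completeness, from which its squared distance is 0. The comparison
  through \<open>sqn_diff_le\<close> costs the factor 2.\<close>

lemma green_spec:
  assumes x: "x \<in> D"
  shows "L2_fun D (G x)" "sqn (\<lambda>y. Gsum n x y - G x y) \<le> 2 * tail n x"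
proof -
  obtain f where f: "L2_fun D f" "\<And>n. sqn (\<lambda>y. f y - Gsum n x y) \<le> tail n x"
    using L2_complete[of "\<lambda>n. Gsum n x" "\<lambda>n. tail n x", OF L2_fun_Gsum tail_tendsto[OF x] sqn_Gsum_diff[OF x]]
    by blast
  have f_lim: "(\<lambda>n. sqn (\<lambda>y. Gsum n x y - f y)) \<longlonglongrightarrow> 0"
  proof (rule Lim_null_comparison[OF _ tail_tendsto[OF x]], rule always_eventually, rule allI)
    show "norm (sqn (\<lambda>y. Gsum n x y - f y)) \<le> tail n x" for n
      using f(2)[of n] sqn_nonneg by (simp add: power2_commute[of "f _"])
  qed
  then have "L2_fun D f \<and> L2_tendsto D (\<lambda>n y. \<Sum>k<n. lam k powr (- \<gamma>) * e k x * e k y) f"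
    using f(1) by (simp add: L2_tendsto_def Gsum_def coef_def)
  then have G: "L2_fun D (G x) \<and> L2_tendsto D (\<lambda>n y. \<Sum>k<n. lam k powr (- \<gamma>) * e k x * e k y) (G x)"
    unfolding green_def by (rule someI[of "\<lambda>g. L2_fun D g \<and> L2_tendsto D (\<lambda>n y. \<Sum>k<n. lam k powr - \<gamma> * e k x * e k y) g"])
  then show L2: "L2_fun D (G x)" by blast
  have G_lim: "(\<lambda>n. sqn (\<lambda>y. Gsum n x y - G x y)) \<longlonglongrightarrow> 0"
    using G by (simp add: L2_tendsto_def Gsum_def coef_def)
  have "sqn (\<lambda>y. G x y - f y) \<le> 0"
  proof (rule LIMSEQ_le_const)
    show "(\<lambda>n. 2 * sqn (\<lambda>y. Gsum n x y - G x y) + 2 * sqn (\<lambda>y. Gsum n x y - f y)) \<longlonglongrightarrow> 0"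
      by (intro tendsto_add_zero tendsto_mult_right_zero G_lim f_lim)
    have "sqn (\<lambda>y. G x y - f y) \<le> 2 * sqn (\<lambda>y. Gsum n x y - G x y) + 2 * sqn (\<lambda>y. Gsum n x y - f y)" for n
      using sqn_diff_le[OF L2 f(1) L2_fun_Gsum[of n x]] by (simp add: power2_commute[of "Gsum _ _ _"])
    then show "\<exists>N. \<forall>n\<ge>N. sqn (\<lambda>y. G x y - f y)
        \<le> 2 * sqn (\<lambda>y. Gsum n x y - G x y) + 2 * sqn (\<lambda>y. Gsum n x y - f y)" by blast
  qed
  then have "sqn (\<lambda>y. Gsum n x y - G x y) \<le> 2 * sqn (\<lambda>y. Gsum n x y - f y) + 2 * 0"
    using sqn_diff_le[OF L2_fun_Gsum[of n x] L2 f(1)] by linarith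
  then show "sqn (\<lambda>y. Gsum n x y - G x y) \<le> 2 * tail n x"
    using f(2)[of n] by (simp add: power2_commute[of "f _"])
qed

lemma green_tendsto: "x \<in> D \<Longrightarrow> (\<lambda>n. sqn (\<lambda>y. Gsum n x y - G x y)) \<longlonglongrightarrow> 0"
proof -
  assume x: "x \<in> D"
  show ?thesis
  proof (rule Lim_null_comparison[where g="\<lambda>n. 2 * tail n x"], rule always_eventually, rule allI)
    show "norm (sqn (\<lambda>y. Gsum n x y - G x y)) \<le> 2 * tail n x" for n
      using green_spec(2)[OF x, of n] sqn_nonneg by simp
    show "(\<lambda>n. 2 * tail n x) \<longlonglongrightarrow> 0" by (intro tendsto_mult_right_zero tail_tendsto x)
  qed
qed

end

section \<open>Mild solutions\<close>

locale levy_dirichlet_problem = green_region D e lam \<gamma> + levy_white_noise M D b \<sigma> \<nu> \<xi>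
  for M :: "'w measure" and D :: "'a::euclidean_space set" and e lam \<gamma> b \<sigma> \<nu> \<xi>
begin

definition X :: "nat \<Rightarrow> 'w \<Rightarrow> real" where "X k = NI (e k)"
text \<open>\<open>NI (Gsum n x)\<close> is chosen separately for each \<open>x\<close>, so nothing
  is known about its joint measurability; this sum is a jointly measurable version of it.\<close>

definition U :: "nat \<Rightarrow> 'a \<Rightarrow> 'w \<Rightarrow> real" where "U n x \<omega> = (\<Sum>k<n. (coef k * e k x) * X k \<omega>)"

lemma measurable_X [measurable]: "X k \<in> borel_measurable M"
  unfolding X_def by (rule measurable_noise_integral[OF L2_fun_e])

lemma L2_fun_U: "L2_fun D (\<lambda>x. U n x \<omega>)"
  unfolding U_def using L2_fun_sum[of "{..<n}" e "\<lambda>k. coef k * X k \<omega>"] L2_fun_e by (simp add: mult_ac)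

lemma measurable_U [measurable]: "U n x \<in> borel_measurable M"
  unfolding U_def[abs_def] by measurable

lemma sets_leb_eq: "sets (leb_on D) = sets (restrict_space borel D)"
  by (intro sets_restrict_space_cong) simp

lemma measurable_e [measurable]: "e k \<in> borel_measurable (restrict_space borel D)"
  using L2_fun_borel[OF L2_fun_e, of k] measurable_cong_sets[OF sets_leb_eq refl, of borel] by blast

lemma measurable_U_joint [measurable]:
  "(\<lambda>p. U n (snd p) (fst p)) \<in> borel_measurable (M \<Otimes>\<^sub>M restrict_space borel D)"
  unfolding U_def by measurable

lemma U_eq_noise_integral: "AE \<omega> in M. U n x \<omega> = NI (Gsum n x) \<omega>"
  using noise_integral_sum[of "{..<n}" e "\<lambda>k. coef k * e k x"] L2_fun_e
  unfolding U_def X_def Gsum_def[abs_def] by fastforce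

lemma prob_dist_U:
  assumes x: "x \<in> D"
  shows "prob_dist M (U n x) (NI (G x)) = prob_dist M (NI (\<lambda>y. Gsum n x y - G x y)) (\<lambda>_. 0)"
proof -
  have "prob_dist M (U n x) (NI (G x)) = prob_dist M (NI (Gsum n x)) (NI (G x))"
    by (rule prob_dist_cong_AE)
       (use measurable_noise_integral L2_fun_Gsum green_spec(1)[OF x] U_eq_noise_integral in auto)
  then show ?thesis by (simp only: noise_integral_prob_dist_diff[OF L2_fun_Gsum green_spec(1)[OF x]])
qed

lemma U_conv_in_prob:
  assumes x: "x \<in> D"
  shows "conv_in_prob M (\<lambda>n. U n x) (NI (G x))"
proof (rule conv_in_prob_cong_AE)
  show "conv_in_prob M (\<lambda>n. NI (Gsum n x)) (NI (G x))"
    by (intro noise_integral_L2_tendsto L2_fun_Gsum green_spec(1) green_tendsto x)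
  show "AE \<omega> in M. NI (Gsum n x) \<omega> = U n x \<omega>" for n
    using U_eq_noise_integral[of n x] by eventually_elim simp
qed (use measurable_noise_integral[OF green_spec(1)[OF x]] in auto)

lemma measurable_tail [measurable]: "tail n \<in> borel_measurable (restrict_space borel D)"
  unfolding tail_def[abs_def] by measurable

text \<open>A jointly measurable version: the truncation index is chosen measurably in \<open>x\<close> so that
  the truncated series converges almost surely for every \<open>x\<close>.\<close>

lemma mild_solution_exists: "\<exists>u. mild_solution M D G \<xi> u"
proof -
  have "\<forall>j::nat. \<exists>\<delta>. 0 < \<delta> \<and> (\<forall>f. L2_fun D f \<longrightarrow> sqn f \<le> \<delta> \<longrightarrow> prob_dist M (NI f) (\<lambda>_. 0) \<le> (1/2)^j)"
  proof
    fix j :: nat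
    have pos: "0 < (1/2::real)^j" by simp
    obtain \<delta> where "0 < \<delta>" "\<And>f. L2_fun D f \<Longrightarrow> sqn f \<le> \<delta> \<Longrightarrow> prob_dist M (NI f) (\<lambda>_. 0) \<le> (1/2)^j"
      using noise_integral_small[OF pos] by blast
    then show "\<exists>\<delta>. 0 < \<delta> \<and> (\<forall>f. L2_fun D f \<longrightarrow> sqn f \<le> \<delta> \<longrightarrow> prob_dist M (NI f) (\<lambda>_. 0) \<le> (1/2)^j)"
      by blast
  qed
  from choice[OF this] obtain \<delta> :: "nat \<Rightarrow> real" where \<delta>: "\<And>j. 0 < \<delta> j"
    "\<And>j f. L2_fun D f \<Longrightarrow> sqn f \<le> \<delta> j \<Longrightarrow> prob_dist M (NI f) (\<lambda>_. 0) \<le> (1/2)^j" by blast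
  \<comment> \<open>The least index is measurable in \<open>x\<close> because \<open>tail\<close>
    is. The factor 2 matches \<open>green_spec\<close>, and the summable rate (1/2)^j yields almost
    sure convergence at each \<open>x\<close>.\<close>
  define N where "N j x = (LEAST n. 2 * tail n x \<le> \<delta> j)" for j x
  have N: "2 * tail (N j x) x \<le> \<delta> j" if x: "x \<in> D" for j x
  proof -
    have "(\<lambda>n. 2 * tail n x) \<longlonglongrightarrow> 0" by (intro tendsto_mult_right_zero tail_tendsto x)
    then have "\<forall>\<^sub>F n in sequentially. 2 * tail n x < \<delta> j" by (rule order_tendstoD) (rule \<delta>)
    from eventually_happens[OF this] have "\<exists>n. 2 * tail n x \<le> \<delta> j" by (auto intro: less_imp_le)
    then show ?thesis unfolding N_def by (rule LeastI_ex)
  qed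
  have N_meas [measurable]: "N j \<in> measurable (restrict_space borel D) (count_space UNIV)" for j
    unfolding N_def by measurable
  define u where "u x \<omega> = lim (\<lambda>j. U (N j x) x \<omega>)" for x \<omega>
  have "(\<lambda>p. U (N j (snd p)) (snd p) (fst p)) \<in> borel_measurable (M \<Otimes>\<^sub>M restrict_space borel D)" for j
    by (rule measurable_compose_countable[where f="\<lambda>n p. U n (snd p) (fst p)" and g="\<lambda>p. N j (snd p)"])
       measurable
  then have joint: "(\<lambda>(\<omega>, x). u x \<omega>) \<in> borel_measurable (M \<Otimes>\<^sub>M restrict_space borel D)"
    unfolding u_def case_prod_unfold by (rule borel_measurable_lim_metric)
  have "AE \<omega> in M. u x \<omega> = NI (G x) \<omega>" if x: "x \<in> D" for x
  proof -
    have le: "prob_dist M (U (N j x) x) (NI (G x)) \<le> (1/2)^j" for j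
      unfolding prob_dist_U[OF x]
      using green_spec[OF x] N[OF x, of j] by (intro \<delta>(2) L2_fun_diff L2_fun_Gsum) (auto intro: order_trans)
    have "AE \<omega> in M. (\<lambda>j. U (N j x) x \<omega>) \<longlonglongrightarrow> NI (G x) \<omega>"
      by (rule AE_tendsto_of_summable_prob_dist[OF _ _ le])
         (use measurable_noise_integral[OF green_spec(1)[OF x]] in \<open>auto simp: summable_geometric\<close>)
    then show ?thesis by eventually_elim (simp add: u_def limI)
  qed
  then have "mild_solution M D G \<xi> u"
    unfolding mild_solution_def using joint noise_integrable_L2[OF green_spec(1)] by blast
  then show ?thesis by blast
qed

lemma mild_solution_unique:
  assumes "mild_solution M D G \<xi> u" "mild_solution M D G \<xi> v"
  shows "modification_of M D u v"
  unfolding modification_of_def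
proof
  fix x assume "x \<in> D"
  then have "AE \<omega> in M. u x \<omega> = NI (G x) \<omega>" "AE \<omega> in M. v x \<omega> = NI (G x) \<omega>"
    using assms unfolding mild_solution_def by blast+
  then show "AE \<omega> in M. u x \<omega> = v x \<omega>" by eventually_elim simp
qed

end

section \<open>Generalized solutions\<close>

context bounded_region
begin

lemma L2_fun_indicator:
  assumes "L2_fun D f" and "K \<in> sets borel"
  shows "L2_fun D (\<lambda>x. indicator K x * f x)"
proof -
  have [measurable]: "f \<in> borel_measurable (leb_on D)" using assms(1) by (rule L2_fun_borel)
  have [measurable]: "(indicator K :: 'a \<Rightarrow> real) \<in> borel_measurable (leb_on D)"
    using assms(2) by (intro measurable_restrict_space1) simp
  have meas: "(\<lambda>x. indicator K x * f x) \<in> borel_measurable (leb_on D)" by measurable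
  have "integrable (leb_on D) (\<lambda>x. (indicator K x * f x)\<^sup>2)"
  proof (rule Bochner_Integration.integrable_bound[OF L2_fun_square[OF assms(1)]])
    show "(\<lambda>x. (indicator K x * f x)\<^sup>2) \<in> borel_measurable (leb_on D)"
      by (intro borel_measurable_power meas)
  qed (auto simp: indicator_def)
  then show ?thesis using meas by (simp add: L2_fun_def)
qed

end

context levy_white_noise
begin

text \<open>Induction peels off one Gaussian factor at a time. Averaging turns it into
  \<open>iexp (g * NI (h N) \<omega>)\<close>, which linearity merges with
  \<open>iexp (NI f \<omega>)\<close>; so \<open>f\<close> must stay general. The term with \<eta>
  does not grow with \<open>N\<close>, and hence \<open>N\<close> may later tend to
  infinity.\<close>

lemma gaussian_sum_bound:
  fixes N :: nat
  assumes C: "\<And>v. cmod (\<Psi> v) \<le> \<eta> + C * v\<^sup>2" and C0: "0 \<le> C" "0 \<le> \<eta>"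
    and h: "\<And>i. L2_fun D (h i)" and f: "L2_fun D f"
  shows "cmod (1 - (CLINT \<omega>|M. of_real (exp (- (\<Sum>i<N. (NI (h i) \<omega>)\<^sup>2) / 2)) * iexp (NI f \<omega>)))
    \<le> \<eta> * vol + C * (sqn f + (\<Sum>i<N. sqn (h i)))"
  using f
proof (induction N arbitrary: f)
  case 0
  show ?case using noise_integral_char_bound[OF C C0 0, of 1] by simp
next
  case (Suc N)
  note f = \<open>L2_fun D f\<close>
  note [measurable] = measurable_noise_integral[OF h] measurable_noise_integral[OF f]
  let ?W = "\<lambda>\<omega>. complex_of_real (exp (- (\<Sum>i<N. (NI (h i) \<omega>)\<^sup>2) / 2))"
  let ?V = "\<lambda>\<omega>. ?W \<omega> * iexp (NI f \<omega>)"
  have W1: "cmod (?W \<omega>) \<le> 1" for \<omega>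
    by (simp only: norm_of_real) (simp add: sum_nonneg)
  have "cmod (1 - (CLINT \<omega>|M. ?V \<omega> * of_real (exp (- (NI (h N) \<omega>)\<^sup>2 / 2))))
      \<le> (\<eta> * vol + C * (sqn f + (\<Sum>i<N. sqn (h i)))) + C * sqn (h N)"
  \<comment> \<open>The cross term in the squared norm of \<open>f + g * h N\<close> is linear in
    \<open>g\<close> and drops out under the Gaussian average.\<close>
  proof (rule gaussian_average_bound[where \<beta>="2 * C * L2_inner D f (h N)"])
    show "cmod (?V \<omega>) \<le> 1" for \<omega> using W1[of \<omega>] by (simp add: norm_mult)
    fix g :: real
    have L2: "L2_fun D (\<lambda>x. f x + g * h N x)" by (intro L2_fun_linear f h)
    note [measurable] = measurable_noise_integral[OF L2]
    have "(CLINT \<omega>|M. ?V \<omega> * iexp (g * NI (h N) \<omega>)) = (CLINT \<omega>|M. ?W \<omega> * iexp (NI (\<lambda>x. f x + g * h N x) \<omega>))"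
    proof (rule integral_cong_AE)
      show "AE \<omega> in M. ?V \<omega> * iexp (g * NI (h N) \<omega>) = ?W \<omega> * iexp (NI (\<lambda>x. f x + g * h N x) \<omega>)"
        using noise_integral_linear[OF f h[of N], of g]
        by eventually_elim (simp add: distrib_left mult_exp_exp mult.assoc)
    qed measurable
    then have "cmod (1 - (CLINT \<omega>|M. ?V \<omega> * iexp (g * NI (h N) \<omega>)))
        \<le> \<eta> * vol + C * (sqn (\<lambda>x. f x + g * h N x) + (\<Sum>i<N. sqn (h i)))"
      using Suc.IH[OF L2] by simp
    also have "\<dots> = \<eta> * vol + C * (sqn f + (\<Sum>i<N. sqn (h i))) + 2 * C * L2_inner D f (h N) * g
        + C * sqn (h N) * g\<^sup>2"
      unfolding sqn_linear[OF f h] by (simp add: algebra_simps)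
    finally show "cmod (1 - (CLINT \<omega>|M. ?V \<omega> * iexp (g * NI (h N) \<omega>)))
        \<le> \<eta> * vol + C * (sqn f + (\<Sum>i<N. sqn (h i))) + 2 * C * L2_inner D f (h N) * g
        + C * sqn (h N) * g\<^sup>2" .
  qed measurable
  moreover have "?V \<omega> * of_real (exp (- (NI (h N) \<omega>)\<^sup>2 / 2))
      = of_real (exp (- (\<Sum>i<Suc N. (NI (h i) \<omega>)\<^sup>2) / 2)) * iexp (NI f \<omega>)" for \<omega>
  proof -
    have "exp (- (\<Sum>i<Suc N. (NI (h i) \<omega>)\<^sup>2) / 2)
        = exp (- (\<Sum>i<N. (NI (h i) \<omega>)\<^sup>2) / 2) * exp (- (NI (h N) \<omega>)\<^sup>2 / 2)"
      by (simp add: exp_add[symmetric] add_divide_distrib diff_divide_distrib)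
    then show ?thesis by (simp only: of_real_mult mult.commute mult.left_commute)
  qed
  ultimately show ?case by (simp add: algebra_simps)
qed

end

section \<open>Local square integrability of the random series, and the pairing with test
  functions\<close>

context levy_dirichlet_problem
begin

lemma block_eq:
  assumes "n \<le> m"
  shows "indicator K x * (U m x \<omega> - U n x \<omega>)
    = (\<Sum>k\<in>{n..<m}. (coef k * X k \<omega>) * (indicator K x * e k x))"
proof -
  have "U m x \<omega> - U n x \<omega> = (\<Sum>k\<in>{n..<m}. (coef k * e k x) * X k \<omega>)"
    using assms sum.atLeastLessThan_concat[of 0 n m "\<lambda>k. coef k * e k x * X k \<omega>"]
    by (simp add: U_def lessThan_atLeast0)
  then show ?thesis by (simp add: sum_distrib_left mult_ac)
qed

text \<open>A Cauchy estimate for \<open>U\<close> in L2 over \<open>K\<close>; the squared norm is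
  truncated since it may have no mean. The right side becomes uniform in \<open>m\<close> once the
  local masses of the eigenfunctions are summable.\<close>

lemma block_bound:
  assumes C: "\<And>v. cmod (\<Psi> v) \<le> \<eta> + C * v\<^sup>2" and C0: "0 \<le> C" "0 \<le> \<eta>"
    and K: "K \<in> sets borel" and nm: "n \<le> m"
  shows "(\<lambda>\<omega>. sqn (\<lambda>x. indicator K x * (U m x \<omega> - U n x \<omega>))) \<in> borel_measurable M"
    and "(LINT \<omega>|M. min 1 (sqn (\<lambda>x. indicator K x * (U m x \<omega> - U n x \<omega>))))
      \<le> 3 * (\<eta> * vol + C * (\<Sum>k\<in>{n..<m}. (coef k)\<^sup>2 * sqn (\<lambda>x. indicator K x * e k x)))"
proof -
  let ?T = "{n..<m}"
  define w where "w k x = indicator K x * e k x" for k x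
  have w: "L2_fun D (w k)" for k unfolding w_def[abs_def] by (intro L2_fun_indicator L2_fun_e K)
  define a where "a i k = L2_inner D (w k) (e i)" for i k
  define P where "P \<omega> x = (\<Sum>k\<in>?T. (coef k * X k \<omega>) * w k x)" for \<omega> x
  have P_eq: "indicator K x * (U m x \<omega> - U n x \<omega>) = P \<omega> x" for \<omega> x
    by (simp only: block_eq[OF nm] P_def w_def)
  have P: "L2_fun D (P \<omega>)" for \<omega> unfolding P_def[abs_def] by (intro L2_fun_sum w)
  define Z where "Z i \<omega> = L2_inner D (P \<omega>) (e i)" for i \<omega>
  have Z_eq: "Z i \<omega> = (\<Sum>k\<in>?T. (coef k * X k \<omega>) * a i k)" for i \<omega>
    unfolding Z_def P_def[abs_def] a_def by (intro L2_inner_sum w L2_fun_e)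
  have [measurable]: "Z i \<in> borel_measurable M" for i unfolding Z_eq[abs_def] by measurable
  \<comment> \<open>The coefficient \<open>Z i\<close> is linear in the variables
    \<open>X k\<close>, hence almost surely the noise integral of this deterministic
    function.\<close>
  define h where "h i x = (\<Sum>k\<in>?T. (coef k * a i k) * e k x)" for i x
  have h: "L2_fun D (h i)" for i unfolding h_def[abs_def] by (intro L2_fun_sum L2_fun_e)
  have NI_h: "AE \<omega> in M. NI (h i) \<omega> = Z i \<omega>" for i
    using noise_integral_sum[of ?T e "\<lambda>k. coef k * a i k", OF finite_atLeastLessThan L2_fun_e]
    unfolding h_def[abs_def] Z_eq X_def by (simp add: mult_ac)
  note [measurable] = measurable_noise_integral[OF h] measurable_noise_integral[OF L2_fun_zero]
  define B where "B = \<eta> * vol + C * (\<Sum>k\<in>?T. (coef k)\<^sup>2 * sqn (w k))"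
  \<comment> \<open>Exchanging the sums puts Bessel's inequality to work in the index
    \<open>i\<close>, once for each cut-off eigenfunction \<open>w k\<close>.\<close>
  have sum_h: "(\<Sum>i<N. sqn (h i)) \<le> (\<Sum>k\<in>?T. (coef k)\<^sup>2 * sqn (w k))" for N
  proof -
    have "(\<Sum>i<N. sqn (h i)) = (\<Sum>i<N. \<Sum>k\<in>?T. (coef k)\<^sup>2 * (a i k)\<^sup>2)"
      unfolding h_def[abs_def] by (simp add: sqn_lincomb power_mult_distrib)
    also have "\<dots> = (\<Sum>k\<in>?T. (coef k)\<^sup>2 * (\<Sum>i<N. (a i k)\<^sup>2))"
      by (subst sum.swap) (simp add: sum_distrib_left)
    also have "\<dots> \<le> (\<Sum>k\<in>?T. (coef k)\<^sup>2 * sqn (w k))"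
      unfolding a_def by (intro sum_mono mult_left_mono Bessel w) auto
    finally show ?thesis .
  qed
  have finite_bound: "1 - (LINT \<omega>|M. exp (- (\<Sum>i<N. (Z i \<omega>)\<^sup>2) / 2)) \<le> B" for N
  proof -
    let ?F = "\<lambda>\<omega>. of_real (exp (- (\<Sum>i<N. (NI (h i) \<omega>)\<^sup>2) / 2)) * iexp (NI (\<lambda>_. 0) \<omega>)"
    have "AE \<omega> in M. \<forall>i\<in>{..<N}. NI (h i) \<omega> = Z i \<omega>"
      by (rule AE_finite_allI) (auto intro: NI_h)
    with noise_integral_zero have "AE \<omega> in M. ?F \<omega> = of_real (exp (- (\<Sum>i<N. (Z i \<omega>)\<^sup>2) / 2))"
    proof eventually_elim
      case (elim \<omega>)
      then have "(\<Sum>i<N. (NI (h i) \<omega>)\<^sup>2) = (\<Sum>i<N. (Z i \<omega>)\<^sup>2)" by (intro sum.cong) auto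
      then show ?case using elim(1) by simp
    qed
    then have "(CLINT \<omega>|M. ?F \<omega>) = (CLINT \<omega>|M. of_real (exp (- (\<Sum>i<N. (Z i \<omega>)\<^sup>2) / 2)))"
      by (intro integral_cong_AE) measurable
    also have "\<dots> = of_real (LINT \<omega>|M. exp (- (\<Sum>i<N. (Z i \<omega>)\<^sup>2) / 2))"
      by (rule integral_complex_of_real)
    finally have eq: "1 - (CLINT \<omega>|M. ?F \<omega>) = of_real (1 - (LINT \<omega>|M. exp (- (\<Sum>i<N. (Z i \<omega>)\<^sup>2) / 2)))"
      by (simp only: of_real_diff of_real_1)
    have "1 - (LINT \<omega>|M. exp (- (\<Sum>i<N. (Z i \<omega>)\<^sup>2) / 2)) \<le> cmod (1 - (CLINT \<omega>|M. ?F \<omega>))"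
      unfolding eq norm_of_real by (rule abs_ge_self)
    also have "\<dots> \<le> \<eta> * vol + C * (sqn (\<lambda>_. 0) + (\<Sum>i<N. sqn (h i)))"
      by (rule gaussian_sum_bound[OF C C0 h L2_fun_zero])
    also have "\<dots> \<le> B"
      unfolding B_def using C0 sum_h[of N] by (simp add: mult_left_mono)
    finally show ?thesis .
  qed
  have lim: "(\<lambda>N. \<Sum>i<N. (Z i \<omega>)\<^sup>2) \<longlonglongrightarrow> sqn (P \<omega>)" for \<omega>
    unfolding Z_def by (rule Parseval[OF P])
  have sqn_meas [measurable]: "(\<lambda>\<omega>. sqn (P \<omega>)) \<in> borel_measurable M"
    by (rule borel_measurable_LIMSEQ_real[where u="\<lambda>N \<omega>. \<Sum>i<N. (Z i \<omega>)\<^sup>2"]) (use lim in auto)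
  then show "(\<lambda>\<omega>. sqn (\<lambda>x. indicator K x * (U m x \<omega> - U n x \<omega>))) \<in> borel_measurable M"
    by (simp only: P_eq)
  have int: "integrable M (\<lambda>\<omega>. exp (- sqn (P \<omega>) / 2))"
    by (rule integrable_const_bound[where B=1]) (auto simp: sqn_nonneg)
  have "(\<lambda>N. LINT \<omega>|M. exp (- (\<Sum>i<N. (Z i \<omega>)\<^sup>2) / 2)) \<longlonglongrightarrow> (LINT \<omega>|M. exp (- sqn (P \<omega>) / 2))"
  proof (rule integral_dominated_convergence[where w="\<lambda>_. 1"])
    show "AE \<omega> in M. (\<lambda>N. exp (- (\<Sum>i<N. (Z i \<omega>)\<^sup>2) / 2)) \<longlonglongrightarrow> exp (- sqn (P \<omega>) / 2)"
      by (intro AE_I2 tendsto_intros lim) simp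
    show "AE \<omega> in M. norm (exp (- (\<Sum>i<N. (Z i \<omega>)\<^sup>2) / 2)) \<le> 1" for N
      by (intro AE_I2) (simp add: sum_nonneg)
  qed auto
  from tendsto_diff[OF tendsto_const this, of 1]
  have "1 - (LINT \<omega>|M. exp (- sqn (P \<omega>) / 2)) \<le> B"
    by (rule LIMSEQ_le_const2) (use finite_bound in blast)
  have "(LINT \<omega>|M. min 1 (sqn (P \<omega>))) \<le> (LINT \<omega>|M. 3 * (1 - exp (- sqn (P \<omega>) / 2)))"
  proof (rule integral_mono)
    show "integrable M (\<lambda>\<omega>. min 1 (sqn (P \<omega>)))"
      by (rule integrable_const_bound[where B=1]) (auto simp: sqn_nonneg)
    show "integrable M (\<lambda>\<omega>. 3 * (1 - exp (- sqn (P \<omega>) / 2)))"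
      by (intro integrable_mult_right Bochner_Integration.integrable_diff int) simp
    show "min 1 (sqn (P \<omega>)) \<le> 3 * (1 - exp (- sqn (P \<omega>) / 2))" for \<omega>
      by (rule min_one_le_exp[OF sqn_nonneg])
  qed
  also have "\<dots> = 3 * (1 - (LINT \<omega>|M. exp (- sqn (P \<omega>) / 2)))"
    using int by (simp add: prob_space)
  also have "\<dots> \<le> 3 * B"
    by (rule mult_left_mono) (fact, simp)
  finally show "(LINT \<omega>|M. min 1 (sqn (\<lambda>x. indicator K x * (U m x \<omega> - U n x \<omega>))))
      \<le> 3 * (\<eta> * vol + C * (\<Sum>k\<in>{n..<m}. (coef k)\<^sup>2 * sqn (\<lambda>x. indicator K x * e k x)))"
    by (simp only: P_eq B_def w_def)
qed

text \<open>Compactness provides one radius \<open>R\<close> for all centres in \<open>K\<close>, so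
  \<open>spectral_sum_bound\<close> is uniform there and can be integrated.\<close>

lemma summable_local_mass:
  assumes K: "compact K" "K \<subseteq> D"
  shows "summable (\<lambda>k. (coef k)\<^sup>2 * sqn (\<lambda>x. indicator K x * e k x))"
proof -
  have Kb: "K \<in> sets borel" using K(1) by (simp add: borel_compact)
  obtain R where R: "0 < R" "(\<Union>x\<in>K. cball x R) \<subseteq> D"
    using compact_subset_open_imp_cball_epsilon_subset[OF K(1) D_open K(2)] by blast
  obtain B where B: "0 \<le> B" "\<And>x n. cball x R \<subseteq> D \<Longrightarrow> (\<Sum>k<n. (lam k powr (-\<gamma>) * e k x)\<^sup>2) \<le> B"
    using spectral_sum_bound[OF \<gamma> R(1)] by blast
  have L2: "L2_fun D (\<lambda>x. indicator K x * e k x)" for k by (intro L2_fun_indicator L2_fun_e Kb)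
  have "(\<Sum>k<n. (coef k)\<^sup>2 * sqn (\<lambda>x. indicator K x * e k x)) \<le> B * vol" for n
  proof -
    have "(\<Sum>k<n. (coef k)\<^sup>2 * sqn (\<lambda>x. indicator K x * e k x))
        = (LINT x|leb_on D. (\<Sum>k<n. (coef k)\<^sup>2 * (indicator K x * e k x)\<^sup>2))"
      using L2_fun_square[OF L2] by (subst Bochner_Integration.integral_sum) auto
    also have "\<dots> \<le> (LINT x|leb_on D. B)"
    proof (rule integral_mono)
      show "integrable (leb_on D) (\<lambda>x. \<Sum>k<n. (coef k)\<^sup>2 * (indicator K x * e k x)\<^sup>2)"
        by (intro Bochner_Integration.integrable_sum integrable_mult_right L2_fun_square L2)
      fix x
      show "(\<Sum>k<n. (coef k)\<^sup>2 * (indicator K x * e k x)\<^sup>2) \<le> B"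
      proof (cases "x \<in> K")
        case True
        then have "cball x R \<subseteq> D" using R(2) by blast
        from B(2)[OF this, of n] show ?thesis using True by (simp add: coef_def power_mult_distrib)
      qed (use B(1) in simp)
    qed simp
    finally show ?thesis by (simp only: integral_const_leb)
  qed
  then show ?thesis by (intro summableI_nonneg_bounded) (auto simp: sqn_nonneg)
qed

lemma measurable_solution_slice:
  assumes u: "(\<lambda>(\<omega>, x). u x \<omega>) \<in> borel_measurable (M \<Otimes>\<^sub>M restrict_space borel D)"
  shows "(\<lambda>p. u (snd p) (fst p)) \<in> borel_measurable (M \<Otimes>\<^sub>M leb_on D)"
    and "\<omega> \<in> space M \<Longrightarrow> (\<lambda>x. u x \<omega>) \<in> borel_measurable (leb_on D)"
    and "x \<in> D \<Longrightarrow> u x \<in> borel_measurable M"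
proof -
  have eq: "sets (M \<Otimes>\<^sub>M restrict_space borel D) = sets (M \<Otimes>\<^sub>M leb_on D)"
    by (intro sets_pair_measure_cong refl sets_leb_eq[symmetric])
  from u show 1: "(\<lambda>p. u (snd p) (fst p)) \<in> borel_measurable (M \<Otimes>\<^sub>M leb_on D)"
    unfolding measurable_cong_sets[OF eq refl]
    by (simp add: case_prod_unfold)
  show "\<omega> \<in> space M \<Longrightarrow> (\<lambda>x. u x \<omega>) \<in> borel_measurable (leb_on D)"
    using measurable_compose[OF measurable_Pair1' 1] by simp
  show "x \<in> D \<Longrightarrow> u x \<in> borel_measurable M"
    using measurable_compose[OF measurable_Pair2' 1] by (simp add: space_leb_on)
qed

text \<open>Convergence in probability at each \<open>x\<close> becomes, by dominated convergence in
  \<open>x\<close>, L1 convergence of the truncated difference on the product space, so a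
  subsequence converges almost everywhere there. It lets Fatou's lemma see \<open>u\<close> as a
  pointwise limit.\<close>

lemma partial_sums_AE_subseq:
  assumes u: "mild_solution M D G \<xi> u"
  obtains r where "strict_mono r" "AE \<omega> in M. AE x in leb_on D. (\<lambda>j. U (r j) x \<omega>) \<longlonglongrightarrow> u x \<omega>"
proof -
  interpret prod: pair_sigma_finite M "leb_on D" ..
  interpret P: finite_measure "M \<Otimes>\<^sub>M leb_on D"
    by (rule finite_measure_pair_measure) unfold_locales
  have joint: "(\<lambda>(\<omega>, x). u x \<omega>) \<in> borel_measurable (M \<Otimes>\<^sub>M restrict_space borel D)"
    using u by (simp add: mild_solution_def)
  note u_meas = measurable_solution_slice[OF joint]
  have "(\<lambda>(\<omega>, x). U n x \<omega>) \<in> borel_measurable (M \<Otimes>\<^sub>M restrict_space borel D)" for n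
    using measurable_U_joint[of n] by (simp add: case_prod_unfold)
  note U_meas = measurable_solution_slice[OF this]
  note [measurable] = u_meas(1) U_meas(1)
  let ?f = "\<lambda>n p. min 1 \<bar>U n (snd p) (fst p) - u (snd p) (fst p)\<bar>"
  have int: "integrable (M \<Otimes>\<^sub>M leb_on D) (?f n)" for n
    by (rule P.integrable_const_bound[where B=1]) auto
  have eq: "(LINT p|(M \<Otimes>\<^sub>M leb_on D). norm (?f n p)) = (LINT x|leb_on D. prob_dist M (U n x) (u x))" for n
    using prod.integral_snd[of "\<lambda>\<omega> x. ?f n (\<omega>, x)"] int[of n] by (simp add: prob_dist_def case_prod_unfold)
  have meas: "(\<lambda>x. prob_dist M (U n x) (u x)) \<in> borel_measurable (leb_on D)" for n
  proof -
    have "(\<lambda>p. (snd p, fst p)) \<in> measurable (leb_on D \<Otimes>\<^sub>M M) (M \<Otimes>\<^sub>M leb_on D)" by measurable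
    from measurable_compose[OF this borel_measurable_integrable[OF int[of n]]]
    have "(\<lambda>(x, \<omega>). min 1 \<bar>U n x \<omega> - u x \<omega>\<bar>) \<in> borel_measurable (leb_on D \<Otimes>\<^sub>M M)"
      by (simp add: case_prod_unfold)
    then show ?thesis unfolding prob_dist_def by (rule borel_measurable_lebesgue_integral)
  qed
  have "(\<lambda>n. LINT x|leb_on D. prob_dist M (U n x) (u x)) \<longlonglongrightarrow> (LINT x|leb_on D. 0)"
  proof (rule integral_dominated_convergence[where w="\<lambda>_. 1"])
    show "AE x in leb_on D. (\<lambda>n. prob_dist M (U n x) (u x)) \<longlonglongrightarrow> 0"
    proof (intro AE_I2)
      fix x assume "x \<in> space (leb_on D)"
      then have x: "x \<in> D" by (simp add: space_leb_on)
      have "AE \<omega> in M. NI (G x) \<omega> = u x \<omega>"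
        using u x unfolding mild_solution_def by (auto elim: eventually_mono)
      then have "conv_in_prob M (\<lambda>n. U n x) (u x)"
        by (intro conv_in_prob_cong_AE[OF U_conv_in_prob[OF x]]) (use u_meas(3)[OF x] in auto)
      then show "(\<lambda>n. prob_dist M (U n x) (u x)) \<longlonglongrightarrow> 0" by (simp add: conv_in_prob_iff)
    qed
    show "AE x in leb_on D. norm (prob_dist M (U n x) (u x)) \<le> 1" for n
    proof (intro AE_I2)
      fix x assume "x \<in> space (leb_on D)"
      then have x: "x \<in> D" by (simp add: space_leb_on)
      have "prob_dist M (U n x) (u x) \<le> (LINT \<omega>|M. 1)"
        unfolding prob_dist_def using u_meas(3)[OF x] U_meas(3)[OF x]
        by (intro integral_mono integrable_min_one) auto
      then show "norm (prob_dist M (U n x) (u x)) \<le> 1"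
        using prob_dist_nonneg[of "U n x" "u x"] by (simp add: prob_space)
    qed
  qed (use meas in auto)
  then have "(\<lambda>n. LINT p|(M \<Otimes>\<^sub>M leb_on D). norm (?f n p)) \<longlonglongrightarrow> 0" by (simp only: eq) simp
  from tendsto_L1_AE_subseq[OF int this]
  obtain r where r: "strict_mono r" "AE p in M \<Otimes>\<^sub>M leb_on D. (\<lambda>j. ?f (r j) p) \<longlonglongrightarrow> 0" by blast
  show ?thesis
  proof (rule that[OF r(1)])
    have "AE \<omega> in M. AE x in leb_on D. (\<lambda>j. ?f (r j) (\<omega>, x)) \<longlonglongrightarrow> 0"
      by (rule prod.AE_pair[OF r(2)])
    then show "AE \<omega> in M. AE x in leb_on D. (\<lambda>j. U (r j) x \<omega>) \<longlonglongrightarrow> u x \<omega>"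
    proof eventually_elim
      case (elim \<omega>)
      then show ?case
      proof eventually_elim
        case (elim x)
        then have lim: "(\<lambda>j. min 1 \<bar>U (r j) x \<omega> - u x \<omega>\<bar>) \<longlonglongrightarrow> 0" by simp
        then have "\<forall>\<^sub>F j in sequentially. min 1 \<bar>U (r j) x \<omega> - u x \<omega>\<bar> < 1"
          by (rule order_tendstoD) simp
        then have "\<forall>\<^sub>F j in sequentially. min 1 \<bar>U (r j) x \<omega> - u x \<omega>\<bar> = \<bar>U (r j) x \<omega> - u x \<omega>\<bar>"
          by eventually_elim (simp add: min_def split: if_splits)
        from Lim_transform_eventually[OF lim this] show ?case
          by (simp add: LIM_zero_iff tendsto_rabs_zero_iff)
      qed
    qed
  qed
qed

text \<open>Extended values, because square integrability of \<open>u\<close> over \<open>K\<close>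
  is not known beforehand: it is deduced from the smallness of this quantity.\<close>

definition defect :: "'a set \<Rightarrow> ('a \<Rightarrow> 'w \<Rightarrow> real) \<Rightarrow> nat \<Rightarrow> 'w \<Rightarrow> ennreal" where
  "defect K u n \<omega> = (\<integral>\<^sup>+x. ennreal ((indicator K x * (u x \<omega> - U n x \<omega>))\<^sup>2) \<partial>leb_on D)"

lemma measurable_defect:
  assumes u: "(\<lambda>(\<omega>, x). u x \<omega>) \<in> borel_measurable (M \<Otimes>\<^sub>M restrict_space borel D)"
    and K: "K \<in> sets borel"
  shows "defect K u n \<in> borel_measurable M"
proof -
  have [measurable]: "(\<lambda>p. U n (snd p) (fst p)) \<in> borel_measurable (M \<Otimes>\<^sub>M leb_on D)"
    using measurable_solution_slice(1)[of "U n"] measurable_U_joint[of n] by (simp add: case_prod_unfold)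
  note [measurable] = measurable_solution_slice(1)[OF u]
  have [measurable]: "(indicator K :: 'a \<Rightarrow> real) \<in> borel_measurable (leb_on D)"
    using K by (intro measurable_restrict_space1) simp
  have "(\<lambda>p. ennreal ((indicator K (snd p) * (u (snd p) (fst p) - U n (snd p) (fst p)))\<^sup>2))
      \<in> borel_measurable (M \<Otimes>\<^sub>M leb_on D)"
    by measurable
  then have "(\<lambda>(\<omega>, x). ennreal ((indicator K x * (u x \<omega> - U n x \<omega>))\<^sup>2)) \<in> borel_measurable (M \<Otimes>\<^sub>M leb_on D)"
    by (simp add: case_prod_unfold)
  then show ?thesis
    unfolding defect_def[abs_def] by (rule leb.borel_measurable_nn_integral)
qed

text \<open>Fatou's lemma is used twice, in \<open>x\<close> for fixed \<omega> and then in
  \<omega>, on the blocks from \<open>n\<close> to \<open>r j\<close>, whose bounds do not depend on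
  \<open>j\<close>.\<close>

lemma defect_small:
  assumes u: "mild_solution M D G \<xi> u" and K: "compact K" "K \<subseteq> D" and \<epsilon>: "0 < \<epsilon>"
  shows "\<forall>\<^sub>F n in sequentially. (\<integral>\<^sup>+\<omega>. min 1 (defect K u n \<omega>) \<partial>M) \<le> ennreal \<epsilon>"
proof -
  have Kb: "K \<in> sets borel" using K(1) by (simp add: borel_compact)
  have joint: "(\<lambda>(\<omega>, x). u x \<omega>) \<in> borel_measurable (M \<Otimes>\<^sub>M restrict_space borel D)"
    using u by (simp add: mild_solution_def)
  obtain r where r: "strict_mono r" "AE \<omega> in M. AE x in leb_on D. (\<lambda>j. U (r j) x \<omega>) \<longlonglongrightarrow> u x \<omega>"
    using partial_sums_AE_subseq[OF u] by blast
  define s where "s k = (coef k)\<^sup>2 * sqn (\<lambda>x. indicator K x * e k x)" for k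
  have s: "summable s" "0 \<le> s k" for k
    unfolding s_def using summable_local_mass[OF K] by (auto simp: sqn_nonneg)
  define V where "V = vol + 1"
  have V: "0 < V" "vol \<le> V" unfolding V_def by (auto intro: add_nonneg_pos)
  define \<eta> where "\<eta> = \<epsilon> / (6 * V)"
  have \<eta>: "0 < \<eta>" unfolding \<eta>_def using \<epsilon> V by (intro divide_pos_pos) auto
  obtain C where C: "0 \<le> C" "\<And>v. cmod (\<Psi> v) \<le> \<eta> + C * v\<^sup>2"
    using levy_exponent_bound[OF levy \<eta>, of b \<sigma>] by auto
  have "(\<lambda>n. C * (suminf s - (\<Sum>k<n. s k))) \<longlonglongrightarrow> C * (suminf s - suminf s)"
    by (intro tendsto_mult tendsto_diff tendsto_const summable_LIMSEQ s)
  then have "\<forall>\<^sub>F n in sequentially. C * (suminf s - (\<Sum>k<n. s k)) < \<epsilon> / 6"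
    by (rule order_tendstoD) (use \<epsilon> in simp)
  then show ?thesis
  proof eventually_elim
    case (elim n)
    define L where "L j \<omega> = sqn (\<lambda>x. indicator K x * (U (r j) x \<omega> - U n x \<omega>))" for j \<omega>
    have ev: "\<forall>\<^sub>F j in sequentially. n \<le> r j"
      using filterlim_subseq[OF r(1)] by (simp add: filterlim_at_top)
    have diff_L2: "L2_fun D (\<lambda>x. indicator K x * (U m x \<omega> - U n x \<omega>))" for m \<omega>
      by (intro L2_fun_indicator L2_fun_diff L2_fun_U Kb)
    have L_nonneg: "0 \<le> L j \<omega>" for j \<omega> unfolding L_def by (rule sqn_nonneg)
    \<comment> \<open>\<open>block_bound\<close> needs \<open>n \<le> r j\<close>. Replacing the
      finitely many earlier blocks by 0 makes every integral bounded and does not affect the limes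
      inferior.\<close>
    define L' where "L' j \<omega> = (if n \<le> r j then L j \<omega> else 0)" for j \<omega>
    have L'_meas [measurable]: "L' j \<in> borel_measurable M" for j
    proof (cases "n \<le> r j")
      case True
      then show ?thesis using block_bound(1)[OF C(2) C(1) less_imp_le[OF \<eta>] Kb True]
        by (simp add: L'_def[abs_def] L_def)
    qed (simp add: L'_def[abs_def])
    have L'_nonneg: "0 \<le> L' j \<omega>" for j \<omega> using L_nonneg by (simp add: L'_def)
    have L'_int: "(\<integral>\<^sup>+\<omega>. ennreal (min 1 (L' j \<omega>)) \<partial>M) \<le> ennreal \<epsilon>" for j
    proof (cases "n \<le> r j")
      case True
      have "(\<integral>\<^sup>+\<omega>. ennreal (min 1 (L' j \<omega>)) \<partial>M) = ennreal (LINT \<omega>|M. min 1 (L' j \<omega>))"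
        using L'_nonneg by (intro nn_integral_eq_integral integrable_const_bound[where B=1]) auto
      also have "(LINT \<omega>|M. min 1 (L' j \<omega>)) \<le> 3 * (\<eta> * vol + C * (\<Sum>k\<in>{n..<r j}. s k))"
        using block_bound(2)[OF C(2) C(1) less_imp_le[OF \<eta>] Kb True] True
        by (simp add: L'_def L_def s_def)
      also have "\<dots> \<le> 3 * (\<epsilon> / 6 + \<epsilon> / 6)"
      proof (rule mult_left_mono[OF add_mono])
        have "\<eta> * vol \<le> \<eta> * V" using \<eta> V by (intro mult_left_mono) auto
        also have "\<dots> = \<epsilon> / 6" using V by (simp add: \<eta>_def)
        finally show "\<eta> * vol \<le> \<epsilon> / 6" .
        have "(\<Sum>k<n. s k) + (\<Sum>k\<in>{n..<r j}. s k) = (\<Sum>k<r j. s k)"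
          using sum.atLeastLessThan_concat[of 0 n "r j" s] True by (simp add: lessThan_atLeast0)
        also have "\<dots> \<le> suminf s" by (intro sum_le_suminf s) auto
        finally have "C * (\<Sum>k\<in>{n..<r j}. s k) \<le> C * (suminf s - (\<Sum>k<n. s k))"
          using C(1) by (intro mult_left_mono) auto
        then show "C * (\<Sum>k\<in>{n..<r j}. s k) \<le> \<epsilon> / 6" using elim by (rule order.trans[OF _ less_imp_le])
      qed simp
      also have "\<dots> = \<epsilon>" by simp
      finally show ?thesis by (simp add: ennreal_leI)
    qed (simp add: L'_def)
    have pointwise: "AE \<omega> in M. min 1 (defect K u n \<omega>) \<le> liminf (\<lambda>j. ennreal (min 1 (L' j \<omega>)))"
      using r(2) AE_space
    proof eventually_elim
      case (elim \<omega>)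
      have [measurable]: "(\<lambda>x. indicator K x * (U m x \<omega> - U n x \<omega>)) \<in> borel_measurable (leb_on D)" for m
        using diff_L2 by (rule L2_fun_borel)
      have "defect K u n \<omega> = (\<integral>\<^sup>+x. liminf (\<lambda>j. ennreal ((indicator K x * (U (r j) x \<omega> - U n x \<omega>))\<^sup>2)) \<partial>leb_on D)"
        unfolding defect_def
      proof (rule nn_integral_cong_AE)
        show "AE x in leb_on D. ennreal ((indicator K x * (u x \<omega> - U n x \<omega>))\<^sup>2)
            = liminf (\<lambda>j. ennreal ((indicator K x * (U (r j) x \<omega> - U n x \<omega>))\<^sup>2))"
          using elim(1)
        proof eventually_elim
          case (elim x)
          then have "(\<lambda>j. ennreal ((indicator K x * (U (r j) x \<omega> - U n x \<omega>))\<^sup>2))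
              \<longlonglongrightarrow> ennreal ((indicator K x * (u x \<omega> - U n x \<omega>))\<^sup>2)"
            by (intro tendsto_ennrealI tendsto_power tendsto_mult tendsto_diff tendsto_const)
          then show ?case by (rule lim_imp_Liminf[OF sequentially_bot, symmetric])
        qed
      qed
      also have "\<dots> \<le> liminf (\<lambda>j. \<integral>\<^sup>+x. ennreal ((indicator K x * (U (r j) x \<omega> - U n x \<omega>))\<^sup>2) \<partial>leb_on D)"
        by (rule nn_integral_liminf) simp
      also have "\<dots> = liminf (\<lambda>j. ennreal (L j \<omega>))"
        unfolding L_def by (subst nn_integral_eq_integral[OF L2_fun_square[OF diff_L2]]) auto
      finally have le: "defect K u n \<omega> \<le> liminf (\<lambda>j. ennreal (L j \<omega>))" .
      \<comment> \<open>The truncation passes through the limes inferior because only levels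
        \<open>y\<close> below 1 have to be tested.\<close>
      show ?case
        unfolding le_Liminf_iff
      proof (intro allI impI)
        fix y assume "y < min 1 (defect K u n \<omega>)"
        then have y: "y < 1" "y < defect K u n \<omega>" by auto
        from y(2) le have "\<forall>\<^sub>F j in sequentially. y < ennreal (L j \<omega>)"
          unfolding le_Liminf_iff by blast
        with ev show "\<forall>\<^sub>F j in sequentially. y < ennreal (min 1 (L' j \<omega>))"
        proof eventually_elim
          case (elim j)
          then show ?case using y(1) by (cases "L j \<omega> \<le> 1") (auto simp: L'_def min_def)
        qed
      qed
    qed
    have "(\<integral>\<^sup>+\<omega>. min 1 (defect K u n \<omega>) \<partial>M) \<le> (\<integral>\<^sup>+\<omega>. liminf (\<lambda>j. ennreal (min 1 (L' j \<omega>))) \<partial>M)"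
      by (rule nn_integral_mono_AE[OF pointwise])
    also have "\<dots> \<le> liminf (\<lambda>j. \<integral>\<^sup>+\<omega>. ennreal (min 1 (L' j \<omega>)) \<partial>M)"
      by (rule nn_integral_liminf) simp
    also have "\<dots> \<le> liminf (\<lambda>j::nat. ennreal \<epsilon>)"
      by (rule Liminf_mono) (simp add: L'_int)
    also have "\<dots> = ennreal \<epsilon>" by (simp add: Liminf_const)
    finally show ?case .
  qed
qed

text \<open>Every \<open>U n\<close> is square integrable, so a defect that is infinite at index 0
  is infinite at all indices. On that event the truncated defect is constantly 1, which
  \<open>defect_small\<close> allows only with probability 0. Index 0 is the right one since
  \<open>U 0\<close> vanishes.\<close>

lemma solution_L2_local:
  assumes u: "mild_solution M D G \<xi> u" and K: "compact K" "K \<subseteq> D"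
  shows "AE \<omega> in M. L2_fun D (\<lambda>x. indicator K x * u x \<omega>)"
proof -
  have Kb: "K \<in> sets borel" using K(1) by (simp add: borel_compact)
  have joint: "(\<lambda>(\<omega>, x). u x \<omega>) \<in> borel_measurable (M \<Otimes>\<^sub>M restrict_space borel D)"
    using u by (simp add: mild_solution_def)
  note [measurable] = measurable_defect[OF joint Kb, of 0]
  have "defect K u n \<omega> = \<infinity>" if "defect K u 0 \<omega> = \<infinity>" "\<omega> \<in> space M" for n \<omega>
  proof (rule ccontr)
    assume fin: "defect K u n \<omega> \<noteq> \<infinity>"
    have [measurable]: "(\<lambda>x. u x \<omega>) \<in> borel_measurable (leb_on D)"
      by (rule measurable_solution_slice(2)[OF joint that(2)])
    have [measurable]: "(\<lambda>x. U n x \<omega>) \<in> borel_measurable (leb_on D)" by (rule L2_fun_borel[OF L2_fun_U])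
    have [measurable]: "(indicator K :: 'a \<Rightarrow> real) \<in> borel_measurable (leb_on D)"
      using Kb by (intro measurable_restrict_space1) simp
    have "integrable (leb_on D) (\<lambda>x. (indicator K x * (u x \<omega> - U n x \<omega>))\<^sup>2)"
      using fin by (intro integrableI_nonneg) (auto simp: defect_def less_top[symmetric])
    then have "L2_fun D (\<lambda>x. indicator K x * (u x \<omega> - U n x \<omega>))" by (simp add: L2_fun_def)
    from L2_fun_add[OF this L2_fun_indicator[OF L2_fun_U[of n \<omega>] Kb]]
    have "L2_fun D (\<lambda>x. indicator K x * u x \<omega>)" by (simp add: algebra_simps)
    from L2_fun_square[OF this] have "defect K u 0 \<omega> < \<infinity>"
      unfolding defect_def by (subst nn_integral_eq_integral) (auto simp: U_def)
    with that(1) show False by simp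
  qed
  note all_inf = this
  define Z where "Z = {\<omega>\<in>space M. defect K u 0 \<omega> = \<infinity>}"
  have Z [measurable]: "Z \<in> sets M" unfolding Z_def by measurable
  have "emeasure M Z \<le> ennreal \<epsilon>" if \<epsilon>: "0 < \<epsilon>" for \<epsilon>
  proof -
    obtain n where n: "(\<integral>\<^sup>+\<omega>. min 1 (defect K u n \<omega>) \<partial>M) \<le> ennreal \<epsilon>"
      using eventually_happens[OF defect_small[OF u K \<epsilon>]] by auto
    have "emeasure M Z = (\<integral>\<^sup>+\<omega>. indicator Z \<omega> \<partial>M)" by simp
    also have "\<dots> \<le> (\<integral>\<^sup>+\<omega>. min 1 (defect K u n \<omega>) \<partial>M)"
      by (rule nn_integral_mono) (auto simp: Z_def indicator_def all_inf)
    finally show ?thesis using n by simp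
  qed
  note small = this
  have "emeasure M Z \<le> 0"
    by (rule ennreal_le_epsilon) (simp only: add_0, rule small)
  then have "Z \<in> null_sets M" using Z by (simp add: null_sets_def)
  then have "AE \<omega> in M. \<omega> \<notin> Z" by (rule AE_not_in)
  with AE_space show ?thesis
  proof eventually_elim
    case (elim \<omega>)
    have [measurable]: "(\<lambda>x. u x \<omega>) \<in> borel_measurable (leb_on D)"
      by (rule measurable_solution_slice(2)[OF joint elim(1)])
    have [measurable]: "(indicator K :: 'a \<Rightarrow> real) \<in> borel_measurable (leb_on D)"
      using Kb by (intro measurable_restrict_space1) simp
    have "defect K u 0 \<omega> \<noteq> \<infinity>" using elim by (simp add: Z_def)
    then have "(\<integral>\<^sup>+x. ennreal ((indicator K x * u x \<omega>)\<^sup>2) \<partial>leb_on D) < \<infinity>"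
      by (simp add: defect_def U_def less_top)
    then have "integrable (leb_on D) (\<lambda>x. (indicator K x * u x \<omega>)\<^sup>2)"
      by (intro integrableI_nonneg) auto
    then show ?case by (simp add: L2_fun_def)
  qed
qed

text \<open>The common approximation of both sides of the generalized identity: for square
  integrable \<phi> it is the inner product of \<open>U n\<close> with \<phi>, and almost surely
  also the noise integral of the truncated potential of \<phi>.\<close>

definition pairing :: "('a \<Rightarrow> real) \<Rightarrow> nat \<Rightarrow> 'w \<Rightarrow> real" where
  "pairing \<phi> n \<omega> = (\<Sum>k<n. (coef k * L2_inner D (e k) \<phi>) * X k \<omega>)"

lemma solution_pairing_conv:
  assumes u: "mild_solution M D G \<xi> u" and K: "compact K" "K \<subseteq> D"
    and \<phi>: "L2_fun D \<phi>" and supp: "\<And>x. x \<notin> K \<Longrightarrow> \<phi> x = 0"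
  shows "conv_in_prob M (pairing \<phi>) (\<lambda>\<omega>. LINT x|leb_on D. u x \<omega> * \<phi> x)"
proof -
  have Kb: "K \<in> sets borel" using K(1) by (simp add: borel_compact)
  have joint: "(\<lambda>(\<omega>, x). u x \<omega>) \<in> borel_measurable (M \<Otimes>\<^sub>M restrict_space borel D)"
    using u by (simp add: mild_solution_def)
  have [measurable]: "\<phi> \<in> borel_measurable (leb_on D)" by (rule L2_fun_borel[OF \<phi>])
  have I_meas [measurable]: "(\<lambda>\<omega>. LINT x|leb_on D. u x \<omega> * \<phi> x) \<in> borel_measurable M"
  proof (rule leb.borel_measurable_lebesgue_integral)
    note [measurable] = measurable_solution_slice(1)[OF joint]
    show "(\<lambda>(\<omega>, x). u x \<omega> * \<phi> x) \<in> borel_measurable (M \<Otimes>\<^sub>M leb_on D)"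
      unfolding case_prod_unfold by measurable
  qed
  have V_meas [measurable]: "pairing \<phi> n \<in> borel_measurable M" for n
    unfolding pairing_def[abs_def] by measurable
  let ?I = "\<lambda>\<omega>. LINT x|leb_on D. u x \<omega> * \<phi> x"
  \<comment> \<open>Adding 1 keeps the factor at least 1, so the Cauchy-Schwarz bound remains valid
    after truncation at 1.\<close>
  let ?A = "1 + sqn \<phi>"
  have A: "1 \<le> ?A" using sqn_nonneg[of \<phi>] by simp
  have pointwise: "AE \<omega> in M. ennreal ((min 1 \<bar>pairing \<phi> n \<omega> - ?I \<omega>\<bar>)\<^sup>2) \<le> ennreal ?A * min 1 (defect K u n \<omega>)" for n
    using solution_L2_local[OF u K]
  proof eventually_elim
    case (elim \<omega>)
    let ?d = "\<lambda>x. indicator K x * (u x \<omega> - U n x \<omega>)"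
    have d_L2: "L2_fun D ?d"
      using L2_fun_diff[OF elim L2_fun_indicator[OF L2_fun_U[of n \<omega>] Kb]] by (simp add: right_diff_distrib)
    have V_eq: "pairing \<phi> n \<omega> = L2_inner D (\<lambda>x. U n x \<omega>) \<phi>"
    proof -
      have "L2_inner D (\<lambda>x. \<Sum>k<n. (coef k * X k \<omega>) * e k x) \<phi> = (\<Sum>k<n. (coef k * X k \<omega>) * L2_inner D (e k) \<phi>)"
        by (intro L2_inner_sum L2_fun_e \<phi>)
      then show ?thesis by (simp add: pairing_def U_def mult_ac)
    qed
    have u_eq: "u x \<omega> * \<phi> x = (indicator K x * u x \<omega>) * \<phi> x"
      and U_eq: "U n x \<omega> * \<phi> x = (indicator K x * U n x \<omega>) * \<phi> x" for x
      using supp[of x] by (auto simp: indicator_def)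
    have "?I \<omega> - pairing \<phi> n \<omega> = L2_inner D (\<lambda>x. indicator K x * u x \<omega>) \<phi>
        + (-1) * L2_inner D (\<lambda>x. indicator K x * U n x \<omega>) \<phi>"
      unfolding V_eq L2_inner_def u_eq[symmetric] U_eq[symmetric] by simp
    also have "\<dots> = L2_inner D (\<lambda>x. indicator K x * u x \<omega> + (-1) * (indicator K x * U n x \<omega>)) \<phi>"
      by (rule L2_inner_linear[OF elim L2_fun_indicator[OF L2_fun_U[of n \<omega>] Kb] \<phi>, symmetric])
    also have "\<dots> = L2_inner D ?d \<phi>" by (simp add: right_diff_distrib)
    finally have "(?I \<omega> - pairing \<phi> n \<omega>)\<^sup>2 \<le> sqn ?d * sqn \<phi>"
      using L2_Cauchy_Schwarz[OF d_L2 \<phi>] by simp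
    also have "\<dots> \<le> ?A * sqn ?d"
      using sqn_nonneg[of ?d] by (simp add: distrib_right mult.commute)
    finally have sq: "(pairing \<phi> n \<omega> - ?I \<omega>)\<^sup>2 \<le> ?A * sqn ?d" by (simp add: power2_commute)
    have "(min 1 \<bar>pairing \<phi> n \<omega> - ?I \<omega>\<bar>)\<^sup>2 \<le> ?A * min 1 (sqn ?d)"
    proof (cases "sqn ?d \<le> 1")
      case True
      have "(min 1 \<bar>pairing \<phi> n \<omega> - ?I \<omega>\<bar>)\<^sup>2 \<le> \<bar>pairing \<phi> n \<omega> - ?I \<omega>\<bar>\<^sup>2" by (intro power_mono) auto
      then show ?thesis using sq True by (simp add: min_def)
    next
      case False
      then have one: "min 1 (sqn ?d) = 1" by simp
      have "(min 1 \<bar>pairing \<phi> n \<omega> - ?I \<omega>\<bar>)\<^sup>2 \<le> 1\<^sup>2" by (intro power_mono) auto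
      also have "\<dots> \<le> ?A * min 1 (sqn ?d)" unfolding one using A by simp
      finally show ?thesis .
    qed
    then have "ennreal ((min 1 \<bar>pairing \<phi> n \<omega> - ?I \<omega>\<bar>)\<^sup>2) \<le> ennreal (?A * min 1 (sqn ?d))"
      by (rule ennreal_leI)
    also have "\<dots> = ennreal ?A * ennreal (min 1 (sqn ?d))"
      using A sqn_nonneg[of ?d] by (intro ennreal_mult) auto
    also have "ennreal (min 1 (sqn ?d)) = min 1 (ennreal (sqn ?d))"
      using sqn_nonneg[of ?d] by (simp add: min_def ennreal_le_1)
    also have "ennreal (sqn ?d) = defect K u n \<omega>"
      unfolding defect_def by (rule nn_integral_eq_integral[OF L2_fun_square[OF d_L2], symmetric]) simp
    finally show ?case .
  qed
  have bound: "\<forall>\<^sub>F n in sequentially. (prob_dist M (pairing \<phi> n) ?I)\<^sup>2 \<le> ?A * \<epsilon>" if \<epsilon>: "0 < \<epsilon>" for \<epsilon>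
    using defect_small[OF u K \<epsilon>]
  proof eventually_elim
    case (elim n)
    note [measurable] = measurable_defect[OF joint Kb, of n]
    have m: "(\<lambda>\<omega>. min 1 \<bar>pairing \<phi> n \<omega> - ?I \<omega>\<bar>) \<in> borel_measurable M" by measurable
    have int: "integrable M (\<lambda>\<omega>. (min 1 \<bar>pairing \<phi> n \<omega> - ?I \<omega>\<bar>)\<^sup>2)"
    proof (rule integrable_const_bound[where B=1])
      show "(\<lambda>\<omega>. (min 1 \<bar>pairing \<phi> n \<omega> - ?I \<omega>\<bar>)\<^sup>2) \<in> borel_measurable M"
        by (rule borel_measurable_power[OF m])
    qed (auto simp: abs_square_le_1)
    have int1: "integrable M (\<lambda>\<omega>. min 1 \<bar>pairing \<phi> n \<omega> - ?I \<omega>\<bar>)"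
      by (rule integrable_const_bound[where B=1]) (use m in auto)
    have "(prob_dist M (pairing \<phi> n) ?I)\<^sup>2 \<le> (LINT \<omega>|M. (min 1 \<bar>pairing \<phi> n \<omega> - ?I \<omega>\<bar>)\<^sup>2)"
      unfolding prob_dist_def by (rule square_expectation_le[OF int1 int])
    then have "ennreal ((prob_dist M (pairing \<phi> n) ?I)\<^sup>2) \<le> (\<integral>\<^sup>+\<omega>. ennreal ((min 1 \<bar>pairing \<phi> n \<omega> - ?I \<omega>\<bar>)\<^sup>2) \<partial>M)"
      by (subst nn_integral_eq_integral[OF int]) (auto intro: ennreal_leI)
    also have "\<dots> \<le> (\<integral>\<^sup>+\<omega>. ennreal ?A * min 1 (defect K u n \<omega>) \<partial>M)"
      by (rule nn_integral_mono_AE[OF pointwise])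
    also have "\<dots> = ennreal ?A * (\<integral>\<^sup>+\<omega>. min 1 (defect K u n \<omega>) \<partial>M)"
      by (rule nn_integral_cmult) measurable
    also have "\<dots> \<le> ennreal ?A * ennreal \<epsilon>" by (rule mult_left_mono[OF elim]) simp
    also have "\<dots> = ennreal (?A * \<epsilon>)" using A \<epsilon> by (intro ennreal_mult[symmetric]) auto
    finally show ?case
    proof (subst (asm) ennreal_le_iff)
      show "0 \<le> ?A * \<epsilon>" using A \<epsilon> by simp
    qed
  qed
  have "(\<lambda>n. prob_dist M (pairing \<phi> n) ?I) \<longlonglongrightarrow> 0"
  proof (rule order_tendstoI)
    fix a :: real assume "a < 0"
    then show "\<forall>\<^sub>F n in sequentially. a < prob_dist M (pairing \<phi> n) ?I"
      by (intro always_eventually allI) (rule less_le_trans[OF _ prob_dist_nonneg])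
  next
    fix a :: real assume a: "0 < a"
    \<comment> \<open>Chosen so that the bound \<open>?A * \<epsilon>\<close> for the squared
      distance is the square of \<open>a / 2\<close>.\<close>
    define \<epsilon> where "\<epsilon> = (a / 2)\<^sup>2 / ?A"
    have A0: "0 < ?A" using A by (rule less_le_trans[OF zero_less_one])
    have \<epsilon>: "0 < \<epsilon>" unfolding \<epsilon>_def by (rule divide_pos_pos[OF _ A0]) (use a in simp)
    have eq: "?A * \<epsilon> = (a / 2)\<^sup>2"
      unfolding \<epsilon>_def times_divide_eq_right
      by (rule nonzero_mult_div_cancel_left[OF less_imp_neq[OF A0, symmetric]])
    from bound[OF \<epsilon>] show "\<forall>\<^sub>F n in sequentially. prob_dist M (pairing \<phi> n) ?I < a"
    proof eventually_elim
      case (elim n)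
      then have "prob_dist M (pairing \<phi> n) ?I \<le> a / 2"
        unfolding eq by (rule power2_le_imp_le) (use a in simp)
      also have "\<dots> < a" using a by simp
      finally show ?case .
    qed
  qed
  then show ?thesis unfolding conv_in_prob_iff using V_meas I_meas by blast
qed

text \<open>The coefficients \<open>p\<close> are square summable because \<open>coef\<close> is
  bounded, so the sums \<open>P n\<close> are Cauchy in L2. Convergence of \<open>Gsum n x\<close>
  to \<open>G x\<close> identifies their pointwise limit as the integral \<open>\<psi>\<close>, and
  Fatou's lemma carries the Cauchy modulus over to it.\<close>

lemma green_potential:
  assumes \<phi>: "L2_fun D \<phi>"
  defines "\<psi> \<equiv> \<lambda>x. LINT y|leb_on D. G x y * \<phi> y"
  shows "L2_fun D \<psi>" and "conv_in_prob M (pairing \<phi>) (NI \<psi>)"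
proof -
  define p where "p k = coef k * L2_inner D (e k) \<phi>" for k
  define P where "P n x = (\<Sum>k<n. p k * e k x)" for n x
  have P: "L2_fun D (P n)" for n unfolding P_def[abs_def] by (intro L2_fun_sum L2_fun_e)
  have lim: "(\<lambda>n. P n x) \<longlonglongrightarrow> \<psi> x" if x: "x \<in> D" for x
  proof -
    have "(\<lambda>n. L2_inner D (Gsum n x) \<phi>) \<longlonglongrightarrow> L2_inner D (G x) \<phi>"
      by (rule L2_inner_tendsto[OF L2_fun_Gsum green_spec(1)[OF x] \<phi> green_tendsto[OF x]])
    moreover have "L2_inner D (Gsum n x) \<phi> = P n x" for n
    proof -
      have "L2_inner D (Gsum n x) \<phi> = (\<Sum>k<n. (coef k * e k x) * L2_inner D (e k) \<phi>)"
        unfolding Gsum_def[abs_def] by (intro L2_inner_sum L2_fun_e \<phi>)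
      then show ?thesis by (simp add: P_def p_def mult_ac)
    qed
    ultimately show ?thesis by (simp add: \<psi>_def L2_inner_def)
  qed
  have \<psi>_meas: "\<psi> \<in> borel_measurable (leb_on D)"
    by (rule borel_measurable_LIMSEQ_real[where u=P]) (use lim L2_fun_borel[OF P] in \<open>auto simp: space_leb_on\<close>)
  \<comment> \<open>The coefficients tend to 0, since \<open>lam\<close> tends to infinity and
    \<gamma> is positive.\<close>
  obtain B where B: "\<And>k. (coef k)\<^sup>2 \<le> B" "0 \<le> B"
  proof -
    have "0 \<le> real DIM('a) / 4" by simp
    with \<gamma> have \<gamma>0: "0 < \<gamma>" by linarith
    have "(\<lambda>k. coef k) \<longlonglongrightarrow> 0"
      unfolding coef_def by (rule tendsto_neg_powr[OF _ lam_at_top]) (use \<gamma>0 in simp)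
    then have "Bseq coef" by (intro convergent_imp_Bseq) (auto simp: convergent_def)
    then obtain b where b: "0 < b" "\<And>k. norm (coef k) \<le> b" by (auto elim: BseqE)
    have "(coef k)\<^sup>2 \<le> b\<^sup>2" for k using power_mono[OF b(2)[of k], of 2] by simp
    then show ?thesis using that[of "b\<^sup>2"] by simp
  qed
  have p_sum: "summable (\<lambda>k. (p k)\<^sup>2)"
  proof (rule summableI_nonneg_bounded)
    show "(\<Sum>k<n. (p k)\<^sup>2) \<le> B * sqn \<phi>" for n
    proof -
      have "(\<Sum>k<n. (p k)\<^sup>2) \<le> (\<Sum>k<n. B * (L2_inner D \<phi> (e k))\<^sup>2)"
        unfolding p_def power_mult_distrib L2_inner_commute[of "e _"]
        by (intro sum_mono mult_right_mono B) simp
      also have "\<dots> \<le> B * sqn \<phi>"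
        unfolding sum_distrib_left[symmetric] by (intro mult_left_mono Bessel \<phi> B) simp
      finally show ?thesis .
    qed
  qed simp
  define \<delta> where "\<delta> n = (\<Sum>k. (p k)\<^sup>2) - (\<Sum>k<n. (p k)\<^sup>2)" for n
  have \<delta>: "\<delta> \<longlonglongrightarrow> 0"
    using tendsto_diff[OF tendsto_const[of "\<Sum>k. (p k)\<^sup>2"] summable_LIMSEQ[OF p_sum]] by (simp add: \<delta>_def[abs_def])
  have block: "sqn (\<lambda>x. P m x - P n x) \<le> \<delta> n" if "n \<le> m" for n m
  proof -
    have "P m x - P n x = (\<Sum>k\<in>{n..<m}. p k * e k x)" for x
      using that sum.atLeastLessThan_concat[of 0 n m "\<lambda>k. p k * e k x"] by (simp add: P_def lessThan_atLeast0)
    then have "sqn (\<lambda>x. P m x - P n x) = (\<Sum>k\<in>{n..<m}. (p k)\<^sup>2)"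
      by (simp only: sqn_lincomb[OF finite_atLeastLessThan])
    moreover have "(\<Sum>k<n. (p k)\<^sup>2) + (\<Sum>k\<in>{n..<m}. (p k)\<^sup>2) = (\<Sum>k<m. (p k)\<^sup>2)"
      using that sum.atLeastLessThan_concat[of 0 n m "\<lambda>k. (p k)\<^sup>2"] by (simp add: lessThan_atLeast0)
    moreover have "(\<Sum>k<m. (p k)\<^sup>2) \<le> (\<Sum>k. (p k)\<^sup>2)" by (intro sum_le_suminf p_sum) auto
    ultimately show ?thesis unfolding \<delta>_def by linarith
  qed
  have diff: "L2_fun D (\<lambda>x. \<psi> x - P n x) \<and> sqn (\<lambda>x. \<psi> x - P n x) \<le> \<delta> n" for n
  proof -
    have L2: "L2_fun D (\<lambda>x. P m x - P n x)" for m by (intro L2_fun_diff P)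
    have meas: "(\<lambda>x. \<psi> x - P n x) \<in> borel_measurable (leb_on D)"
      by (intro borel_measurable_diff \<psi>_meas L2_fun_borel P)
    have ae: "AE x in leb_on D. (\<lambda>m. P m x - P n x) \<longlonglongrightarrow> \<psi> x - P n x"
      by (rule AE_I2, rule tendsto_diff[OF lim tendsto_const]) (simp add: space_leb_on)
    have ev: "\<forall>\<^sub>F m in sequentially. sqn (\<lambda>x. P m x - P n x) \<le> \<delta> n"
      using eventually_ge_at_top[of n] by eventually_elim (rule block)
    show ?thesis using L2_fatou[OF L2 meas ae ev] by blast
  qed
  then show \<psi>: "L2_fun D \<psi>" using L2_fun_add[OF conjunct1[OF diff[of 0]] P[of 0]] by simp
  have "(\<lambda>n. sqn (\<lambda>x. P n x - \<psi> x)) \<longlonglongrightarrow> 0"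
  proof (rule Lim_null_comparison[OF _ \<delta>], rule always_eventually, rule allI)
    show "norm (sqn (\<lambda>x. P n x - \<psi> x)) \<le> \<delta> n" for n
      using conjunct2[OF diff[of n]] sqn_nonneg by (simp add: power2_commute[of "P _ _"])
  qed
  then have conv: "conv_in_prob M (\<lambda>n. NI (P n)) (NI \<psi>)" by (rule noise_integral_L2_tendsto[OF P \<psi>])
  show "conv_in_prob M (pairing \<phi>) (NI \<psi>)"
  proof (rule conv_in_prob_cong_AE[OF conv])
    show "pairing \<phi> n \<in> borel_measurable M" for n unfolding pairing_def[abs_def] by measurable
    show "NI \<psi> \<in> borel_measurable M" by (rule measurable_noise_integral[OF \<psi>])
    show "AE \<omega> in M. NI (P n) \<omega> = pairing \<phi> n \<omega>" for n
      using noise_integral_sum[of "{..<n}" e p, OF finite_lessThan L2_fun_e]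
      unfolding P_def[abs_def] pairing_def p_def X_def .
  qed simp
qed

text \<open>\<open>pairing\<close> converges in probability to both sides, and such limits are
  almost surely unique. The compact support of the test function confines the left side to a set on
  which \<open>u\<close> is square integrable.\<close>

lemma mild_solution_is_generalized:
  assumes u: "mild_solution M D G \<xi> u"
  shows "generalized_solution M D G \<xi> u"
  unfolding generalized_solution_def
proof (intro allI impI)
  fix \<phi> assume test: "test_function D \<phi>"
  define K where "K = closure {x. \<phi> x \<noteq> 0}"
  have K: "compact K" "K \<subseteq> D" using test by (auto simp: test_function_def K_def)
  have supp: "\<phi> x = 0" if "x \<notin> K" for x using that closure_subset[of "{x. \<phi> x \<noteq> 0}"] by (auto simp: K_def)
  have "Ck_on 0 \<phi> UNIV" using test unfolding test_function_def smooth_on_def by blast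
  then have cont: "continuous_on UNIV \<phi>" by simp
  have "bounded (\<phi> ` K)"
    by (intro compact_imp_bounded compact_continuous_image K continuous_on_subset[OF cont]) simp
  then obtain B where B: "\<And>x. x \<in> K \<Longrightarrow> \<bar>\<phi> x\<bar> \<le> B" by (auto simp: bounded_iff)
  have \<phi>: "L2_fun D \<phi>"
  proof (rule L2_fun_bounded)
    show "\<phi> \<in> borel_measurable (leb_on D)"
      using borel_measurable_continuous_onI[OF cont] by (intro measurable_restrict_space1) simp
    show "\<bar>\<phi> x\<bar> \<le> max 0 B" for x using B[of x] supp[of x] by (cases "x \<in> K") auto
  qed
  have "AE \<omega> in M. (LINT x|leb_on D. u x \<omega> * \<phi> x) = NI (\<lambda>x. LINT y|leb_on D. G x y * \<phi> y) \<omega>"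
    by (rule conv_in_prob_unique[OF solution_pairing_conv[OF u K \<phi> supp] green_potential(2)[OF \<phi>]])
  moreover have "AE \<omega> in M. integrable (leb_on D) (\<lambda>x. u x \<omega> * \<phi> x)"
    using solution_L2_local[OF u K]
  proof eventually_elim
    case (elim \<omega>)
    have eq: "u x \<omega> * \<phi> x = (indicator K x * u x \<omega>) * \<phi> x" for x using supp[of x] by (auto simp: indicator_def)
    show ?case unfolding eq by (rule L2_fun_mult[OF elim \<phi>])
  qed
  ultimately show "noise_integrable M D \<xi> (\<lambda>x. LINT y|leb_on D. G x y * \<phi> y) \<and>
      (AE \<omega> in M. integrable (leb_on D) (\<lambda>x. u x \<omega> * \<phi> x) \<and>
        (LINT x|leb_on D. u x \<omega> * \<phi> x) = NI (\<lambda>x. LINT y|leb_on D. G x y * \<phi> y) \<omega>)"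
    using noise_integrable_L2[OF green_potential(1)[OF \<phi>]] by (auto intro: eventually_conj)
qed

end

theorem theorem3p5:
  fixes M :: "'w measure"
    and D :: "'a::euclidean_space set"
    and e :: "nat \<Rightarrow> 'a \<Rightarrow> real" and lam :: "nat \<Rightarrow> real"
    and \<gamma> b \<sigma> :: real and \<nu> :: "real measure"
    and \<xi> :: "'a set \<Rightarrow> 'w \<Rightarrow> real"
  assumes "prob_space M"
    and "complete_measure M"
    and "smooth_bounded_domain D"
    and "dirichlet_eigenbasis D e lam"
    and "\<gamma> > real DIM('a) / 4"
    and "symmetric_levy_noise M D b \<sigma> \<nu> \<xi>"
  defines "G \<equiv> green D e lam \<gamma>"
  shows "(\<exists>u. mild_solution M D G \<xi> u) \<and>
         (\<forall>u v. mild_solution M D G \<xi> u \<and> mild_solution M D G \<xi> v \<longrightarrow> modification_of M D u v) \<and>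
         (\<forall>u. mild_solution M D G \<xi> u \<longrightarrow> generalized_solution M D G \<xi> u)"
proof -
  interpret prob_space M by fact
  have "open D" "bounded D" using assms(3) by (auto simp: smooth_bounded_domain_def)
  then interpret levy_dirichlet_problem M D e lam \<gamma> b \<sigma> \<nu> \<xi>
    using assms by unfold_locales auto
  show ?thesis
    unfolding G_def
    using mild_solution_exists mild_solution_unique mild_solution_is_generalized by blast
qed

end
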